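(* Let $F$ be an algebraically closed field of characteristic $0$, let $H$ be an associative $F$-algebra with $1$, not necessarily finite dimensional, and let $A$ be a finite dimensional non-nilpotent associative $F$-algebra with a generalized $H$-action. Suppose that the Jacobson radical $J:=J(A)$ is $H$-invariant and that $A=B\oplus J$ (direct sum of $H$-submodules), where $B$ is a subalgebra of $A$ with $B=B_1\oplus\ldots\oplus B_q$ (direct sum of $H$-invariant ideals of $B$), the $B_i$ being $H$-simple semisimple algebras. Let $$d:=\max\left(\dim(B_{i_1}\oplus B_{i_2}\oplus\ldots\oplus B_{i_r})\ \middle|\ B_{i_1}JB_{i_2}J\ldots JB_{i_r}\ne 0,\ 1\leqslant i_k\leqslant q,\ 1\leqslant k\leqslant r;\ 0\leqslant r\leqslant q\right).$$ Then there exist constants $C_1,C_2>0$, $r_1,r_2\in\mathbb R$ such that $$C_1n^{r_1}d^n\leqslant c^H_n(A)\leqslant C_2n^{r_2}d^n\quad\text{for all } n\in\mathbb N.$$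
   Context: Associative algebras $A$ are not assumed unital; $\mathbb N=\{1,2,\ldots\}$. An associative algebra $A$ has a generalized $H$-action if it is endowed with a homomorphism of unital algebras $H\to \mathrm{End}_F(A)$ and for every $h\in H$ there exist finitely many $h_i',h_i'',h_i''',h_i''''\in H$ such that $h(ab)=\sum_i\bigl((h_i'a)(h_i''b)+(h_i'''b)(h_i''''a)\bigr)$ for all $a,b\in A$. An algebra is $H$-simple if its multiplication is nonzero and its only $H$-invariant two-sided ideals are $0$ and itself. Codimensions. Let $F\langle X\rangle=\bigoplus_{n\geqslant1}F\langle X\rangle^{(n)}$ be the free associative algebra without $1$ on $X=\{x_1,x_2,\ldots\}$, with $F\langle X\rangle^{(n)}$ spanned by the monomials of degree $n$. Let $F\langle X|H\rangle:=\bigoplus_{n\geqslant 1}H^{\otimes n}\otimes F\langle X\rangle^{(n)}$ with multiplication $(u_1\otimes w_1)(u_2\otimes w_2)=(u_1\otimes u_2)\otimes w_1w_2$, and write $x_{i_1}^{h_1}\cdots x_{i_n}^{h_n}:=(h_1\otimes\cdots\otimes h_n)\otimes x_{i_1}\cdots x_{i_n}$. Any map $\psi:X\to A$ extends uniquely to an algebra homomorphism $\bar\psi:F\langle X|H\rangle\to A$ with $\bar\psi(x_i^h)=h\psi(x_i)$. Let $\mathrm{Id}^H(A)$ be the set of $f\in F\langle X|H\rangle$ with $\bar\psi(f)=0$ for all $\psi$. Let $P_n^H$ be the linear span of all $x_{\sigma(1)}^{h_1}\cdots x_{\sigma(n)}^{h_n}$, $h_i\in H$, $\sigma\in S_n$.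 The $n$th $H$-codimension of $A$ is $c_n^H(A):=\dim\bigl(P_n^H/(P_n^H\cap \mathrm{Id}^H(A))\bigr)$. Equivalently, it is the dimension of the subspace of $\mathrm{Hom}_F(A^{\otimes n};A)$ of $n$-linear functions represented by elements of $P_n^H$. In the definition of $d$, for $r=1$ the condition reads $B_{i_1}\neq 0$; the case $r=0$ contributes the value $0$; the $i_k$ are taken distinct (so that the sum of the $B_{i_k}$ is direct). *)

theory Defs
  imports
    Complex_Main
    "HOL-Library.Poly_Mapping"
    "HOL-Combinatorics.Permutations"
    "HOL-Computational_Algebra.Polynomial"
begin

section \<open>Associative algebras over a field\<close>

text \<open>
  The type class \<open>ring\<close> is that of associative, not necessarily unital rings.
\<close>

locale assoc_algebra = vector_space scale
  for scale :: "'f::field \<Rightarrow> 'a::ring \<Rightarrow> 'a" +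
  assumes scale_mult_left: "scale c (x * y) = scale c x * y"
    and scale_mult_right: "scale c (x * y) = x * scale c y"

definition finite_dim :: "('f::field \<Rightarrow> 'a::ab_group_add \<Rightarrow> 'a) \<Rightarrow> bool" where
  "finite_dim scale \<longleftrightarrow> (\<exists>S. finite S \<and> module.span scale S = UNIV)"

definition subalgebra :: "('f::field \<Rightarrow> 'a::ring \<Rightarrow> 'a) \<Rightarrow> 'a set \<Rightarrow> bool" where
  "subalgebra scale S \<longleftrightarrow>
     module.subspace scale S \<and> (\<forall>x\<in>S. \<forall>y\<in>S. x * y \<in> S)"

definition left_ideal :: "('f::field \<Rightarrow> 'a::ring \<Rightarrow> 'a) \<Rightarrow> 'a set \<Rightarrow> 'a set \<Rightarrow> bool" where
  "left_ideal scale S L \<longleftrightarrow>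
     module.subspace scale L \<and> L \<subseteq> S \<and> (\<forall>s\<in>S. \<forall>x\<in>L. s * x \<in> L)"

definition two_sided_ideal :: "('f::field \<Rightarrow> 'a::ring \<Rightarrow> 'a) \<Rightarrow> 'a set \<Rightarrow> 'a set \<Rightarrow> bool" where
  "two_sided_ideal scale S I \<longleftrightarrow>
     module.subspace scale I \<and> I \<subseteq> S \<and> (\<forall>s\<in>S. \<forall>x\<in>I. s * x \<in> I \<and> x * s \<in> I)"

definition modular_left_ideal :: "('f::field \<Rightarrow> 'a::ring \<Rightarrow> 'a) \<Rightarrow> 'a set \<Rightarrow> 'a set \<Rightarrow> bool" where
  "modular_left_ideal scale S L \<longleftrightarrow>
     left_ideal scale S L \<and> (\<exists>e\<in>S. \<forall>s\<in>S. s - s * e \<in> L)"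

definition maximal_modular_left_ideal ::
    "('f::field \<Rightarrow> 'a::ring \<Rightarrow> 'a) \<Rightarrow> 'a set \<Rightarrow> 'a set \<Rightarrow> bool" where
  "maximal_modular_left_ideal scale S L \<longleftrightarrow>
     modular_left_ideal scale S L \<and> L \<noteq> S \<and>
     (\<forall>L'. left_ideal scale S L' \<and> L \<subseteq> L' \<longrightarrow> L' = L \<or> L' = S)"

text \<open>
  The Jacobson radical of a not necessarily unital algebra is the intersection of its maximal
  modular left ideals; it is the whole algebra if there are none.
\<close>

definition jacobson_radical :: "('f::field \<Rightarrow> 'a::ring \<Rightarrow> 'a) \<Rightarrow> 'a set \<Rightarrow> 'a set" where
  "jacobson_radical scale S =
     {x \<in> S. \<forall>L. maximal_modular_left_ideal scale S L \<longrightarrow> x \<in> L}"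

text \<open>To be used for finite dimensional algebras only.\<close>

definition semisimple_algebra :: "('f::field \<Rightarrow> 'a::ring \<Rightarrow> 'a) \<Rightarrow> 'a set \<Rightarrow> bool" where
  "semisimple_algebra scale S \<longleftrightarrow> jacobson_radical scale S = {0}"

text \<open>
  There is no unit to start from, so the product of the empty list carries no meaning; it is
  never used below.
\<close>

fun list_product :: "'a::ring list \<Rightarrow> 'a" where
  "list_product [] = 0"
| "list_product [x] = x"
| "list_product (x # y # zs) = x * list_product (y # zs)"

definition nilpotent_algebra :: "'a::ring set \<Rightarrow> bool" where
  "nilpotent_algebra S \<longleftrightarrow>
     (\<exists>n\<ge>1. \<forall>xs. length xs = n \<and> set xs \<subseteq> S \<longrightarrow> list_product xs = 0)"

definition direct_sum_of ::
    "'a::ab_group_add set \<Rightarrow> 'i set \<Rightarrow> ('i \<Rightarrow> 'a set) \<Rightarrow> bool" where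
  "direct_sum_of S I U \<longleftrightarrow>
     S = {\<Sum>i\<in>I. f i | f. \<forall>i\<in>I. f i \<in> U i} \<and>
     (\<forall>f. (\<forall>i\<in>I. f i \<in> U i) \<and> (\<Sum>i\<in>I. f i) = 0 \<longrightarrow> (\<forall>i\<in>I. f i = 0))"

section \<open>Generalized actions\<close>

text \<open>
  The class \<open>ring_1\<close> excludes the zero ring. This is no restriction: the zero algebra acts
  unitally on the zero algebra only.
\<close>

locale generalized_action =
  H: assoc_algebra scaleH + A: assoc_algebra scaleA
  for scaleH :: "'f::field \<Rightarrow> 'h::ring_1 \<Rightarrow> 'h"
    and scaleA :: "'f \<Rightarrow> 'a::ring \<Rightarrow> 'a" +
  fixes act :: "'h \<Rightarrow> 'a \<Rightarrow> 'a"
  assumes act_add_right: "act h (a + b) = act h a + act h b"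
    and act_scale_right: "act h (scaleA c a) = scaleA c (act h a)"
    and act_add_left: "act (h + k) a = act h a + act k a"
    and act_scale_left: "act (scaleH c h) a = scaleA c (act h a)"
    and act_mult: "act (h * k) a = act h (act k a)"
    and act_one: "act 1 a = a"
    and act_product:
      "\<exists>ts :: ('h \<times> 'h \<times> 'h \<times> 'h) list. \<forall>a b. act h (a * b) =
         (\<Sum>(h1, h2, h3, h4) \<leftarrow> ts. act h1 a * act h2 b + act h3 b * act h4 a)"

definition invariant :: "('h \<Rightarrow> 'a \<Rightarrow> 'a) \<Rightarrow> 'a set \<Rightarrow> bool" where
  "invariant act S \<longleftrightarrow> (\<forall>h. \<forall>a\<in>S. act h a \<in> S)"

definition H_simple ::
    "('f::field \<Rightarrow> 'a::ring \<Rightarrow> 'a) \<Rightarrow> ('h \<Rightarrow> 'a \<Rightarrow> 'a) \<Rightarrow> 'a set \<Rightarrow> bool" where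
  "H_simple scale act S \<longleftrightarrow>
     (\<exists>x\<in>S. \<exists>y\<in>S. x * y \<noteq> 0) \<and>
     (\<forall>I. two_sided_ideal scale S I \<and> invariant act I \<longrightarrow> I = {0} \<or> I = S)"

section \<open>Quotient dimension\<close>

text \<open>
  \<open>quotient_basis scale U V S\<close>: the cosets of the elements of \<open>S\<close> are pairwise distinct and form
  a basis of the quotient space \<open>U / V\<close>. As for the library's \<open>dim\<close>, the dimension is \<open>0\<close>
  if it is infinite.
\<close>

definition quotient_basis ::
    "('f::field \<Rightarrow> 'v::ab_group_add \<Rightarrow> 'v) \<Rightarrow> 'v set \<Rightarrow> 'v set \<Rightarrow> 'v set \<Rightarrow> bool" where
  "quotient_basis scale U V S \<longleftrightarrow>
     S \<subseteq> U \<and>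
     (\<forall>T c. finite T \<and> T \<subseteq> S \<and> (\<Sum>v\<in>T. scale (c v) v) \<in> V \<longrightarrow> (\<forall>v\<in>T. c v = 0)) \<and>
     (\<forall>u\<in>U. \<exists>s \<in> module.span scale S. u - s \<in> V)"

definition quotient_dim ::
    "('f::field \<Rightarrow> 'v::ab_group_add \<Rightarrow> 'v) \<Rightarrow> 'v set \<Rightarrow> 'v set \<Rightarrow> nat" where
  "quotient_dim scale U V =
     (if \<exists>S. quotient_basis scale U V S then card (SOME S. quotient_basis scale U V S) else 0)"

section \<open>\<open>H\<close>-polynomials, \<open>H\<close>-identities and \<open>H\<close>-codimensions\<close>

text \<open>
  The word \<open>[(i\<^sub>1, h\<^sub>1), \<dots>, (i\<^sub>n, h\<^sub>n)]\<close> stands for the monomial with variables \<open>x\<close> of indices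
  \<open>i\<^sub>1, \<dots>, i\<^sub>n\<close> decorated by \<open>h\<^sub>1, \<dots>, h\<^sub>n\<close>. The algebra \<open>F\<langle>X|H\<rangle>\<close>, the sum over \<open>n \<ge> 1\<close> of the
  spaces \<open>H\<^sup>\<otimes>\<^sup>n \<otimes> F\<langle>X\<rangle>\<^sup>(\<^sup>n\<^sup>)\<close>, is the free vector space \<open>hpolys\<close> on the nonempty words modulo the span
  of \<open>tensor_relations\<close>, which express that words are linear in each decoration.
  Subspaces of \<open>F\<langle>X|H\<rangle>\<close> are represented by their full preimages in \<open>hpolys\<close>.
\<close>

type_synonym ('f, 'h) hpoly = "(nat \<times> 'h) list \<Rightarrow>\<^sub>0 'f"

definition hscale :: "'f::field \<Rightarrow> ('f, 'h) hpoly \<Rightarrow> ('f, 'h) hpoly" where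
  "hscale c f = Poly_Mapping.map ((*) c) f"

definition monomial :: "(nat \<times> 'h) list \<Rightarrow> ('f::field, 'h) hpoly" where
  "monomial w = Poly_Mapping.single w 1"

definition hwords :: "(nat \<times> 'h) list set" where
  "hwords = {w. w \<noteq> [] \<and> (\<forall>(i, h) \<in> set w. i \<ge> 1)}"

definition hpolys :: "('f::field, 'h) hpoly set" where
  "hpolys = module.span hscale (monomial ` hwords)"

definition tensor_relations ::
    "('f::field \<Rightarrow> 'h::ab_group_add \<Rightarrow> 'h) \<Rightarrow> ('f, 'h) hpoly set" where
  "tensor_relations scaleH =
     {monomial (u @ (i, h + k) # v) - monomial (u @ (i, h) # v) - monomial (u @ (i, k) # v)
        | u v i h k. u @ (i, h) # v \<in> hwords} \<union>
     {monomial (u @ (i, scaleH c h) # v) - hscale c (monomial (u @ (i, h) # v))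
        | u v i c h. u @ (i, h) # v \<in> hwords}"

text \<open>
  On the class of a polynomial, \<open>heval\<close> is the algebra homomorphism to \<open>A\<close> that extends the
  substitution \<open>\<psi>\<close>; see \<open>eval_word_append\<close> and \<open>tensor_relations_identities\<close> below.
\<close>

definition eval_word :: "('h \<Rightarrow> 'a::ring \<Rightarrow> 'a) \<Rightarrow> (nat \<Rightarrow> 'a) \<Rightarrow> (nat \<times> 'h) list \<Rightarrow> 'a" where
  "eval_word act \<psi> w = list_product (map (\<lambda>(i, h). act h (\<psi> i)) w)"

definition heval ::
    "('f::field \<Rightarrow> 'a::ring \<Rightarrow> 'a) \<Rightarrow> ('h \<Rightarrow> 'a \<Rightarrow> 'a) \<Rightarrow> (nat \<Rightarrow> 'a) \<Rightarrow> ('f, 'h) hpoly \<Rightarrow> 'a" where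
  "heval scaleA act \<psi> f =
     (\<Sum>w \<in> Poly_Mapping.keys f. scaleA (Poly_Mapping.lookup f w) (eval_word act \<psi> w))"

definition H_identities ::
    "('f::field \<Rightarrow> 'a::ring \<Rightarrow> 'a) \<Rightarrow> ('h \<Rightarrow> 'a \<Rightarrow> 'a) \<Rightarrow> ('f, 'h) hpoly set" where
  "H_identities scaleA act = {f \<in> hpolys. \<forall>\<psi>. heval scaleA act \<psi> f = 0}"

definition multilinear_words :: "nat \<Rightarrow> (nat \<times> 'h) list set" where
  "multilinear_words n = {w. \<exists>\<sigma>. \<sigma> permutes {1..n} \<and> map fst w = map \<sigma> [1..<Suc n]}"

definition multilinear_hpolys ::
    "('f::field \<Rightarrow> 'h::ab_group_add \<Rightarrow> 'h) \<Rightarrow> nat \<Rightarrow> ('f, 'h) hpoly set" where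
  "multilinear_hpolys scaleH n =
     module.span hscale (monomial ` multilinear_words n \<union> tensor_relations scaleH)"

definition H_codim ::
    "('f::field \<Rightarrow> 'h::ab_group_add \<Rightarrow> 'h) \<Rightarrow> ('f \<Rightarrow> 'a::ring \<Rightarrow> 'a) \<Rightarrow>
     ('h \<Rightarrow> 'a \<Rightarrow> 'a) \<Rightarrow> nat \<Rightarrow> nat" where
  "H_codim scaleH scaleA act n =
     quotient_dim hscale (multilinear_hpolys scaleH n)
       (multilinear_hpolys scaleH n \<inter> H_identities scaleA act)"

lemma list_product_append:
  "xs \<noteq> [] \<Longrightarrow> ys \<noteq> [] \<Longrightarrow> list_product (xs @ ys) = list_product xs * list_product ys"
proof (induction xs rule: list_product.induct)
  case (2 x)
  then show ?case by (cases ys) auto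
qed (auto simp: mult.assoc)

lemma eval_word_append:
  "u \<noteq> [] \<Longrightarrow> v \<noteq> [] \<Longrightarrow>
     eval_word act \<psi> (u @ v) = eval_word act \<psi> u * eval_word act \<psi> v"
  by (simp add: eval_word_def list_product_append)

lemma lookup_hscale [simp]:
  "Poly_Mapping.lookup (hscale c f) w = c * Poly_Mapping.lookup f w"
  by (simp add: hscale_def Poly_Mapping.map.rep_eq when_def)

lemma vector_space_hscale: "vector_space hscale"
  by unfold_locales (auto intro!: poly_mapping_eqI simp: lookup_add algebra_simps)

lemma eval_word_cons:
  "v \<noteq> [] \<Longrightarrow> eval_word act \<psi> ((i, h) # v) = act h (\<psi> i) * eval_word act \<psi> v"
  by (cases v) (auto simp: eval_word_def)

lemma eval_word_single [simp]: "eval_word act \<psi> [(i, h)] = act h (\<psi> i)"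
  by (simp add: eval_word_def)

context generalized_action
begin

lemma heval_eq:
  assumes "finite K" "Poly_Mapping.keys f \<subseteq> K"
  shows "heval scaleA act \<psi> f =
    (\<Sum>w\<in>K. scaleA (Poly_Mapping.lookup f w) (eval_word act \<psi> w))"
  unfolding heval_def using assms
  by (intro sum.mono_neutral_left) (auto simp: in_keys_iff)

lemma heval_diff: "heval scaleA act \<psi> (f - g) = heval scaleA act \<psi> f - heval scaleA act \<psi> g"
proof -
  let ?K = "Poly_Mapping.keys f \<union> Poly_Mapping.keys g"
  have "Poly_Mapping.keys (f - g) \<subseteq> ?K"
    by (auto simp: in_keys_iff lookup_minus)
  then show ?thesis
    by (simp add: heval_eq[of ?K] lookup_minus A.scale_left_diff_distrib sum_subtractf)
qed

lemma heval_hscale: "heval scaleA act \<psi> (hscale c f) = scaleA c (heval scaleA act \<psi> f)"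
proof -
  have "Poly_Mapping.keys (hscale c f) \<subseteq> Poly_Mapping.keys f"
    by (auto simp: in_keys_iff)
  then show ?thesis
    by (simp add: heval_eq[of "Poly_Mapping.keys f"] A.scale_sum_right)
qed

lemma heval_monomial [simp]: "heval scaleA act \<psi> (monomial w) = eval_word act \<psi> w"
  by (simp add: heval_def monomial_def)

lemma eval_word_add:
  "eval_word act \<psi> (u @ (i, h + k) # v) =
     eval_word act \<psi> (u @ (i, h) # v) + eval_word act \<psi> (u @ (i, k) # v)"
proof -
  have "eval_word act \<psi> ((i, h + k) # v) = eval_word act \<psi> ((i, h) # v) + eval_word act \<psi> ((i, k) # v)"
    by (cases "v = []") (simp_all add: eval_word_cons act_add_left distrib_right)
  then show ?thesis
    by (cases "u = []") (simp_all add: eval_word_append distrib_left)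
qed

lemma eval_word_scale:
  "eval_word act \<psi> (u @ (i, scaleH c h) # v) = scaleA c (eval_word act \<psi> (u @ (i, h) # v))"
proof -
  have "eval_word act \<psi> ((i, scaleH c h) # v) = scaleA c (eval_word act \<psi> ((i, h) # v))"
    by (cases "v = []") (simp_all add: eval_word_cons act_scale_left A.scale_mult_left)
  then show ?thesis
    by (cases "u = []") (simp_all add: eval_word_append A.scale_mult_right)
qed

lemma tensor_relations_identities: "tensor_relations scaleH \<subseteq> H_identities scaleA act"
proof
  interpret hp: vector_space hscale
    by (rule vector_space_hscale)
  have mono: "monomial w \<in> hpolys" if "w \<in> hwords" for w :: "(nat \<times> 'h) list"
    unfolding hpolys_def using that by (intro hp.span_base) auto
  have dec: "u @ (i, k) # v \<in> hwords" if "u @ (i, h) # v \<in> hwords" for u v i and h k :: 'h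
    using that by (auto simp: hwords_def)
  fix f assume "f \<in> tensor_relations scaleH"
  then consider
      (add) u v i h k where "u @ (i, h) # v \<in> hwords"
        "f = monomial (u @ (i, h + k) # v) - monomial (u @ (i, h) # v) - monomial (u @ (i, k) # v)"
    | (scale) u v i c h where "u @ (i, h) # v \<in> hwords"
        "f = monomial (u @ (i, scaleH c h) # v) - hscale c (monomial (u @ (i, h) # v))"
    unfolding tensor_relations_def by blast
  then show "f \<in> H_identities scaleA act"
  proof cases
    case add
    have "f \<in> hpolys"
      unfolding add(2) hpolys_def
      by (intro hp.span_diff) (auto simp: hpolys_def[symmetric] intro: mono dec[OF add(1)])
    then show ?thesis
      by (auto simp: H_identities_def add(2) heval_diff eval_word_add)
  next
    case scale
    have "f \<in> hpolys"
      unfolding scale(2) hpolys_def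
      by (intro hp.span_diff hp.span_scale)
        (auto simp: hpolys_def[symmetric] intro: mono dec[OF scale(1)])
    then show ?thesis
      by (auto simp: H_identities_def scale(2) heval_diff heval_hscale eval_word_scale)
  qed
qed

end

section \<open>The exponent\<close>

definition subspace_product ::
    "('f::field \<Rightarrow> 'a::ring \<Rightarrow> 'a) \<Rightarrow> 'a set \<Rightarrow> 'a set \<Rightarrow> 'a set" where
  "subspace_product scale U V = module.span scale {u * v | u v. u \<in> U \<and> v \<in> V}"

text \<open>
  \<open>radical_chain scale J Bs [i\<^sub>1, \<dots>, i\<^sub>r]\<close> is the product of the subspaces \<open>Bs i\<^sub>1\<close>, \<open>J\<close>, \<open>Bs i\<^sub>2\<close>,
  \<open>J\<close>, \<open>\<dots>\<close>, \<open>J\<close>, \<open>Bs i\<^sub>r\<close>.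
\<close>

fun radical_chain ::
    "('f::field \<Rightarrow> 'a::ring \<Rightarrow> 'a) \<Rightarrow> 'a set \<Rightarrow> (nat \<Rightarrow> 'a set) \<Rightarrow> nat list \<Rightarrow> 'a set" where
  "radical_chain scale J Bs [] = {0}"
| "radical_chain scale J Bs [i] = Bs i"
| "radical_chain scale J Bs (i # j # is) =
     subspace_product scale (subspace_product scale (Bs i) J) (radical_chain scale J Bs (j # is))"

text \<open>The empty list contributes the dimension \<open>0\<close> of the zero space.\<close>

definition exponent_d ::
    "('f::field \<Rightarrow> 'a::ring \<Rightarrow> 'a) \<Rightarrow> 'a set \<Rightarrow> (nat \<Rightarrow> 'a set) \<Rightarrow> nat \<Rightarrow> nat" where
  "exponent_d scale J Bs q =
     Max {vector_space.dim scale (module.span scale (\<Union>i\<in>set is. Bs i)) | is.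
       distinct is \<and> set is \<subseteq> {1..q} \<and> length is \<le> q \<and>
       (is = [] \<or> radical_chain scale J Bs is \<noteq> {0})}"

end

theory Submission
  imports Defs "HOL-Library.Function_Algebras"
begin

text \<open>
  The codimension \<open>c\<^sub>n\<close> is the dimension of the space of \<open>n\<close>-linear functions on \<open>A\<close> that are
  represented by \<open>H\<close>-polynomials (\<open>H_codim_eq_dim\<close>), and both bounds are obtained by looking
  at the values of such functions on a basis of \<open>A\<close> that is adapted to
  \<open>A = B\<^sub>1 \<oplus> \<dots> \<oplus> B\<^sub>q \<oplus> J\<close>. No representation theory of the symmetric group is used.

  Upper bound. A multilinear function is determined by its values on tuples of basis elements.
  Such a value is a sum of products of elements of \<open>J\<close> and of the \<open>B\<^sub>i\<close>, because all of these
  are invariant. A nonzero product has boundedly many factors in \<open>J\<close>, since \<open>J\<close> is nilpotent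
  (\<open>coloured_product_few_J\<close>); and since \<open>B\<^sub>i B\<^sub>j = 0\<close> for \<open>i \<noteq> j\<close>, the indices \<open>i\<close> of its
  other factors can be arranged to a chain \<open>B\<^sub>i J B\<^sub>j J \<dots> \<noteq> 0\<close> (\<open>coloured_product_dim\<close>), so
  the corresponding \<open>B\<^sub>i\<close> have at most \<open>d\<close> basis elements together. Hence only polynomially
  many times \<open>d\<^sup>n\<close> tuples matter (\<open>upper_bound\<close>).

  Lower bound. Take a chain \<open>B\<^sub>i J B\<^sub>j J \<dots> \<noteq> 0\<close> for which \<open>V = B\<^sub>i \<oplus> B\<^sub>j \<oplus> \<dots>\<close> has dimension
  \<open>d\<close>. Each \<open>B\<^sub>i\<close> is an irreducible module over the operators \<open>x \<mapsto> p (h x) s\<close>, so Jacobson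
  density provides operators that separate the basis elements of \<open>V\<close> and whose values have a
  nonzero product along the chain. This yields an \<open>H\<close>-polynomial function \<open>f\<close> in \<open>3 d\<close>
  variables that is alternating in \<open>d\<close> of them and does not vanish identically when these take
  values in a basis of \<open>V\<close> (\<open>alternating_start\<close>). If \<open>f\<close> is alternating in \<open>x\<^sub>1, \<dots>, x\<^sub>d\<close>, then
  replacing \<open>x\<^sub>i\<close> by \<open>y x\<^sub>i\<close> and summing over \<open>i\<close> multiplies \<open>f\<close> by the trace of the
  multiplication by \<open>y\<close> on \<open>V\<close>. Therefore \<open>f\<close> times any product of the trace forms \<open>t (z y)\<close>,
  where \<open>t\<close> denotes that trace, is again an \<open>H\<close>-polynomial function, whose only new variables
  are those of the trace forms (\<open>multiply_by_trace_forms\<close>). So all but a bounded number of the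
  \<open>n\<close> variables can be put into trace forms.

  The trace form is nondegenerate because the \<open>B\<^sub>i\<close> are semisimple and the characteristic is
  \<open>0\<close> (\<open>trace_form_nondegenerate\<close>). Hence the \<open>m!\<close> products of \<open>m\<close> trace forms that pair
  \<open>y\<^sub>1, \<dots>, y\<^sub>m\<close> with a permutation of \<open>z\<^sub>1, \<dots>, z\<^sub>m\<close> span a space as large as the span of the
  permutation operators on \<open>V\<^sup>\<otimes>\<^sup>m\<close>. Its dimension is at least \<open>d\<^sup>2\<^sup>m\<close> divided by a polynomial
  in \<open>m\<close> (\<open>indep_family_permutations\<close>): for a symmetric positive semidefinite matrix, the
  square of the trace is at most the rank times the trace of the square, and for the Gram
  matrix of the permutation operators the trace of the square counts orbits of the symmetric
  group on words with \<open>d\<^sup>2\<close> letters, of which there are only polynomially many.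
\<close>

section \<open>The span of the permutation operators on a tensor power\<close>

definition inner_on :: "'x set \<Rightarrow> ('x \<Rightarrow> real) \<Rightarrow> ('x \<Rightarrow> real) \<Rightarrow> real" where
  "inner_on X f g = (\<Sum>x\<in>X. f x * g x)"

lemma inner_on_sum_left: "inner_on X (\<lambda>x. \<Sum>i\<in>I. c i * u i x) g = (\<Sum>i\<in>I. c i * inner_on X (u i) g)"
  unfolding inner_on_def sum_distrib_left sum_distrib_right
  by (subst sum.swap) (simp add: mult_ac)

lemma inner_on_commute: "inner_on X f g = inner_on X g f"
  by (simp add: inner_on_def mult.commute)

text \<open>
  Gram-Schmidt orthonormalisation, in the form of an expansion of the given functions. A
  function that vanishes after the projection step contributes no new vector.
\<close>

lemma orthonormal_expansion:
  fixes S :: "('x \<Rightarrow> real) set"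
  assumes "finite X" "finite S"
  shows "\<exists>u r. r \<le> card S \<and>
    (\<forall>i<r. \<forall>j<r. inner_on X (u i) (u j) = (if i = j then 1 else 0)) \<and>
    (\<forall>f\<in>S. \<forall>x\<in>X. f x = (\<Sum>i<r. inner_on X f (u i) * u i x))"
  using assms(2)
proof (induction S rule: finite_induct)
  case empty
  then show ?case by (intro exI[of _ "\<lambda>_ _. 0"] exI[of _ "0::nat"]) auto
next
  case (insert f S)
  then obtain u r where r: "r \<le> card S"
    and on: "\<And>i j. i < r \<Longrightarrow> j < r \<Longrightarrow> inner_on X (u i) (u j) = (if i = j then 1 else 0)"
    and ex: "\<And>g x. g \<in> S \<Longrightarrow> x \<in> X \<Longrightarrow> g x = (\<Sum>i<r. inner_on X g (u i) * u i x)"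
    by blast
  define g where "g = (\<lambda>x. f x - (\<Sum>i<r. inner_on X f (u i) * u i x))"
  have g_orth: "inner_on X g (u j) = 0" if "j < r" for j
  proof -
    have "inner_on X g (u j) = inner_on X f (u j) - inner_on X (\<lambda>x. \<Sum>i<r. inner_on X f (u i) * u i x) (u j)"
      by (simp add: inner_on_def g_def left_diff_distrib sum_subtractf)
    also have "\<dots> = inner_on X f (u j) - (\<Sum>i<r. inner_on X f (u i) * (if i = j then 1 else 0))"
      unfolding inner_on_sum_left using that by (simp add: on)
    also have "(\<Sum>i<r. inner_on X f (u i) * (if i = j then 1 else 0)) = inner_on X f (u j)"
      using that by (simp add: if_distrib cong: if_cong)
    finally show ?thesis by simp
  qed
  show ?case
  proof (cases "\<forall>x\<in>X. g x = 0")
    case True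
    then show ?thesis
      using r on ex insert.hyps
      by (intro exI[of _ u] exI[of _ r]) (auto simp: g_def)
  next
    case False
    define N where "N = inner_on X g g"
    have "N > 0"
    proof -
      from False obtain x where x: "x \<in> X" "g x \<noteq> 0" by blast
      have "N \<ge> g x * g x"
        unfolding N_def inner_on_def using assms(1) x(1)
        by (intro member_le_sum) auto
      moreover have "g x * g x > 0" using x(2) not_square_less_zero[of "g x"] by (simp add: zero_less_mult_iff) linarith
      ultimately show ?thesis by linarith
    qed
    define w where "w = (\<lambda>i. if i = r then (\<lambda>x. g x / sqrt N) else u i)"
    have w_lt: "w i = u i" if "i < r" for i using that by (simp add: w_def)
    have gw: "inner_on X (w r) h = inner_on X g h / sqrt N" for h
      by (simp add: inner_on_def w_def sum_divide_distrib)
    have on': "inner_on X (w i) (w j) = (if i = j then 1 else 0)" if ij: "i < Suc r" "j < Suc r" for i j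
    proof -
      consider "i < r" "j < r" | "i = r" "j < r" | "i < r" "j = r" | "i = r" "j = r"
        using ij by (auto simp: less_Suc_eq)
      then show ?thesis
      proof cases
        case 4
        have "inner_on X (w r) (w r) = inner_on X g (w r) / sqrt N" by (rule gw)
        also have "inner_on X g (w r) = inner_on X g g / sqrt N" using gw[of g] by (simp add: inner_on_commute)
        finally show ?thesis using 4 \<open>N > 0\<close> by (simp add: N_def)
      next
        case 3
        then show ?thesis using gw[of "u i"] g_orth w_lt by (simp add: inner_on_commute)
      qed (simp_all add: on w_lt gw g_orth)
    qed
    have old: "h x = (\<Sum>i<Suc r. inner_on X h (w i) * w i x)" if "h \<in> S" "x \<in> X" for h x
    proof -
      have "inner_on X h (w r) = inner_on X (\<lambda>x. \<Sum>i<r. inner_on X h (u i) * u i x) (w r)"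
        unfolding inner_on_def by (intro sum.cong refl) (simp add: ex[OF that(1), unfolded inner_on_def])
      also have "\<dots> = 0"
        unfolding inner_on_sum_left using on' by (intro sum.neutral) (auto simp: w_lt[symmetric])
      finally show ?thesis using ex[OF that] by (simp add: w_lt)
    qed
    have new: "f x = (\<Sum>i<Suc r. inner_on X f (w i) * w i x)" for x
    proof -
      have "inner_on X f (w r) = inner_on X (\<lambda>x. g x + (\<Sum>i<r. inner_on X f (u i) * u i x)) (w r)"
        by (simp add: g_def)
      also have "\<dots> = inner_on X g (w r) + inner_on X (\<lambda>x. \<Sum>i<r. inner_on X f (u i) * u i x) (w r)"
        by (simp add: inner_on_def distrib_right sum.distrib)
      also have "inner_on X (\<lambda>x. \<Sum>i<r. inner_on X f (u i) * u i x) (w r) = 0"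
        unfolding inner_on_sum_left using on' by (intro sum.neutral) (auto simp: w_lt[symmetric])
      also have "inner_on X g (w r) = sqrt N"
        using gw[of g] \<open>N > 0\<close> by (simp add: inner_on_commute N_def[symmetric] real_div_sqrt)
      finally have "inner_on X f (w r) = sqrt N" by simp
      then show ?thesis
        using \<open>N > 0\<close> by (simp add: w_lt) (simp add: w_def g_def)
    qed
    show ?thesis
      using r insert.hyps on' old new
      by (intro exI[of _ w] exI[of _ "Suc r"]) (auto simp del: sum.lessThan_Suc)
  qed
qed

text \<open>
  Linear independence of a family of functions restricted to \<open>X\<close>. It is stated for families,
  so equal members with different indices are dependent.
\<close>

definition indep_family :: "'x set \<Rightarrow> ('g \<Rightarrow> 'x \<Rightarrow> 'f::field) \<Rightarrow> 'g set \<Rightarrow> bool" where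
  "indep_family X v S \<longleftrightarrow>
     (\<forall>c. (\<forall>x\<in>X. (\<Sum>s\<in>S. c s * v s x) = 0) \<longrightarrow> (\<forall>s\<in>S. c s = 0))"

lemma maximal_indep_family:
  assumes "finite G"
  shows "\<exists>S\<subseteq>G. indep_family X v S \<and>
    (\<forall>g\<in>G. \<exists>c. \<forall>x\<in>X. v g x = (\<Sum>s\<in>S. c s * v s x))"
proof -
  let ?Q = "\<lambda>S. S \<subseteq> G \<and> indep_family X v S"
  have "finite (card ` Collect ?Q)"
    using assms by (intro finite_imageI finite_subset[of "Collect ?Q" "Pow G"]) auto
  moreover have "?Q {}" by (simp add: indep_family_def)
  ultimately have "Max (card ` Collect ?Q) \<in> card ` Collect ?Q"
    by (intro Max_in) auto
  then obtain S where S: "?Q S" and S_max: "card S = Max (card ` Collect ?Q)"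
    by auto
  have max: "card T \<le> card S" if "?Q T" for T
    unfolding S_max using \<open>finite (card ` Collect ?Q)\<close> that by (intro Max_ge) auto
  have fin: "finite S" using S assms finite_subset by blast
  have "\<exists>c. \<forall>x\<in>X. v g x = (\<Sum>s\<in>S. c s * v s x)" if g: "g \<in> G" for g
  proof (cases "g \<in> S")
    case True
    have "(\<Sum>s\<in>S. (if s = g then 1 else 0) * v s x) = v g x" for x
      using fin True by (simp add: if_distrib[of "\<lambda>a. a * _"] cong: if_cong)
    then show ?thesis by (intro exI[of _ "\<lambda>s. if s = g then 1 else 0"]) simp
  next
    case False
    then have "card (insert g S) > card S" using fin by simp
    then have "\<not> indep_family X v (insert g S)" using max[of "insert g S"] S g by force
    then obtain c where c0: "\<And>x. x \<in> X \<Longrightarrow> (\<Sum>s\<in>insert g S. c s * v s x) = 0"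
      and cn: "\<exists>s\<in>insert g S. c s \<noteq> 0"
      unfolding indep_family_def by blast
    have c: "c g * v g x + (\<Sum>s\<in>S. c s * v s x) = 0" if "x \<in> X" for x
      using c0[OF that] fin False by simp
    have "c g \<noteq> 0"
    proof
      assume "c g = 0"
      then have "\<forall>s\<in>S. c s = 0" using c S unfolding indep_family_def by auto
      then show False using cn \<open>c g = 0\<close> by auto
    qed
    have "v g x = (\<Sum>s\<in>S. (- c s / c g) * v s x)" if "x \<in> X" for x
    proof -
      have eq: "(\<Sum>s\<in>S. c s * v s x) = - (c g * v g x)"
        using c[OF that] by (metis add.commute eq_neg_iff_add_eq_0)
      have "(\<Sum>s\<in>S. (- c s / c g) * v s x) = - (\<Sum>s\<in>S. c s * v s x) / c g"
        by (simp add: sum_divide_distrib sum_negf)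
      also have "\<dots> = v g x"
        unfolding eq using \<open>c g \<noteq> 0\<close> by simp
      finally show ?thesis by simp
    qed
    then show ?thesis by (intro exI[of _ "\<lambda>s. - c s / c g"]) blast
  qed
  then show ?thesis using S by blast
qed

lemma square_sum_le:
  fixes f :: "'i \<Rightarrow> real"
  shows "(\<Sum>i\<in>I. f i)\<^sup>2 \<le> real (card I) * (\<Sum>i\<in>I. (f i)\<^sup>2)"
proof -
  have "0 \<le> (\<Sum>i\<in>I. \<Sum>j\<in>I. (f i - f j)\<^sup>2)"
    by (intro sum_nonneg) auto
  also have "\<dots> = (\<Sum>i\<in>I. \<Sum>j\<in>I. (f i)\<^sup>2 + (f j)\<^sup>2 - 2 * (f i * f j))"
    by (intro sum.cong refl) (simp add: power2_eq_square algebra_simps)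
  also have "\<dots> = 2 * (real (card I) * (\<Sum>i\<in>I. (f i)\<^sup>2)) - 2 * (\<Sum>i\<in>I. f i)\<^sup>2"
    by (simp add: sum.distrib sum_subtractf power2_eq_square sum_product
        sum_distrib_left[symmetric])
  finally show ?thesis by simp
qed

text \<open>
  Let \<open>T\<close> be the sum of the operators \<open>x \<mapsto> \<langle>x, v\<rangle> v\<close> over the vectors \<open>v\<close> of the family. The
  left side is the square of the trace of \<open>T\<close>, the double sum is the trace of \<open>T\<^sup>2\<close>, and the
  rank of \<open>T\<close> is at most the number of the spanning vectors, so the claim is the
  Cauchy-Schwarz inequality for the eigenvalues. Computing both traces in an orthonormal basis
  of the span avoids eigenvalues.
\<close>

lemma sum_norm_squared_le:
  fixes v :: "'g \<Rightarrow> 'x \<Rightarrow> real"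
  assumes "finite X" "finite G" "finite S"
    and comb: "\<And>g. g \<in> G \<Longrightarrow> \<exists>c. \<forall>x\<in>X. v g x = (\<Sum>s\<in>S. c s * v s x)"
  shows "(\<Sum>g\<in>G. inner_on X (v g) (v g))\<^sup>2 \<le> real (card S) * (\<Sum>g\<in>G. \<Sum>h\<in>G. (inner_on X (v g) (v h))\<^sup>2)"
proof -
  obtain u r where r: "r \<le> card (v ` S)"
    and on: "\<And>i j. i < r \<Longrightarrow> j < r \<Longrightarrow> inner_on X (u i) (u j) = (if i = j then 1 else 0)"
    and ex: "\<And>f x. f \<in> v ` S \<Longrightarrow> x \<in> X \<Longrightarrow> f x = (\<Sum>i<r. inner_on X f (u i) * u i x)"
    using orthonormal_expansion[of X "v ` S"] assms by blast
  have r': "r \<le> card S" using r card_image_le[OF assms(3), of v] by linarith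
  have exG: "v g x = (\<Sum>i<r. inner_on X (v g) (u i) * u i x)" if g: "g \<in> G" and x: "x \<in> X" for g x
  proof -
    obtain c where c: "\<And>x. x \<in> X \<Longrightarrow> v g x = (\<Sum>s\<in>S. c s * v s x)" using comb[OF g] by blast
    have ipg: "inner_on X (v g) h = (\<Sum>s\<in>S. c s * inner_on X (v s) h)" for h
    proof -
      have "inner_on X (v g) h = inner_on X (\<lambda>x. \<Sum>s\<in>S. c s * v s x) h"
        unfolding inner_on_def by (intro sum.cong) (auto simp: c)
      then show ?thesis by (simp add: inner_on_sum_left)
    qed
    have "v g x = (\<Sum>s\<in>S. c s * (\<Sum>i<r. inner_on X (v s) (u i) * u i x))"
      using c[OF x] ex x by simp
    also have "\<dots> = (\<Sum>i<r. (\<Sum>s\<in>S. c s * inner_on X (v s) (u i)) * u i x)"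
      unfolding sum_distrib_left sum_distrib_right by (subst sum.swap) (simp add: mult_ac)
    finally show ?thesis by (simp add: ipg)
  qed
  have ipG: "inner_on X (v g) h = (\<Sum>i<r. inner_on X (v g) (u i) * inner_on X (u i) h)" if "g \<in> G" for g h
  proof -
    have "inner_on X (v g) h = inner_on X (\<lambda>x. \<Sum>i<r. inner_on X (v g) (u i) * u i x) h"
      unfolding inner_on_def by (intro sum.cong) (auto simp: exG[OF that, unfolded inner_on_def])
    then show ?thesis by (simp only: inner_on_sum_left)
  qed
  \<comment> \<open>The matrix of \<open>T\<close> in the orthonormal basis \<open>u\<close>.\<close>
  define t where "t = (\<lambda>i j. \<Sum>g\<in>G. inner_on X (v g) (u i) * inner_on X (v g) (u j))"
  have "(\<Sum>g\<in>G. inner_on X (v g) (v g)) = (\<Sum>g\<in>G. \<Sum>i<r. inner_on X (v g) (u i) * inner_on X (v g) (u i))"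
    by (intro sum.cong refl) (subst ipG, auto simp: inner_on_commute)
  also have "\<dots> = (\<Sum>i<r. t i i)"
    unfolding t_def by (rule sum.swap)
  finally have tr: "(\<Sum>g\<in>G. inner_on X (v g) (v g)) = (\<Sum>i<r. t i i)" .
  have "(\<Sum>g\<in>G. \<Sum>h\<in>G. (inner_on X (v g) (v h))\<^sup>2) =
    (\<Sum>g\<in>G. \<Sum>h\<in>G. \<Sum>i<r. \<Sum>j<r. (inner_on X (v g) (u i) * inner_on X (v g) (u j)) * (inner_on X (v h) (u i) * inner_on X (v h) (u j)))"
  proof (intro sum.cong refl)
    fix g h assume g: "g \<in> G" and h: "h \<in> G"
    have "inner_on X (v g) (v h) = (\<Sum>i<r. inner_on X (v g) (u i) * inner_on X (v h) (u i))"
      by (subst ipG[OF g]) (simp add: inner_on_commute)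
    then show "(inner_on X (v g) (v h))\<^sup>2 = (\<Sum>i<r. \<Sum>j<r. (inner_on X (v g) (u i) * inner_on X (v g) (u j)) * (inner_on X (v h) (u i) * inner_on X (v h) (u j)))"
      by (simp add: power2_eq_square sum_product mult_ac)
  qed
  also have "\<dots> = (\<Sum>g\<in>G. \<Sum>i<r. \<Sum>j<r. \<Sum>h\<in>G. (inner_on X (v g) (u i) * inner_on X (v g) (u j)) * (inner_on X (v h) (u i) * inner_on X (v h) (u j)))"
    by (intro sum.cong refl) (subst sum.swap, intro sum.cong refl, rule sum.swap)
  also have "\<dots> = (\<Sum>i<r. \<Sum>j<r. \<Sum>g\<in>G. \<Sum>h\<in>G. (inner_on X (v g) (u i) * inner_on X (v g) (u j)) * (inner_on X (v h) (u i) * inner_on X (v h) (u j)))"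
    by (subst sum.swap, intro sum.cong refl, rule sum.swap)
  also have "\<dots> = (\<Sum>i<r. \<Sum>j<r. (t i j)\<^sup>2)"
    unfolding t_def power2_eq_square sum_product by (simp add: mult_ac)
  finally have tr2: "(\<Sum>g\<in>G. \<Sum>h\<in>G. (inner_on X (v g) (v h))\<^sup>2) = (\<Sum>i<r. \<Sum>j<r. (t i j)\<^sup>2)" .
  have "(\<Sum>i<r. t i i)\<^sup>2 \<le> real r * (\<Sum>i<r. (t i i)\<^sup>2)"
    using square_sum_le[of "\<lambda>i. t i i" "{..<r}"] by simp
  also have "\<dots> \<le> real r * (\<Sum>i<r. \<Sum>j<r. (t i j)\<^sup>2)"
    by (intro mult_left_mono sum_mono member_le_sum) auto
  also have "\<dots> \<le> real (card S) * (\<Sum>i<r. \<Sum>j<r. (t i j)\<^sup>2)"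
    using r' by (intro mult_right_mono sum_nonneg) auto
  finally show ?thesis by (simp add: tr tr2)
qed


text \<open>
  A linear relation over a field of characteristic \<open>0\<close> between integral vectors yields a
  rational, hence a real one: apply to its coefficients a \<open>\<rat>\<close>-linear functional that does not
  vanish on a chosen nonzero coefficient.
\<close>

lemma of_int_indep_family:
  fixes a :: "'g \<Rightarrow> 'x \<Rightarrow> int"
  assumes "indep_family X (\<lambda>s x. of_int (a s x) :: real) S"
  shows "indep_family X (\<lambda>s x. of_int (a s x) :: 'f::field_char_0) S"
  unfolding indep_family_def
proof (intro allI impI ballI)
  fix c :: "'g \<Rightarrow> 'f" and s0
  assume c: "\<forall>x\<in>X. (\<Sum>s\<in>S. c s * of_int (a s x)) = 0" and s0: "s0 \<in> S"
  interpret Q: vector_space "\<lambda>(q::rat) (x::'f). of_rat q * x"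
    by unfold_locales (simp_all add: algebra_simps of_rat_add of_rat_mult)
  show "c s0 = 0"
  proof (rule ccontr)
    assume nz: "c s0 \<noteq> 0"
    then have ind: "Q.independent {c s0}" by simp
    define E where "E = Q.extend_basis {c s0}"
    have E: "Q.independent E" "Q.span E = UNIV" "{c s0} \<subseteq> E"
      using Q.independent_extend_basis[OF ind] Q.span_extend_basis[OF ind]
        Q.extend_basis_superset[OF ind] by (simp_all add: E_def)
    define \<phi> where "\<phi> = (\<lambda>x. Q.representation E x (c s0))"
    have add: "\<phi> (x + y) = \<phi> x + \<phi> y" for x y
      unfolding \<phi>_def by (subst Q.representation_add) (simp_all add: E)
    have scale: "\<phi> (x * of_int k) = \<phi> x * of_int k" for x k
    proof -
      have "\<phi> (of_rat (of_int k) * x) = of_int k * \<phi> x"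
        unfolding \<phi>_def using Q.representation_scale[OF E(1), of x "of_int k"] E(2) by simp
      then show ?thesis by (simp add: mult.commute)
    qed
    have zero: "\<phi> 0 = 0"
      by (simp add: \<phi>_def Q.representation_zero)
    have sum: "\<phi> (\<Sum>s\<in>T. f s) = (\<Sum>s\<in>T. \<phi> (f s))" for f and T :: "'g set"
      by (induction T rule: infinite_finite_induct) (simp_all add: zero add)
    have "\<forall>x\<in>X. (\<Sum>s\<in>S. real_of_rat (\<phi> (c s)) * of_int (a s x)) = 0"
    proof
      fix x assume x: "x \<in> X"
      have "(\<Sum>s\<in>S. \<phi> (c s) * of_int (a s x)) = \<phi> (\<Sum>s\<in>S. c s * of_int (a s x))"
        by (simp add: sum scale)
      also have "\<dots> = 0" using c x zero by simp
      finally have "real_of_rat (\<Sum>s\<in>S. \<phi> (c s) * of_int (a s x)) = 0" by simp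
      then show "(\<Sum>s\<in>S. real_of_rat (\<phi> (c s)) * of_int (a s x)) = 0"
        by (simp add: of_rat_sum of_rat_mult)
    qed
    then have "real_of_rat (\<phi> (c s0)) = 0"
      using assms[unfolded indep_family_def, rule_format, of "\<lambda>s. real_of_rat (\<phi> (c s))" s0] s0
      by blast
    moreover have "\<phi> (c s0) = 1"
      using E by (simp add: \<phi>_def Q.representation_basis)
    ultimately show False by simp
  qed
qed

text \<open>
  Words of length \<open>m\<close> are extensional functions, so that composing a word with a permutation
  of the positions gives a word again and equality of words is equality of functions.
\<close>

abbreviation words :: "nat \<Rightarrow> 'l set \<Rightarrow> (nat \<Rightarrow> 'l) set" where
  "words m L \<equiv> PiE {..<m} (\<lambda>_. L)"

abbreviation perms :: "nat \<Rightarrow> (nat \<Rightarrow> nat) set" where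
  "perms m \<equiv> {\<sigma>. \<sigma> permutes {..<m}}"

lemma words_comp_permutes: "w \<in> words m L \<Longrightarrow> \<sigma> permutes {..<m} \<Longrightarrow> w \<circ> \<sigma> \<in> words m L"
  by (auto simp: PiE_iff extensional_def permutes_not_in dest: permutes_in_image)

text \<open>
  By Burnside's lemma the left side is \<open>m!\<close> times the number of orbits of the symmetric group
  on words, and an orbit is determined by the number of occurrences of each letter. Instead of
  counting orbits, the proof encodes a pair \<open>(v, \<rho>)\<close> by the letter counts of \<open>v\<close> and the
  permutation \<open>\<pi> \<circ> \<rho>\<close>, where \<open>\<pi>\<close> sorts \<open>v\<close>: as \<open>\<rho>\<close> fixes \<open>v\<close>, the permutation \<open>\<pi> \<circ> \<rho>\<close> sorts
  \<open>v\<close> as well, so the code determines \<open>v\<close>, then \<open>\<pi>\<close>, then \<open>\<rho>\<close>.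
\<close>

lemma card_stabilizer_pairs_le:
  fixes L :: "'l set"
  assumes "finite L"
  shows "card {(v, \<rho>). v \<in> words m L \<and> \<rho> \<in> perms m \<and> v \<circ> \<rho> = v} \<le> (m + 1) ^ card L * fact m"
proof -
  define content where "content = (\<lambda>v. image_mset v (mset_set {..<m}) :: 'l multiset)"
  define canon where "canon = (\<lambda>c. SOME v. v \<in> words m L \<and> content v = c)"
  define sorting where "sorting = (\<lambda>v. SOME \<pi>. \<pi> permutes {..<m} \<and> v = canon (content v) \<circ> \<pi>)"
  let ?P = "{(v, \<rho>). v \<in> words m L \<and> \<rho> \<in> perms m \<and> v \<circ> \<rho> = v}"
  have canon: "canon (content v) \<in> words m L \<and> content (canon (content v)) = content v"
    if "v \<in> words m L" for v
    unfolding canon_def by (rule someI[of _ v]) (simp add: that)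
  have sorting: "sorting v permutes {..<m} \<and> v = canon (content v) \<circ> sorting v"
    if v: "v \<in> words m L" for v
  proof -
    have "image_mset v (mset_set {..<m}) = image_mset (canon (content v)) (mset_set {..<m})"
      using canon[OF v] by (simp add: content_def)
    from image_mset_eq_implies_permutes[OF _ this]
    obtain p where p: "p permutes {..<m}" "\<forall>x\<in>{..<m}. v x = canon (content v) (p x)"
      by auto
    have "v x = (canon (content v) \<circ> p) x" for x
      using p v words_comp_permutes[OF conjunct1[OF canon[OF v]] p(1)]
      by (cases "x < m") (auto simp: PiE_iff extensional_def)
    then have "p permutes {..<m} \<and> v = canon (content v) \<circ> p" using p by auto
    then show ?thesis unfolding sorting_def
      by (rule someI[where P = "\<lambda>\<pi>. \<pi> permutes {..<m} \<and> v = canon (content v) \<circ> \<pi>"])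
  qed
  define counts where "counts = (\<lambda>v. restrict (count (content v)) L)"
  have counts_content: "content v = content w"
    if "v \<in> words m L" "w \<in> words m L" "counts v = counts w" for v w
  proof (rule multiset_eqI)
    fix l
    show "count (content v) l = count (content w) l"
    proof (cases "l \<in> L")
      case True
      then show ?thesis using that(3) by (metis counts_def restrict_apply')
    next
      case False
      then have "l \<notin># content v" "l \<notin># content w"
        using that by (auto simp: content_def)
      then show ?thesis by (simp add: not_in_iff)
    qed
  qed
  let ?f = "\<lambda>(v, \<rho>). (counts v, sorting v \<circ> \<rho>)"
  have "inj_on ?f ?P"
  proof (rule inj_onI, clarify)
    fix v \<rho> w \<tau>
    assume a: "v \<in> words m L" "w \<in> words m L" "\<rho> permutes {..<m}" "\<tau> permutes {..<m}"
      "v \<circ> \<rho> = v" "w \<circ> \<tau> = w" "counts v = counts w" "sorting v \<circ> \<rho> = sorting w \<circ> \<tau>"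
    have c: "content v = content w" using counts_content a by blast
    have "v = canon (content v) \<circ> sorting v \<circ> \<rho>"
      using sorting[OF a(1)] a(5) by metis
    also have "\<dots> = canon (content w) \<circ> sorting w \<circ> \<tau>"
      using a(8) by (simp add: c comp_assoc)
    also have "\<dots> = w"
      using sorting[OF a(2)] a(6) by metis
    finally have vw: "v = w" .
    have "inj (sorting w)" using sorting[OF a(2)] permutes_inj by blast
    then have "\<rho> x = \<tau> x" for x
      using fun_cong[OF a(8), of x] vw by (simp add: inj_eq)
    then have "\<rho> = \<tau>" by blast
    with vw show "v = w \<and> \<rho> = \<tau>" by simp
  qed
  moreover have "?f ` ?P \<subseteq> PiE L (\<lambda>_. {..m}) \<times> perms m"
  proof (rule image_subsetI)
    fix x assume "x \<in> ?P"
    then obtain v \<rho> where x: "x = (v, \<rho>)" and a: "v \<in> words m L" "\<rho> permutes {..<m}"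
      by auto
    have "count (content v) l \<le> m" for l
    proof -
      have "count (content v) l \<le> size (content v)" by (rule count_le_size)
      then show ?thesis by (simp add: content_def)
    qed
    then show "?f x \<in> PiE L (\<lambda>_. {..m}) \<times> perms m"
      using a sorting[OF a(1)] by (simp add: x counts_def permutes_compose)
  qed
  ultimately have "card ?P \<le> card (PiE L (\<lambda>_. {..m}) \<times> perms m)"
    using assms by (intro card_inj_on_le[of ?f] finite_cartesian_product finite_PiE finite_permutations) auto
  also have "\<dots> = (m + 1) ^ card L * fact m"
    using assms by (simp add: card_cartesian_product card_PiE card_permutations[OF refl, of "{..<m}"])
  finally show ?thesis .
qed

text \<open>
  For fixed \<open>\<sigma>\<close>, the substitution \<open>v = w \<circ> \<sigma>\<close>, \<open>\<rho> = \<sigma>\<^sup>-\<^sup>1 \<circ> \<tau>\<close> turns the condition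
  \<open>w \<circ> \<sigma> = w \<circ> \<tau>\<close> into \<open>v \<circ> \<rho> = v\<close>.
\<close>

lemma card_agreeing_triples_le:
  assumes "finite L"
  shows "(\<Sum>\<sigma>\<in>perms m. \<Sum>\<tau>\<in>perms m. card {w \<in> words m L. w \<circ> \<sigma> = w \<circ> \<tau>})
    \<le> fact m * ((m + 1) ^ card L * fact m)"
proof -
  let ?P = "{(v, \<rho>). v \<in> words m L \<and> \<rho> \<in> perms m \<and> v \<circ> \<rho> = v}"
  have fin: "finite (words m L)" "finite (perms m)"
    using assms by (auto intro!: finite_PiE finite_permutations)
  have finP: "finite ?P"
    by (rule finite_subset[of _ "words m L \<times> perms m"]) (use fin in auto)
  have one: "(\<Sum>\<tau>\<in>perms m. card {w \<in> words m L. w \<circ> \<sigma> = w \<circ> \<tau>}) \<le> (m + 1) ^ card L * fact m"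
    if \<sigma>: "\<sigma> \<in> perms m" for \<sigma>
  proof -
    have \<sigma>': "\<sigma> permutes {..<m}" using \<sigma> by simp
    have id: "inv \<sigma> \<circ> \<sigma> = id" "\<sigma> \<circ> inv \<sigma> = id"
      using permutes_inv_o[OF \<sigma>'] by auto
    let ?D = "SIGMA \<tau>:perms m. {w \<in> words m L. w \<circ> \<sigma> = w \<circ> \<tau>}"
    let ?g = "\<lambda>(\<tau>, w). (w \<circ> \<sigma>, inv \<sigma> \<circ> \<tau>)"
    have "inj_on ?g ?D"
    proof (rule inj_onI, clarify)
      fix \<tau> w \<tau>' w' :: "nat \<Rightarrow> _"
      assume "w \<circ> \<sigma> = w' \<circ> \<sigma>" "inv \<sigma> \<circ> \<tau> = inv \<sigma> \<circ> \<tau>'"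
      then have "w \<circ> (\<sigma> \<circ> inv \<sigma>) = w' \<circ> (\<sigma> \<circ> inv \<sigma>)" "(\<sigma> \<circ> inv \<sigma>) \<circ> \<tau> = (\<sigma> \<circ> inv \<sigma>) \<circ> \<tau>'"
        by (metis comp_assoc)+
      then show "\<tau> = \<tau>' \<and> w = w'" by (simp add: id)
    qed
    moreover have "?g ` ?D \<subseteq> ?P"
    proof clarify
      fix \<tau> w assume a: "\<tau> permutes {..<m}" "w \<in> words m L" "w \<circ> \<sigma> = w \<circ> \<tau>"
      have "w \<circ> \<sigma> \<circ> (inv \<sigma> \<circ> \<tau>) = w \<circ> (\<sigma> \<circ> inv \<sigma>) \<circ> \<tau>" by (simp add: comp_assoc)
      then have "w \<circ> \<sigma> \<circ> (inv \<sigma> \<circ> \<tau>) = w \<circ> \<sigma>" by (simp add: id a(3))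
      moreover have "inv \<sigma> \<circ> \<tau> \<in> perms m"
        using a(1) permutes_inv[OF \<sigma>'] by (auto intro: permutes_compose)
      ultimately show "w \<circ> \<sigma> \<in> words m L \<and> inv \<sigma> \<circ> \<tau> \<in> perms m \<and> w \<circ> \<sigma> \<circ> (inv \<sigma> \<circ> \<tau>) = w \<circ> \<sigma>"
        using words_comp_permutes[OF a(2) \<sigma>'] by blast
    qed
    ultimately have "card ?D \<le> card ?P"
      using finP by (intro card_inj_on_le[of ?g])
    also have "\<dots> \<le> (m + 1) ^ card L * fact m"
      using assms by (rule card_stabilizer_pairs_le)
    finally show ?thesis
      using fin by (simp add: card_SigmaI)
  qed
  have "(\<Sum>\<sigma>\<in>perms m. \<Sum>\<tau>\<in>perms m. card {w \<in> words m L. w \<circ> \<sigma> = w \<circ> \<tau>})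
    \<le> (\<Sum>\<sigma>\<in>perms m. (m + 1) ^ card L * fact m)"
    by (rule sum_mono) (rule one)
  then show ?thesis by (simp add: card_permutations[OF refl, of "{..<m}"])
qed

text \<open>
  The entries of the matrix by which \<open>\<sigma>\<close> acts on a tensor power, in the basis of the tensors
  of basis vectors.
\<close>

definition rearranges ::
    "(nat \<Rightarrow> nat) \<Rightarrow> (nat \<Rightarrow> 'l) \<times> (nat \<Rightarrow> 'l) \<Rightarrow> 'f::zero_neq_one" where
  "rearranges \<sigma> = (\<lambda>(a, b). if a = b \<circ> \<sigma> then 1 else 0)"

lemma of_int_rearranges: "of_int (rearranges \<sigma> x) = rearranges \<sigma> x"
  by (simp add: rearranges_def split: prod.split)

text \<open>
  The inequality between the trace, the rank and the trace of the square, applied to the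
  permutation operators as vectors of \<open>0\<close>s and \<open>1\<close>s. The inner product of \<open>\<sigma>\<close> and \<open>\<tau>\<close> is the
  number of words on which both act in the same way; its square is the number of pairs of such
  words, that is, of words in the alphabet of pairs of letters, which is counted by
  \<open>card_agreeing_triples_le\<close>.
\<close>

lemma indep_family_permutations:
  obtains S where "S \<subseteq> perms m"
    and "indep_family (words m {..<d} \<times> words m {..<d})
      (rearranges :: _ \<Rightarrow> _ \<Rightarrow> 'f::field_char_0) S"
    and "d ^ (2 * m) \<le> card S * (m + 1) ^ (d * d)"
proof -
  let ?W = "words m {..<d}"
  let ?X = "?W \<times> ?W"
  let ?v = "rearranges :: _ \<Rightarrow> _ \<Rightarrow> real"
  have finW: "finite ?W" by (intro finite_PiE) auto
  have finP: "finite (perms m)" by (simp add: finite_permutations)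
  obtain S where S: "S \<subseteq> perms m" "indep_family ?X ?v S"
    and comb: "\<forall>g\<in>perms m. \<exists>c. \<forall>x\<in>?X. ?v g x = (\<Sum>s\<in>S. c s * ?v s x)"
    using maximal_indep_family[OF finP, of ?X ?v] by (elim exE conjE)
  have inner_on: "inner_on ?X (?v \<sigma>) (?v \<tau>) = real (card {b \<in> ?W. b \<circ> \<sigma> = b \<circ> \<tau>})"
    if "\<sigma> \<in> perms m" "\<tau> \<in> perms m" for \<sigma> \<tau>
  proof -
    have "inner_on ?X (?v \<sigma>) (?v \<tau>) = (\<Sum>a\<in>?W. \<Sum>b\<in>?W. if a = b \<circ> \<sigma> \<and> b \<circ> \<sigma> = b \<circ> \<tau> then 1 else 0)"
      unfolding inner_on_def sum.cartesian_product'
      by (intro sum.cong refl) (simp add: rearranges_def)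
    also have "\<dots> = (\<Sum>b\<in>?W. \<Sum>a\<in>?W. if a = b \<circ> \<sigma> then (if b \<circ> \<sigma> = b \<circ> \<tau> then 1 else 0) else 0)"
      by (subst sum.swap) (intro sum.cong refl, simp)
    also have "\<dots> = (\<Sum>b\<in>?W. if b \<circ> \<sigma> = b \<circ> \<tau> then 1 else 0)"
    proof (intro sum.cong refl)
      fix b assume "b \<in> ?W"
      then have "b \<circ> \<sigma> \<in> ?W" using words_comp_permutes that(1) by blast
      then show "(\<Sum>a\<in>?W. if a = b \<circ> \<sigma> then (if b \<circ> \<sigma> = b \<circ> \<tau> then 1 else 0) else 0)
        = (if b \<circ> \<sigma> = b \<circ> \<tau> then 1 else 0 :: real)"
        using finW by simp
    qed
    also have "\<dots> = real (card {b \<in> ?W. b \<circ> \<sigma> = b \<circ> \<tau>})"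
      using finW by (simp add: sum.If_cases Int_def)
    finally show ?thesis .
  qed
  have ip2: "(inner_on ?X (?v \<sigma>) (?v \<tau>))\<^sup>2 \<le> real (card {w \<in> words m ({..<d} \<times> {..<d}). w \<circ> \<sigma> = w \<circ> \<tau>})"
    if \<sigma>: "\<sigma> \<in> perms m" and \<tau>: "\<tau> \<in> perms m" for \<sigma> \<tau>
  proof -
    let ?A = "{b \<in> ?W. b \<circ> \<sigma> = b \<circ> \<tau>}"
    let ?C = "{w \<in> words m ({..<d} \<times> {..<d}). w \<circ> \<sigma> = w \<circ> \<tau>}"
    let ?h = "\<lambda>(b, b'). \<lambda>i\<in>{..<m}. (b i, b' i)"
    have "inj_on ?h (?A \<times> ?A)"
    proof (rule inj_onI, clarify)
      fix a b a' b' assume W: "a \<in> ?W" "b \<in> ?W" "a' \<in> ?W" "b' \<in> ?W"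
        and eq: "(\<lambda>i\<in>{..<m}. (a i, b i)) = (\<lambda>i\<in>{..<m}. (a' i, b' i))"
      have "a i = a' i \<and> b i = b' i" if "i < m" for i
        using fun_cong[OF eq, of i] that by simp
      then show "a = a' \<and> b = b'"
        using PiE_ext[OF W(1,3)] PiE_ext[OF W(2,4)] by auto
    qed
    moreover have "?h ` (?A \<times> ?A) \<subseteq> ?C"
    proof clarify
      fix a b assume W: "a \<in> ?W" "b \<in> ?W" and eq: "a \<circ> \<sigma> = a \<circ> \<tau>" "b \<circ> \<sigma> = b \<circ> \<tau>"
      have "(\<lambda>i\<in>{..<m}. (a i, b i)) (\<sigma> i) = (\<lambda>i\<in>{..<m}. (a i, b i)) (\<tau> i)" for i
        using fun_cong[OF eq(1), of i] fun_cong[OF eq(2), of i] \<sigma> \<tau>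
          permutes_in_image[of \<sigma> "{..<m}" i] permutes_in_image[of \<tau> "{..<m}" i] by simp
      moreover have "(\<lambda>i\<in>{..<m}. (a i, b i)) \<in> words m ({..<d} \<times> {..<d})" using W by auto
      ultimately show "(\<lambda>i\<in>{..<m}. (a i, b i)) \<in> words m ({..<d} \<times> {..<d}) \<and>
        (\<lambda>i\<in>{..<m}. (a i, b i)) \<circ> \<sigma> = (\<lambda>i\<in>{..<m}. (a i, b i)) \<circ> \<tau>" by (auto simp: fun_eq_iff)
    qed
    moreover have "finite ?C"
      by (rule finite_subset[of _ "words m ({..<d} \<times> {..<d})"]) (auto intro!: finite_PiE)
    ultimately have "card (?A \<times> ?A) \<le> card ?C"
      by (intro card_inj_on_le[of ?h])
    then have "real (card ?A * card ?A) \<le> real (card ?C)"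
      by (simp only: card_cartesian_product of_nat_le_iff)
    then show ?thesis
      using inner_on[OF \<sigma> \<tau>] by (simp add: power2_eq_square)
  qed
  have "(\<Sum>g\<in>perms m. inner_on ?X (?v g) (?v g)) = fact m * real d ^ m"
  proof -
    have "inner_on ?X (?v g) (?v g) = real d ^ m" if "g \<in> perms m" for g
      using inner_on[OF that that] by (simp add: card_PiE)
    then show ?thesis by (simp add: card_permutations[OF refl, of "{..<m}"])
  qed
  moreover have "(\<Sum>g\<in>perms m. \<Sum>h\<in>perms m. (inner_on ?X (?v g) (?v h))\<^sup>2) \<le>
    (fact m)\<^sup>2 * real (m + 1) ^ (d * d)"
  proof -
    have "(\<Sum>g\<in>perms m. \<Sum>h\<in>perms m. (inner_on ?X (?v g) (?v h))\<^sup>2) \<le>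
      (\<Sum>g\<in>perms m. \<Sum>h\<in>perms m. real (card {w \<in> words m ({..<d} \<times> {..<d}). w \<circ> g = w \<circ> h}))"
      by (intro sum_mono ip2)
    also have "\<dots> = real (\<Sum>g\<in>perms m. \<Sum>h\<in>perms m. card {w \<in> words m ({..<d} \<times> {..<d}). w \<circ> g = w \<circ> h})"
      by simp
    also have "\<dots> \<le> real (fact m * ((m + 1) ^ card ({..<d} \<times> {..<d}) * fact m))"
      by (rule of_nat_mono) (rule card_agreeing_triples_le, simp)
    also have "\<dots> = (fact m)\<^sup>2 * real (m + 1) ^ (d * d)"
      by (simp add: power2_eq_square card_cartesian_product)
    finally show ?thesis .
  qed
  moreover have "(\<Sum>g\<in>perms m. inner_on ?X (?v g) (?v g))\<^sup>2 \<le>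
    real (card S) * (\<Sum>g\<in>perms m. \<Sum>h\<in>perms m. (inner_on ?X (?v g) (?v h))\<^sup>2)"
    using S finP finW comb
    by (intro sum_norm_squared_le) (auto intro: finite_subset simp del: of_int_eq_iff)
  ultimately have "(fact m * real d ^ m)\<^sup>2 \<le> real (card S) * ((fact m)\<^sup>2 * real (m + 1) ^ (d * d))"
    by (metis (no_types, lifting) mult_left_mono of_nat_0_le_iff order_trans)
  then have "(fact m)\<^sup>2 * real (d ^ (2 * m)) \<le> (fact m)\<^sup>2 * real (card S * (m + 1) ^ (d * d))"
    by (simp add: power_mult_distrib power_mult[symmetric] mult.commute mult.left_commute)
  then have "real (d ^ (2 * m)) \<le> real (card S * (m + 1) ^ (d * d))"
    by (subst (asm) mult_le_cancel_left_pos) auto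
  then have le: "d ^ (2 * m) \<le> card S * (m + 1) ^ (d * d)"
    by (simp only: of_nat_le_iff)
  have "indep_family ?X (\<lambda>\<sigma> x. of_int (rearranges \<sigma> x) :: real) S"
    using S(2) by (simp add: of_int_rearranges)
  then have "indep_family ?X (\<lambda>\<sigma> x. of_int (rearranges \<sigma> x) :: 'f) S"
    by (rule of_int_indep_family)
  then have "indep_family ?X (rearranges :: _ \<Rightarrow> _ \<Rightarrow> 'f) S"
    by (simp add: of_int_rearranges)
  then show thesis using that S(1) le by blast
qed

section \<open>Idempotents, nil ideals and the Jacobson radical\<close>

text \<open>
  The power with exponent \<open>k + 1\<close>: there is no unit, hence no power with exponent \<open>0\<close>.
\<close>

definition suc_power :: "'a::ring \<Rightarrow> nat \<Rightarrow> 'a" where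
  "suc_power x k = ((*) x ^^ k) x"

lemma suc_power_0 [simp]: "suc_power x 0 = x"
  and suc_power_Suc: "suc_power x (Suc k) = x * suc_power x k"
  by (simp_all add: suc_power_def)

lemma suc_power_mult: "suc_power x j * suc_power x k = suc_power x (j + k + 1)"
  by (induction j) (simp_all add: suc_power_Suc mult.assoc)

lemma suc_power_mult_swap: "suc_power (y * a) (Suc k) = y * suc_power (a * y) k * a"
  by (induction k) (simp_all add: suc_power_Suc mult.assoc)

locale fd_algebra =
  assoc_algebra scale + finite_dimensional_vector_space scale Basis
  for scale :: "'f::field \<Rightarrow> 'a::ring \<Rightarrow> 'a" and Basis
begin

lemma subspace_image_mult_left: "subspace V \<Longrightarrow> subspace {x * a | a. a \<in> V}"
  unfolding subspace_def
proof (intro conjI ballI allI)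
  assume V: "0 \<in> V \<and> (\<forall>x\<in>V. \<forall>y\<in>V. x + y \<in> V) \<and> (\<forall>c. \<forall>x\<in>V. scale c x \<in> V)"
  show "0 \<in> {x * a | a. a \<in> V}" using V by (auto intro!: exI[of _ 0])
  show "u + v \<in> {x * a | a. a \<in> V}" if "u \<in> {x * a | a. a \<in> V}" "v \<in> {x * a | a. a \<in> V}" for u v
    using that V by (auto simp: distrib_left[symmetric])
  show "scale c u \<in> {x * a | a. a \<in> V}" if "u \<in> {x * a | a. a \<in> V}" for c u
    using that V by (auto simp: scale_mult_right)
qed

lemma subspace_image_mult_right: "subspace V \<Longrightarrow> subspace {a * x | a. a \<in> V}"
  unfolding subspace_def
proof (intro conjI ballI allI)
  assume V: "0 \<in> V \<and> (\<forall>x\<in>V. \<forall>y\<in>V. x + y \<in> V) \<and> (\<forall>c. \<forall>x\<in>V. scale c x \<in> V)"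
  show "0 \<in> {a * x | a. a \<in> V}" using V by (auto intro!: exI[of _ 0])
  show "u + v \<in> {a * x | a. a \<in> V}" if "u \<in> {a * x | a. a \<in> V}" "v \<in> {a * x | a. a \<in> V}" for u v
    using that V by (auto simp: distrib_right[symmetric])
  show "scale c u \<in> {a * x | a. a \<in> V}" if "u \<in> {a * x | a. a \<in> V}" for c u
    using that V by (auto simp: scale_mult_left)
qed

text \<open>
  Let \<open>P n\<close> be spanned by the powers of \<open>x\<close> with exponent greater than \<open>n\<close>. The decreasing
  sequence of these spaces becomes stationary at some \<open>n\<close>, so \<open>x\<^sup>n\<^sup>+\<^sup>1 = x\<^sup>n\<^sup>+\<^sup>1 a\<close> for some
  \<open>a\<close> in \<open>P n\<close>. Then \<open>a\<close> is a right unit for all of \<open>P n\<close>, in particular for itself.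
\<close>

lemma idempotent_if_not_nilpotent:
  assumes S: "subalgebra scale S" and x: "x \<in> S" and nz: "\<And>k. suc_power x k \<noteq> 0"
  obtains e where "e \<in> S" "e * e = e" "e \<noteq> 0"
proof -
  define P where "P n = span {suc_power x k | k. k \<ge> n}" for n
  have P_mono: "P m \<subseteq> P n" if "n \<le> m" for m n
    unfolding P_def using that by (intro span_mono) auto
  obtain n where n: "\<And>m. dim (P n) \<le> dim (P m)"
    using ex_has_least_nat[where P = "\<lambda>_. True" and m = "\<lambda>n. dim (P n)"] by blast
  have P_eq: "P (2 * n + 1) = P n"
    by (rule subspace_dim_equal) (use P_mono[of n "2 * n + 1"] n in \<open>auto simp: P_def\<close>)
  have "P (2 * n + 1) \<subseteq> {suc_power x n * a | a. a \<in> P n}"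
    unfolding P_def[of "2 * n + 1"]
  proof (rule span_minimal)
    show "subspace {suc_power x n * a | a. a \<in> P n}"
      by (rule subspace_image_mult_left) (simp add: P_def)
    show "{suc_power x k | k. k \<ge> 2 * n + 1} \<subseteq> {suc_power x n * a | a. a \<in> P n}"
    proof clarify
      fix k assume k: "2 * n + 1 \<le> k"
      then have "suc_power x k = suc_power x n * suc_power x (k - n - 1)" by (simp add: suc_power_mult)
      moreover have "suc_power x (k - n - 1) \<in> P n"
        unfolding P_def using k by (intro span_base) auto
      ultimately show "\<exists>a. suc_power x k = suc_power x n * a \<and> a \<in> P n" by blast
    qed
  qed
  moreover have "suc_power x n \<in> P (2 * n + 1)"
    unfolding P_eq unfolding P_def by (intro span_base) auto
  ultimately obtain a where a: "a \<in> P n" and xa: "suc_power x n * a = suc_power x n"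
    by auto
  have "P n \<subseteq> {b. b * a = b}"
    unfolding P_def
  proof (rule span_minimal)
    show "subspace {b. b * a = b}"
      by (auto simp: subspace_def distrib_right scale_mult_left[symmetric])
    show "{suc_power x k | k. k \<ge> n} \<subseteq> {b. b * a = b}"
    proof clarify
      fix k assume k: "n \<le> k"
      show "suc_power x k * a = suc_power x k"
      proof (cases "k = n")
        case False
        then have "suc_power x k = suc_power x (k - n - 1) * suc_power x n" using k by (simp add: suc_power_mult)
        then show ?thesis using xa by (simp add: mult.assoc)
      qed (simp add: xa)
    qed
  qed
  then have "a * a = a" using a by auto
  moreover have "a \<noteq> 0" using xa nz[of n] by auto
  moreover have "a \<in> S"
  proof -
    have "suc_power x k \<in> S" for k
      using S x by (induction k) (auto simp: suc_power_Suc subalgebra_def)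
    then have "P n \<subseteq> S"
      unfolding P_def using S by (intro span_minimal) (auto simp: subalgebra_def)
    then show ?thesis using a by blast
  qed
  ultimately show thesis using that by blast
qed

text \<open>
  If a maximal modular left ideal \<open>L\<close> does not contain the nil left ideal, then a right unit
  modulo \<open>L\<close> can be chosen in the nil left ideal, so that it is nilpotent; but then every
  element is congruent to \<open>0\<close> modulo \<open>L\<close>.
\<close>

lemma nil_left_ideal_subset_jacobson:
  assumes S: "subalgebra scale S" and N: "left_ideal scale S N"
    and nil: "\<And>x. x \<in> N \<Longrightarrow> \<exists>k. suc_power x k = 0"
  shows "N \<subseteq> jacobson_radical scale S"
proof
  fix x assume x: "x \<in> N"
  have NS: "N \<subseteq> S" and Nsub: "subspace N" and SN: "\<And>s y. s \<in> S \<Longrightarrow> y \<in> N \<Longrightarrow> s * y \<in> N"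
    using N by (auto simp: left_ideal_def)
  have Ssub: "subspace S" and SS: "\<And>s t. s \<in> S \<Longrightarrow> t \<in> S \<Longrightarrow> s * t \<in> S"
    using S by (auto simp: subalgebra_def)
  have "x \<in> L" if L: "maximal_modular_left_ideal scale S L" for L
  proof (rule ccontr)
    assume xL: "x \<notin> L"
    have Lsub: "subspace L" and LS: "L \<subseteq> S" and SL: "\<And>s y. s \<in> S \<Longrightarrow> y \<in> L \<Longrightarrow> s * y \<in> L"
      and ne: "L \<noteq> S"
      and max: "\<And>L'. left_ideal scale S L' \<Longrightarrow> L \<subseteq> L' \<Longrightarrow> L' = L \<or> L' = S"
      using L by (auto simp: maximal_modular_left_ideal_def modular_left_ideal_def left_ideal_def)
    obtain e where e: "e \<in> S" "\<And>s. s \<in> S \<Longrightarrow> s - s * e \<in> L"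
      using L by (auto simp: maximal_modular_left_ideal_def modular_left_ideal_def)
    let ?M = "{l + y | l y. l \<in> L \<and> y \<in> N}"
    have "left_ideal scale S ?M"
      unfolding left_ideal_def
    proof (intro conjI ballI)
      show "subspace ?M" using Lsub Nsub by (rule subspace_sums)
      show "?M \<subseteq> S" using LS NS Ssub by (auto intro: subspace_add)
      show "s * m \<in> ?M" if "s \<in> S" "m \<in> ?M" for s m
        using that SL SN by (auto simp: distrib_left) blast
    qed
    moreover have "L \<subseteq> ?M" using subspace_0[OF Nsub] by force
    moreover have "x \<in> ?M" using x subspace_0[OF Lsub] by force
    ultimately have "?M = S" using max[of ?M] xL by blast
    then obtain l y where y: "e = l + y" "l \<in> L" "y \<in> N" using e(1) by blast
    have step: "s - s * y \<in> L" if "s \<in> S" for s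
    proof -
      have "s - s * y = (s - s * e) + s * l" by (simp add: y(1) algebra_simps)
      then show ?thesis using subspace_add[OF Lsub e(2)[OF that] SL[OF that y(2)]] by (simp only:)
    qed
    have "s - s * suc_power y k \<in> L" if "s \<in> S" for s k
    proof (induction k)
      case (Suc k)
      have yk: "suc_power y k \<in> S" using y(3) NS SS by (induction k) (auto simp: suc_power_Suc)
      have "suc_power y (Suc k) = suc_power y k * y" using suc_power_mult[of y k 0] by simp
      then have "s - s * suc_power y (Suc k) = (s - s * suc_power y k) + (s * suc_power y k - s * suc_power y k * y)"
        by (simp add: mult.assoc)
      then show ?case
        using subspace_add[OF Lsub Suc step[OF SS[OF that yk]]] by (simp only:)
    qed (use step that in simp)
    moreover obtain k where "suc_power y k = 0" using nil y(3) by blast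
    ultimately have "s \<in> L" if "s \<in> S" for s using that by (metis diff_zero mult_zero_right)
    then show False using LS ne by blast
  qed
  then show "x \<in> jacobson_radical scale S"
    using x NS by (auto simp: jacobson_radical_def)
qed

lemma subspace_jacobson:
  assumes "subspace S"
  shows "subspace (jacobson_radical scale S)"
proof -
  have "subspace L" if "maximal_modular_left_ideal scale S L" for L
    using that by (simp add: maximal_modular_left_ideal_def modular_left_ideal_def left_ideal_def)
  then show ?thesis
    unfolding jacobson_radical_def using assms
    by (intro subspaceI) (auto intro: subspace_0 subspace_add subspace_scale)
qed

lemma left_ideal_jacobson:
  assumes "subalgebra scale S"
  shows "left_ideal scale S (jacobson_radical scale S)"
  using assms subspace_jacobson[of S]
  by (auto simp: left_ideal_def jacobson_radical_def subalgebra_def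
      maximal_modular_left_ideal_def modular_left_ideal_def)

lemma subalgebra_UNIV: "subalgebra scale UNIV"
  by (simp add: subalgebra_def)

lemma maximal_modular_left_ideal_exists:
  assumes K: "modular_left_ideal scale UNIV K" "K \<noteq> UNIV"
  obtains L where "K \<subseteq> L" "maximal_modular_left_ideal scale UNIV L"
proof -
  let ?Q = "\<lambda>L. left_ideal scale UNIV L \<and> K \<subseteq> L \<and> L \<noteq> UNIV"
  have "?Q K" using K by (auto simp: modular_left_ideal_def)
  moreover have "\<forall>L. ?Q L \<longrightarrow> dim L < Suc dimension"
    by (intro allI impI le_imp_less_Suc dim_subset_UNIV)
  ultimately have "\<exists>L. ?Q L \<and> (\<forall>L'. ?Q L' \<longrightarrow> dim L' \<le> dim L)"
    by (rule ex_has_greatest_nat)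
  then obtain L where L: "left_ideal scale UNIV L" "K \<subseteq> L" "L \<noteq> UNIV"
    and max: "\<And>L'. ?Q L' \<Longrightarrow> dim L' \<le> dim L"
    by (elim exE conjE) simp
  have "L' = L \<or> L' = UNIV" if L': "left_ideal scale UNIV L'" "L \<subseteq> L'" for L'
  proof (cases "L' = UNIV")
    case False
    then have "dim L' \<le> dim L" using max[of L'] L' L(2) by blast
    then have "L = L'" using L L' by (intro subspace_dim_equal) (auto simp: left_ideal_def)
    then show ?thesis by simp
  qed simp
  then have "maximal_modular_left_ideal scale UNIV L"
    using L K unfolding maximal_modular_left_ideal_def modular_left_ideal_def by blast
  then show thesis using that L(2) by blast
qed

text \<open>
  Otherwise the radical contains an idempotent \<open>e \<noteq> 0\<close>. The elements \<open>s - s e\<close> form a proper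
  modular left ideal, and a maximal left ideal above it contains all \<open>s - s e\<close> as well as all
  \<open>s e\<close>.
\<close>

lemma jacobson_nil:
  assumes x: "x \<in> jacobson_radical scale UNIV"
  shows "\<exists>k. suc_power x k = 0"
proof (rule ccontr)
  assume nn: "\<nexists>k. suc_power x k = 0"
  have "subalgebra scale (jacobson_radical scale UNIV)"
    using left_ideal_jacobson[OF subalgebra_UNIV]
    by (auto simp: left_ideal_def subalgebra_def)
  then obtain e where e: "e \<in> jacobson_radical scale UNIV" "e * e = e" "e \<noteq> 0"
    using idempotent_if_not_nilpotent[of _ x] x nn by metis
  let ?K = "{s - s * e | s. True}"
  have "left_ideal scale UNIV ?K"
    unfolding left_ideal_def
  proof (intro conjI ballI)
    show "subspace ?K"
      unfolding subspace_def
    proof (intro conjI ballI allI)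
      show "0 \<in> ?K" by (auto intro!: exI[of _ 0])
      show "u + v \<in> ?K" if uv: "u \<in> ?K" "v \<in> ?K" for u v
      proof -
        from uv obtain s t where st: "u = s - s * e" "v = t - t * e" by blast
        have "u + v = (s + t) - (s + t) * e" unfolding st by (simp add: algebra_simps)
        then show ?thesis by blast
      qed
      show "scale c u \<in> ?K" if u: "u \<in> ?K" for c u
      proof -
        from u obtain s where s: "u = s - s * e" by blast
        have "scale c u = scale c s - scale c s * e"
          unfolding s by (simp add: scale_right_diff_distrib scale_mult_left)
        then show ?thesis by blast
      qed
    qed
    show "a * u \<in> ?K" if u: "u \<in> ?K" for a u
    proof -
      from u obtain s where s: "u = s - s * e" by blast
      have "a * u = a * s - a * s * e" unfolding s by (simp add: algebra_simps)
      then show ?thesis by blast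
    qed
  qed simp
  then have K: "modular_left_ideal scale UNIV ?K"
    unfolding modular_left_ideal_def by blast
  have "e \<notin> ?K"
  proof
    assume "e \<in> ?K"
    then obtain s where s: "e = s - s * e" by blast
    have "e * e = (s - s * e) * e" using s by simp
    also have "\<dots> = 0" by (simp add: left_diff_distrib mult.assoc e(2))
    finally show False using e(2,3) by simp
  qed
  then obtain L where L: "?K \<subseteq> L" "maximal_modular_left_ideal scale UNIV L"
    using maximal_modular_left_ideal_exists[OF K] by blast
  have "e \<in> L" using e(1) L(2) by (auto simp: jacobson_radical_def)
  have Lsub: "subspace L" and SL: "\<And>s y. y \<in> L \<Longrightarrow> s * y \<in> L" and ne: "L \<noteq> UNIV"
    using L(2) by (auto simp: maximal_modular_left_ideal_def modular_left_ideal_def left_ideal_def)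
  have "s \<in> L" for s
  proof -
    have "s - s * e \<in> L" using L(1) by blast
    then have "(s - s * e) + s * e \<in> L" using SL[OF \<open>e \<in> L\<close>, of s] Lsub by (intro subspace_add)
    then show ?thesis by simp
  qed
  then show False using ne by blast
qed

text \<open>
  The left ideal \<open>J a\<close> is nil, because \<open>(y a)\<^sup>k\<^sup>+\<^sup>1 = y (a y)\<^sup>k a\<close> and \<open>a y\<close> lies in \<open>J\<close>.
\<close>

lemma jacobson_mult_right:
  assumes x: "x \<in> jacobson_radical scale UNIV"
  shows "x * a \<in> jacobson_radical scale UNIV"
proof -
  let ?J = "jacobson_radical scale UNIV"
  have J: "left_ideal scale UNIV ?J" by (rule left_ideal_jacobson[OF subalgebra_UNIV])
  let ?N = "{y * a | y. y \<in> ?J}"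
  have "left_ideal scale UNIV ?N"
    using J subspace_image_mult_right[of ?J a]
    by (auto simp: left_ideal_def mult.assoc[symmetric])
  moreover have "\<exists>k. suc_power z k = 0" if "z \<in> ?N" for z
  proof -
    from that obtain y where y: "y \<in> ?J" "z = y * a" by blast
    have "a * y \<in> ?J" using J y(1) by (auto simp: left_ideal_def)
    then obtain k where "suc_power (a * y) k = 0" using jacobson_nil by blast
    then have "suc_power z (Suc k) = 0" by (simp add: y(2) suc_power_mult_swap)
    then show ?thesis by blast
  qed
  ultimately have "?N \<subseteq> ?J" by (rule nil_left_ideal_subset_jacobson[OF subalgebra_UNIV])
  then show ?thesis using x by blast
qed

lemma two_sided_ideal_jacobson: "two_sided_ideal scale UNIV (jacobson_radical scale UNIV)"
  using left_ideal_jacobson[OF subalgebra_UNIV] jacobson_mult_right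
  by (auto simp: two_sided_ideal_def left_ideal_def)

text \<open>
  A form of Engel's theorem. In a minimal submodule \<open>K\<close> that properly contains \<open>U\<close>, choose \<open>w\<close>
  outside \<open>U\<close>. If \<open>J w\<close> is not contained in \<open>U\<close>, then \<open>U + J w = K\<close> by minimality, so \<open>w\<close> is
  congruent to \<open>x w\<close> modulo \<open>U\<close> for some \<open>x\<close> in \<open>J\<close>, and \<open>x\<close> is nilpotent.
\<close>

lemma nil_ideal_kills_vector:
  assumes J: "two_sided_ideal scale UNIV J" and nil: "\<And>x. x \<in> J \<Longrightarrow> \<exists>k. suc_power x k = 0"
    and U: "subspace U" "U \<noteq> UNIV" "\<And>j u. j \<in> J \<Longrightarrow> u \<in> U \<Longrightarrow> j * u \<in> U"
  shows "\<exists>w. w \<notin> U \<and> (\<forall>j\<in>J. j * w \<in> U)"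
proof -
  have Jsub: "subspace J" and AJ: "\<And>s y. y \<in> J \<Longrightarrow> s * y \<in> J" and JA: "\<And>s y. y \<in> J \<Longrightarrow> y * s \<in> J"
    using J by (auto simp: two_sided_ideal_def)
  let ?Q = "\<lambda>K. subspace K \<and> (\<forall>j\<in>J. \<forall>u\<in>K. j * u \<in> K) \<and> U \<subseteq> K \<and> U \<noteq> K"
  have "?Q UNIV" using U by auto
  from ex_has_least_nat[of ?Q, OF this, of dim]
  obtain K where K: "subspace K" "\<And>j u. j \<in> J \<Longrightarrow> u \<in> K \<Longrightarrow> j * u \<in> K" "U \<subseteq> K" "U \<noteq> K"
    and min: "\<And>K'. ?Q K' \<Longrightarrow> dim K \<le> dim K'"
    by (elim exE conjE) simp
  obtain w where w: "w \<in> K" "w \<notin> U" using K by blast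
  show ?thesis
  proof (cases "\<forall>j\<in>J. j * w \<in> U")
    case True
    then show ?thesis using w by blast
  next
    case False
    then obtain j0 where j0: "j0 \<in> J" "j0 * w \<notin> U" by blast
    let ?M = "{u + v | u v. u \<in> U \<and> v \<in> {j * w | j. j \<in> J}}"
    have sub: "subspace ?M"
      by (rule subspace_sums[OF U(1) subspace_image_mult_right[OF Jsub]])
    have MK: "?M \<subseteq> K" using K w by (auto intro: subspace_add)
    have JM: "j * m \<in> ?M" if "j \<in> J" "m \<in> ?M" for j m
    proof -
      from that(2) obtain u i where "m = u + i * w" "u \<in> U" "i \<in> J" by blast
      then have "j * m = j * u + (j * i) * w" "j * u \<in> U" "j * i \<in> J"
        using that(1) U(3) AJ by (auto simp: distrib_left mult.assoc)
      then show ?thesis by blast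
    qed
    have UM: "U \<subseteq> ?M" using subspace_0[OF Jsub] by force
    have "j0 * w \<in> ?M" using j0 subspace_0[OF U(1)] by force
    then have "U \<noteq> ?M" using j0 by blast
    then have "dim K \<le> dim ?M" using min[of ?M] sub JM UM by blast
    then have "?M = K" using sub K MK by (intro subspace_dim_equal)
    then have "w \<in> ?M" using w by simp
    then obtain u v where "w = u + v" "u \<in> U" "v \<in> {j * w | j. j \<in> J}" by blast
    moreover from this(3) obtain x where "v = x * w" "x \<in> J" by blast
    ultimately have ux: "w = u + x * w" "u \<in> U" "x \<in> J" by simp_all
    have "w - suc_power x k * w \<in> U" for k
    proof (induction k)
      case 0
      have "w - x * w = u" using ux(1) by (metis add_diff_cancel_right')
      then show ?case using ux(2) by simp
    next
      case (Suc k)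
      have "w - x * w = u" using ux(1) by (metis add_diff_cancel_right')
      then have "w - suc_power x (Suc k) * w = u + x * (w - suc_power x k * w)"
        by (simp add: suc_power_Suc right_diff_distrib mult.assoc flip: \<open>w - x * w = u\<close>)
      then show ?case using subspace_add[OF U(1) ux(2) U(3)[OF ux(3) Suc]] by (simp only:)
    qed
    moreover obtain k where "suc_power x k = 0" using nil ux(3) by blast
    ultimately have "w \<in> U" by (metis diff_zero mult_zero_left)
    then show ?thesis using w by blast
  qed
qed

text \<open>
  The \<open>k\<close>th member consists of the vectors that are killed by all products of \<open>k\<close> elements of
  \<open>J\<close>. That the chain reaches the whole algebra expresses that \<open>J\<close> is nilpotent.
\<close>

primrec annihilator_chain :: "'a set \<Rightarrow> nat \<Rightarrow> 'a set" where
  "annihilator_chain J 0 = {0}"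
| "annihilator_chain J (Suc k) = {w. \<forall>j\<in>J. j * w \<in> annihilator_chain J k}"

lemma annihilator_chain_left_ideal:
  assumes J: "two_sided_ideal scale UNIV J"
  shows "left_ideal scale UNIV (annihilator_chain J k)"
proof (induction k)
  case (Suc k)
  have "subspace {w. \<forall>j\<in>J. j * w \<in> annihilator_chain J k}"
    using Suc unfolding subspace_def left_ideal_def
    by (auto simp: distrib_left scale_mult_right[symmetric])
  moreover have "a * w \<in> annihilator_chain J (Suc k)" if "w \<in> annihilator_chain J (Suc k)" for a w
    using that J by (auto simp: two_sided_ideal_def mult.assoc[symmetric])
  ultimately show ?case unfolding left_ideal_def by simp
qed (simp add: left_ideal_def)

lemma annihilator_chain_mono:
  assumes J: "two_sided_ideal scale UNIV J"
  shows "annihilator_chain J k \<subseteq> annihilator_chain J (Suc k)"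
  using annihilator_chain_left_ideal[OF J, of k] by (auto simp: left_ideal_def)

lemma annihilator_chain_exhausts:
  assumes J: "two_sided_ideal scale UNIV J" and nil: "\<And>x. x \<in> J \<Longrightarrow> \<exists>k. suc_power x k = 0"
  shows "annihilator_chain J (Suc dimension) = UNIV"
proof -
  have sub: "subspace (annihilator_chain J k)" for k
    using annihilator_chain_left_ideal[OF J, of k] by (auto simp: left_ideal_def)
  have "k \<le> dim (annihilator_chain J k) \<or> annihilator_chain J k = UNIV" for k
  proof (induction k)
    case (Suc k)
    show ?case
    proof (cases "annihilator_chain J k = UNIV")
      case True
      then show ?thesis using annihilator_chain_mono[OF J, of k] by auto
    next
      case False
      have "j * u \<in> annihilator_chain J k" if "u \<in> annihilator_chain J k" for j u
        using annihilator_chain_left_ideal[OF J, of k] that by (auto simp: left_ideal_def)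
      then obtain w where w: "w \<notin> annihilator_chain J k" "w \<in> annihilator_chain J (Suc k)"
        using nil_ideal_kills_vector[OF J nil sub False] by auto
      then have "annihilator_chain J k \<subset> annihilator_chain J (Suc k)"
        using annihilator_chain_mono[OF J, of k] by blast
      then have "dim (annihilator_chain J k) < dim (annihilator_chain J (Suc k))"
        using sub by (intro dim_psubset) (simp only: span_eq_iff[THEN iffD2])
      then show ?thesis using Suc False by simp
    qed
  qed simp
  from this[of "Suc dimension"] show ?thesis
    using dim_subset_UNIV[of "annihilator_chain J (Suc dimension)"] by auto
qed

end

section \<open>Density and the trace form over an algebraically closed field\<close>

locale acf_algebra = fd_algebra scale Basis
  for scale :: "'f::{alg_closed_field,field_char_0} \<Rightarrow> 'a::ring \<Rightarrow> 'a" and Basis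
begin

lemma in_span_image_finite:
  assumes "finite I" "x \<in> span (f ` I)"
  shows "\<exists>c. x = (\<Sum>i\<in>I. scale (c i) (f i))"
proof -
  let ?S = "{x. \<exists>c. x = (\<Sum>i\<in>I. scale (c i) (f i))}"
  have "span (f ` I) \<subseteq> ?S"
  proof (rule span_minimal)
    show "subspace ?S"
    proof (rule subspaceI)
      show "0 \<in> ?S" by (auto intro!: exI[of _ "\<lambda>_. 0"])
      show "x + y \<in> ?S" if "x \<in> ?S" "y \<in> ?S" for x y
      proof -
        from that obtain c c' where "x = (\<Sum>i\<in>I. scale (c i) (f i))" "y = (\<Sum>i\<in>I. scale (c' i) (f i))"
          by auto
        then show ?thesis
          by (auto intro!: exI[of _ "\<lambda>i. c i + c' i"] simp: scale_left_distrib sum.distrib)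
      qed
      show "scale a x \<in> ?S" if "x \<in> ?S" for a x
      proof -
        from that obtain c where "x = (\<Sum>i\<in>I. scale (c i) (f i))" by auto
        then show ?thesis
          by (auto intro!: exI[of _ "\<lambda>i. a * c i"] simp: scale_sum_right)
      qed
    qed
    show "f ` I \<subseteq> ?S"
    proof clarify
      fix i assume i: "i \<in> I"
      have "(\<Sum>j\<in>I. scale (if j = i then 1 else 0) (f j)) = (\<Sum>j\<in>I. if j = i then f i else 0)"
        by (intro sum.cong) auto
      also have "\<dots> = f i" using assms(1) i by simp
      finally show "\<exists>c. f i = (\<Sum>i\<in>I. scale (c i) (f i))"
        by (intro exI[of _ "\<lambda>j. if j = i then 1 else 0"]) simp
    qed
  qed
  then show ?thesis using assms(2) by blast
qed

text \<open>
  Otherwise the first \<open>n\<close> members would be independent for every \<open>n\<close>.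
\<close>

lemma sequence_dependent: "\<exists>n. s n \<in> span (s ` {..<n})" for s :: "nat \<Rightarrow> 'a"
proof (rule ccontr)
  assume "\<nexists>n. s n \<in> span (s ` {..<n})"
  then have new: "s n \<notin> span (s ` {..<n})" for n by blast
  have "independent (s ` {..<n}) \<and> card (s ` {..<n}) = n" for n
  proof (induction n)
    case (Suc n)
    have "s n \<notin> s ` {..<n}" using new[of n] span_base[of "s n" "s ` {..<n}"] by blast
    then show ?case
      using Suc new[of n] by (simp add: lessThan_Suc independent_insert)
  qed (simp add: independent_empty)
  from this[of "Suc dimension"] show False
    using independent_card_le_dim[of "s ` {..<Suc dimension}" UNIV]
    by (simp add: dimension_def)
qed

text \<open>
  The polynomials in \<open>\<phi>\<close> that kill \<open>y\<^sub>0\<close> include a nonzero one of least degree; splitting off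
  a root \<open>c\<close> leaves a polynomial \<open>q\<close> with \<open>q(\<phi>) y\<^sub>0 \<noteq> 0\<close>, which is an eigenvector for \<open>c\<close>. The
  assumptions on \<open>\<phi>\<close> concern only the subspace \<open>W\<close> because the lemma is applied to a map that
  is defined by choice on \<open>W\<close>.
\<close>

lemma eigenvector_exists:
  assumes W: "subspace W" and y0: "y0 \<in> W" "y0 \<noteq> 0"
    and maps: "\<And>x. x \<in> W \<Longrightarrow> \<phi> x \<in> W"
    and add: "\<And>x y. x \<in> W \<Longrightarrow> y \<in> W \<Longrightarrow> \<phi> (x + y) = \<phi> x + \<phi> y"
    and scl: "\<And>c x. x \<in> W \<Longrightarrow> \<phi> (scale c x) = scale c (\<phi> x)"
  shows "\<exists>c y. y \<in> W \<and> y \<noteq> 0 \<and> \<phi> y = scale c y"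
proof -
  define s where "s i = (\<phi> ^^ i) y0" for i
  have s_W: "s i \<in> W" for i by (induction i) (simp_all add: s_def y0 maps)
  have s_Suc: "\<phi> (s i) = s (Suc i)" for i by (simp add: s_def)
  define E where "E p = (\<Sum>i\<le>degree p. scale (coeff p i) (s i))" for p
  have E_ge: "E p = (\<Sum>i\<le>N. scale (coeff p i) (s i))" if "degree p \<le> N" for p N
    unfolding E_def using that
    by (intro sum.mono_neutral_left) (auto simp: coeff_eq_0)
  have E_W: "E p \<in> W" for p
    unfolding E_def using W s_W by (intro subspace_sum) (auto intro: subspace_scale)
  have zero: "\<phi> 0 = 0" using scl[of 0 0] subspace_0[OF W] by simp
  have phi_sum: "\<phi> (\<Sum>i\<in>I. g i) = (\<Sum>i\<in>I. \<phi> (g i))" if "\<And>i. i \<in> I \<Longrightarrow> g i \<in> W" "finite I"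
    for g and I :: "nat set"
    using that(2,1)
    by (induction I rule: finite_induct) (simp_all add: zero add subspace_sum[OF W])
  have E_factor: "E ([:- c, 1:] * q) = \<phi> (E q) - scale c (E q)" for c q
  proof -
    let ?N = "Suc (degree q)"
    have deg: "degree ([:- c, 1:] * q) \<le> ?N"
      using degree_mult_le[of "[:- c, 1:]" q] by simp
    have "E ([:- c, 1:] * q) = (\<Sum>i\<le>?N. scale (coeff (smult (- c) q + pCons 0 q) i) (s i))"
      using E_ge[OF deg] by simp
    also have "\<dots> = (\<Sum>i\<le>?N. scale (coeff (pCons 0 q) i) (s i)) - scale c (\<Sum>i\<le>?N. scale (coeff q i) (s i))"
      by (simp add: scale_left_diff_distrib sum_subtractf scale_sum_right del: sum.atMost_Suc)
    also have "(\<Sum>i\<le>?N. scale (coeff q i) (s i)) = E q" using E_ge[of q ?N] by simp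
    also have "(\<Sum>i\<le>?N. scale (coeff (pCons 0 q) i) (s i)) = (\<Sum>i\<le>degree q. scale (coeff q i) (s (Suc i)))"
      unfolding sum.atMost_Suc_shift by simp
    also have "\<dots> = \<phi> (E q)"
      unfolding E_def using s_W W by (subst phi_sum) (auto simp: scl s_Suc intro: subspace_scale)
    finally show ?thesis .
  qed
  obtain n where "s n \<in> span (s ` {..<n})" using sequence_dependent by blast
  then obtain c where c: "s n = (\<Sum>i<n. scale (c i) (s i))"
    using in_span_image_finite[of "{..<n}" "s n" s] by auto
  define p0 where "p0 = monom 1 n - (\<Sum>i<n. monom (c i) i)"
  have p0: "coeff p0 i = (if i = n then 1 else if i < n then - c i else 0)" for i
    unfolding p0_def coeff_diff coeff_sum coeff_monom by auto
  have "degree p0 \<le> n" by (rule degree_le) (simp add: p0)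
  then have "E p0 = (\<Sum>i\<le>n. scale (coeff p0 i) (s i))" by (rule E_ge)
  also have "\<dots> = (\<Sum>i<n. scale (coeff p0 i) (s i)) + s n"
    by (simp add: lessThan_Suc_atMost[symmetric] p0)
  also have "(\<Sum>i<n. scale (coeff p0 i) (s i)) = - s n"
    by (subst c) (simp add: p0 sum_negf)
  finally have "E p0 = 0" by simp
  moreover have "p0 \<noteq> 0" using p0[of n] by auto
  ultimately have "p0 \<noteq> 0 \<and> E p0 = 0" by simp
  from ex_has_least_nat[of "\<lambda>p. p \<noteq> 0 \<and> E p = 0", OF this, of degree]
  obtain p where p: "p \<noteq> 0" "E p = 0" and min: "\<And>q. q \<noteq> 0 \<Longrightarrow> E q = 0 \<Longrightarrow> degree p \<le> degree q"
    by auto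
  have "degree p > 0"
  proof (rule ccontr)
    assume "\<not> degree p > 0"
    then have "E p = scale (coeff p 0) y0" by (simp add: E_def s_def)
    moreover have "coeff p 0 \<noteq> 0" using p(1) \<open>\<not> degree p > 0\<close> leading_coeff_0_iff[of p] by simp
    ultimately show False using p(2) y0 by simp
  qed
  then obtain c where "poly p c = 0" using alg_closed_imp_poly_has_root by blast
  then obtain q where q: "p = [:- c, 1:] * q" by (metis poly_eq_0_iff_dvd dvdE)
  have q0: "q \<noteq> 0" using p(1) q by auto
  have "degree p = degree [:- c, 1:] + degree q"
    unfolding q by (rule degree_mult_eq) (use q0 in auto)
  then have "degree q < degree p" by simp
  then have "E q \<noteq> 0" using min[OF q0] by auto
  moreover have "\<phi> (E q) = scale c (E q)" using p(2) unfolding q E_factor by simp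
  ultimately show ?thesis using E_W by blast
qed

text \<open>
  Jacobson's density theorem for an algebra \<open>M\<close> of operators that acts irreducibly on \<open>W\<close>, by
  induction on \<open>S\<close>. Let \<open>L\<close> be the left ideal of the operators in \<open>M\<close> that kill \<open>S\<close>. If every
  operator of \<open>L\<close> that kills \<open>u\<close> also kills \<open>w\<close>, then \<open>T u \<mapsto> T w\<close> defines an \<open>M\<close>-linear map on
  \<open>W\<close>, which is a scalar \<open>c\<close> by Schur's lemma; so \<open>L\<close> kills \<open>w - c u\<close>, and by induction
  \<open>w - c u\<close> lies in the span of \<open>S\<close>.
\<close>

lemma density:
  assumes W: "subspace W"
    and add: "\<And>T x y. T \<in> M \<Longrightarrow> T (x + y) = T x + T y"
    and scl: "\<And>T c x. T \<in> M \<Longrightarrow> T (scale c x) = scale c (T x)"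
    and maps: "\<And>T x. T \<in> M \<Longrightarrow> x \<in> W \<Longrightarrow> T x \<in> W"
    and M_add: "\<And>S T. S \<in> M \<Longrightarrow> T \<in> M \<Longrightarrow> (\<lambda>x. S x + T x) \<in> M"
    and M_scl: "\<And>c T. T \<in> M \<Longrightarrow> (\<lambda>x. scale c (T x)) \<in> M"
    and M_comp: "\<And>S T. S \<in> M \<Longrightarrow> T \<in> M \<Longrightarrow> (\<lambda>x. S (T x)) \<in> M"
    and trans: "\<And>x y. x \<in> W \<Longrightarrow> x \<noteq> 0 \<Longrightarrow> y \<in> W \<Longrightarrow> \<exists>T\<in>M. T x = y"
    and S: "finite S" "S \<subseteq> W" and w: "w \<in> W" "w \<notin> span S"
  shows "\<exists>T\<in>M. (\<forall>s\<in>S. T s = 0) \<and> T w \<noteq> 0"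
  using S w
proof (induction S arbitrary: w rule: finite_induct)
  case empty
  then have "w \<noteq> 0" by auto
  then obtain T where "T \<in> M" "T w = w" using trans[OF empty(2) _ empty(2)] by blast
  with \<open>w \<noteq> 0\<close> show ?case by (intro bexI[of _ T]) auto
next
  case (insert u S)
  have u: "u \<in> W" and SW: "S \<subseteq> W" using insert.prems by auto
  have wS: "w \<notin> span S" using insert.prems span_mono[of S "insert u S"] by blast
  define L where "L = {T \<in> M. \<forall>s\<in>S. T s = 0}"
  have LM: "T \<in> M" if "T \<in> L" for T using that by (simp add: L_def)
  have L_add: "(\<lambda>x. R x + T x) \<in> L" if "R \<in> L" "T \<in> L" for R T
    using that M_add by (simp add: L_def)
  have L_scl: "(\<lambda>x. scale c (T x)) \<in> L" if "T \<in> L" for c T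
    using that M_scl by (simp add: L_def)
  have M0: "R 0 = 0" if "R \<in> M" for R using scl[OF that, of 0 0] by simp
  have L_comp: "(\<lambda>x. R (T x)) \<in> L" if "R \<in> M" "T \<in> L" for R T
    using that M_comp M0 by (simp add: L_def)
  show ?case
  proof (cases "u \<in> span S")
    case True
    obtain T where T: "T \<in> M" "\<forall>s\<in>S. T s = 0" "T w \<noteq> 0"
      using insert.IH[OF SW insert.prems(2) wS] by blast
    have "span S \<subseteq> {x. T x = 0}"
      using T by (intro span_minimal subspaceI) (auto simp: add scl M0)
    then show ?thesis using T True by auto
  next
    case False
    show ?thesis
    proof (rule ccontr)
      assume "\<not> ?thesis"
      then have ker: "T w = 0" if "T \<in> L" "T u = 0" for T
        using that by (auto simp: L_def)
      have onto: "\<exists>T\<in>L. T u = y" if y: "y \<in> W" for y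
      proof -
        obtain T where T: "T \<in> L" "T u \<noteq> 0"
          using insert.IH[OF SW u False] by (auto simp: L_def)
        obtain R where R: "R \<in> M" "R (T u) = y"
          using trans[OF maps[OF LM[OF T(1)] u] T(2) y] by blast
        then show ?thesis using L_comp[OF R(1) T(1)] by (intro bexI[of _ "\<lambda>x. R (T x)"]) auto
      qed
      define pick where "pick y = (SOME T. T \<in> L \<and> T u = y)" for y
      have pick: "pick y \<in> L \<and> pick y u = y" if y: "y \<in> W" for y
      proof -
        obtain T where "T \<in> L" "T u = y" using onto[OF y] by auto
        then show ?thesis unfolding pick_def by (intro someI[where P = "\<lambda>T. T \<in> L \<and> T u = y" and x = T]) simp
      qed
      define \<phi> where "\<phi> y = pick y w" for y
      have phi: "\<phi> (T u) = T w" if T: "T \<in> L" for T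
      proof -
        have Tu: "T u \<in> W" using maps[OF LM[OF T] u] .
        let ?D = "\<lambda>x. T x + scale (- 1) (pick (T u) x)"
        have "?D \<in> L" using L_add[OF T L_scl[OF conjunct1[OF pick[OF Tu]], of "- 1"]] .
        moreover have "?D u = 0" using pick[OF Tu] by simp
        ultimately have "?D w = 0" by (rule ker)
        then show ?thesis by (simp add: \<phi>_def)
      qed
      have phi_W: "\<phi> y \<in> W" if "y \<in> W" for y
        using pick[OF that] maps[OF LM insert.prems(2)] by (simp add: \<phi>_def)
      have phi_add: "\<phi> (x + y) = \<phi> x + \<phi> y" if "x \<in> W" "y \<in> W" for x y
        using phi[OF L_add[OF conjunct1[OF pick[OF that(1)]] conjunct1[OF pick[OF that(2)]]]]
          pick that by (simp add: \<phi>_def)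
      have phi_scl: "\<phi> (scale c x) = scale c (\<phi> x)" if "x \<in> W" for c x
        using phi[OF L_scl[OF conjunct1[OF pick[OF that]], of c]] pick[OF that] by (simp add: \<phi>_def)
      have "u \<noteq> 0" using False span_zero by auto
      then obtain c y where y: "y \<in> W" "y \<noteq> 0" "\<phi> y = scale c y"
        using eigenvector_exists[OF W u _ phi_W phi_add phi_scl] by blast
      have phi_c: "\<phi> z = scale c z" if z: "z \<in> W" for z
      proof -
        obtain R where R: "R \<in> M" "R y = z" using trans[OF y(1,2) z] by blast
        have "\<phi> z = \<phi> (R (pick y u))" using R pick[OF y(1)] by simp
        also have "\<dots> = R (pick y w)"
          using phi[OF L_comp[OF R(1) conjunct1[OF pick[OF y(1)]]]] by simp
        also have "\<dots> = R (scale c y)" using y(3) by (simp add: \<phi>_def)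
        finally show ?thesis using scl[OF R(1), of c y] R(2) by simp
      qed
      have "w - scale c u \<in> span S"
      proof (rule ccontr)
        assume n: "w - scale c u \<notin> span S"
        have "w - scale c u \<in> W"
          using W u insert.prems(2) by (intro subspace_diff subspace_scale)
        then obtain T where T: "T \<in> L" "T (w - scale c u) \<noteq> 0"
          using insert.IH[OF SW _ n] by (auto simp: L_def)
        have "T w = scale c (T u)"
          using phi[OF T(1)] phi_c maps[OF LM[OF T(1)] u] by simp
        moreover have "T (w - scale c u) = T w - scale c (T u)"
          using add[OF LM[OF T(1)], of "w - scale c u" "scale c u"] scl[OF LM[OF T(1)]] by simp
        ultimately show False using T(2) by simp
      qed
      then have "w \<in> span (insert u S)" by (auto simp: span_insert)
      then show False using insert.prems by blast
    qed
  qed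
qed

text \<open>
  By induction on the number of functionals: in the step, \<open>red\<close> projects to the common kernel
  of the functionals treated so far; if the new functional vanished there, it would be a
  combination of them.
\<close>

lemma dual_vectors:
  fixes \<xi> :: "'k \<Rightarrow> 'a \<Rightarrow> 'f"
  assumes V: "subspace V" and K: "finite K"
    and add: "\<And>k x y. x \<in> V \<Longrightarrow> y \<in> V \<Longrightarrow> \<xi> k (x + y) = \<xi> k x + \<xi> k y"
    and scl: "\<And>k c x. x \<in> V \<Longrightarrow> \<xi> k (scale c x) = c * \<xi> k x"
    and ind: "\<And>c. \<forall>v\<in>V. (\<Sum>k\<in>K. c k * \<xi> k v) = 0 \<Longrightarrow> \<forall>k\<in>K. c k = 0"
  shows "\<exists>v. (\<forall>k\<in>K. v k \<in> V) \<and> (\<forall>k\<in>K. \<forall>j\<in>K. \<xi> j (v k) = (if j = k then 1 else 0))"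
  using K ind
proof (induction K rule: finite_induct)
  case (insert k K)
  have diff: "\<xi> j (x - y) = \<xi> j x - \<xi> j y" if "x \<in> V" "y \<in> V" for j x y
    using add[of "x - y" y j] that subspace_diff[OF V] by (simp add: eq_diff_eq)
  have zero: "\<xi> j 0 = 0" for j using scl[of 0 j 0] subspace_0[OF V] by simp
  have sum: "\<xi> j (\<Sum>i\<in>I. g i) = (\<Sum>i\<in>I. \<xi> j (g i))" if "\<And>i. i \<in> I \<Longrightarrow> g i \<in> V" "finite I"
    for j g and I :: "'k set"
    using that(2,1)
    by (induction I rule: finite_induct) (simp_all add: zero add subspace_sum[OF V])
  have "\<forall>i\<in>K. c i = 0" if c: "\<forall>v\<in>V. (\<Sum>i\<in>K. c i * \<xi> i v) = 0" for c
  proof -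
    let ?c = "\<lambda>i. if i = k then 0 else c i"
    have "(\<Sum>i\<in>insert k K. ?c i * \<xi> i v) = (\<Sum>i\<in>K. c i * \<xi> i v)" for v
      using insert.hyps by (simp, intro sum.cong) auto
    then have "\<forall>i\<in>insert k K. ?c i = 0" using insert.prems[of ?c] c by simp
    then have "?c i = 0" if "i \<in> K" for i using that by blast
    then show ?thesis using insert.hyps by (metis (full_types))
  qed
  then obtain v where v: "\<And>i. i \<in> K \<Longrightarrow> v i \<in> V"
    and dual: "\<And>i j. i \<in> K \<Longrightarrow> j \<in> K \<Longrightarrow> \<xi> j (v i) = (if j = i then 1 else 0)"
    using insert.IH by blast
  define red where "red x = x - (\<Sum>i\<in>K. scale (\<xi> i x) (v i))" for x
  have sum_V: "(\<Sum>i\<in>K. scale (\<xi> i x) (v i)) \<in> V" for x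
    using V v by (intro subspace_sum) (auto intro: subspace_scale)
  have red_V: "red x \<in> V" if "x \<in> V" for x
    unfolding red_def using that V sum_V by (intro subspace_diff)
  have lam_red: "\<xi> j (red x) = \<xi> j x - (\<Sum>i\<in>K. \<xi> i x * \<xi> j (v i))" if "x \<in> V" for j x
  proof -
    have "\<xi> j (\<Sum>i\<in>K. scale (\<xi> i x) (v i)) = (\<Sum>i\<in>K. \<xi> j (scale (\<xi> i x) (v i)))"
      using insert.hyps(1) by (intro sum subspace_scale[OF V] v)
    also have "\<dots> = (\<Sum>i\<in>K. \<xi> i x * \<xi> j (v i))"
      by (intro sum.cong refl scl v)
    finally show ?thesis
      unfolding red_def using diff[OF that sum_V] by simp
  qed
  have red_0: "\<xi> j (red x) = 0" if "x \<in> V" "j \<in> K" for x j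
  proof -
    have "(\<Sum>i\<in>K. \<xi> i x * \<xi> j (v i)) = (\<Sum>i\<in>K. if j = i then \<xi> i x else 0)"
      using that(2) by (intro sum.cong) (auto simp: dual)
    also have "\<dots> = \<xi> j x" using that(2) insert.hyps by simp
    finally show ?thesis by (simp add: lam_red[OF that(1)])
  qed
  have "\<exists>x\<in>V. \<xi> k (red x) \<noteq> 0"
  proof (rule ccontr)
    assume n: "\<not> ?thesis"
    let ?c = "\<lambda>i. if i = k then 1 else - \<xi> k (v i)"
    have "(\<Sum>i\<in>insert k K. ?c i * \<xi> i x) = 0" if x: "x \<in> V" for x
    proof -
      have "(\<Sum>i\<in>insert k K. ?c i * \<xi> i x) = \<xi> k x + (\<Sum>i\<in>K. ?c i * \<xi> i x)"
        using insert.hyps by simp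
      also have "(\<Sum>i\<in>K. ?c i * \<xi> i x) = - (\<Sum>i\<in>K. \<xi> i x * \<xi> k (v i))"
        unfolding sum_negf[symmetric] using insert.hyps by (intro sum.cong) auto
      finally show ?thesis using n x lam_red[OF x, of k] by auto
    qed
    then have "?c k = 0" using insert.prems[of ?c] by blast
    then show False by simp
  qed
  then obtain x where x: "x \<in> V" "\<xi> k (red x) \<noteq> 0" by blast
  define z where "z = scale (1 / \<xi> k (red x)) (red x)"
  have z_V: "z \<in> V" unfolding z_def using V red_V[OF x(1)] by (rule subspace_scale)
  have z: "\<xi> j z = (if j = k then 1 else 0)" if "j \<in> insert k K" for j
    using that red_V[OF x(1)] x red_0[OF x(1)] insert.hyps by (auto simp: z_def scl)
  define v' where "v' i = (if i = k then z else v i - scale (\<xi> k (v i)) z)" for i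
  have "v' i \<in> V" if "i \<in> insert k K" for i
    using that z_V v V by (auto simp: v'_def intro!: subspace_diff subspace_scale)
  moreover have "\<xi> j (v' i) = (if j = i then 1 else 0)" if "i \<in> insert k K" "j \<in> insert k K" for i j
  proof (cases "i = k")
    case True
    then show ?thesis using z that by (simp add: v'_def)
  next
    case False
    then have i: "i \<in> K" using that by simp
    have "\<xi> j (v' i) = \<xi> j (v i) - \<xi> k (v i) * \<xi> j z"
      using False v[OF i] z_V subspace_scale[OF V z_V] by (simp add: v'_def diff scl)
    then show ?thesis using that i dual[OF i] z insert.hyps by (auto split: if_splits)
  qed
  ultimately show ?case by blast
qed simp

text \<open>
  The trace of the left multiplication by \<open>u\<close> on the span of the basis \<open>E\<close>.
\<close>

definition mult_trace :: "'a set \<Rightarrow> 'a \<Rightarrow> 'f" where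
  "mult_trace E u = (\<Sum>b\<in>E. representation E (u * b) b)"

context
  fixes E :: "'a set"
  assumes E: "independent E" and V: "subalgebra scale (span E)"
begin

lemma span_mult: "u \<in> span E \<Longrightarrow> v \<in> span E \<Longrightarrow> u * v \<in> span E"
  using V by (simp add: subalgebra_def)

lemma mult_trace_add:
  "u \<in> span E \<Longrightarrow> v \<in> span E \<Longrightarrow> mult_trace E (u + v) = mult_trace E u + mult_trace E v"
  unfolding mult_trace_def sum.distrib[symmetric]
  by (intro sum.cong refl)
    (simp add: distrib_right representation_add[OF E] span_mult span_base)

lemma mult_trace_scale:
  "u \<in> span E \<Longrightarrow> mult_trace E (scale c u) = c * mult_trace E u"
  unfolding mult_trace_def sum_distrib_left
  by (intro sum.cong refl)
    (simp add: scale_mult_left[symmetric] representation_scale[OF E] span_mult span_base)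

text \<open>
  The trace of a projection is its rank. Expanding \<open>e b\<close> in a basis \<open>F\<close> of the image and the
  elements of \<open>F\<close> in \<open>E\<close> turns the trace with respect to \<open>E\<close> into the one with respect to \<open>F\<close>,
  and \<open>e\<close> fixes the elements of \<open>F\<close>. The rank is nonzero in \<open>'f\<close> as the characteristic is \<open>0\<close>.
\<close>

lemma mult_trace_idempotent:
  assumes e: "e \<in> span E" "e * e = e" "e \<noteq> 0"
  shows "mult_trace E e \<noteq> 0"
proof -
  have finE: "finite E" using E finiteI_independent by blast
  let ?R = "{e * v | v. v \<in> span E}"
  have R: "subspace ?R" by (rule subspace_image_mult_left) simp
  obtain F where F: "F \<subseteq> ?R" "independent F" "?R \<subseteq> span F"
    using maximal_independent_subset[of ?R] by blast
  have finF: "finite F" using F(2) finiteI_independent by blast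
  have F_span: "e * v \<in> span F" if "v \<in> span E" for v using F(3) that by blast
  have FE: "f \<in> span E" and eF: "e * f = f" if "f \<in> F" for f
    using that F(1) e span_mult by (auto simp: mult.assoc[symmetric])
  have "e \<in> ?R" using e by (auto intro!: exI[of _ e])
  then have "F \<noteq> {}" using F(3) e(3) by auto
  then have card: "card F \<noteq> 0" using finF by simp
  have "mult_trace E e = (\<Sum>b\<in>E. representation E (\<Sum>f\<in>F. scale (representation F (e * b) f) f) b)"
    unfolding mult_trace_def
  proof (intro sum.cong refl)
    fix b assume b: "b \<in> E"
    have "(\<Sum>f\<in>F. scale (representation F (e * b) f) f) = e * b"
      using F(2) F_span[OF span_base[OF b]] finF by (intro sum_representation_eq) auto
    then show "representation E (e * b) b = representation E (\<Sum>f\<in>F. scale (representation F (e * b) f) f) b"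
      by simp
  qed
  also have "\<dots> = (\<Sum>b\<in>E. \<Sum>f\<in>F. representation F (e * b) f * representation E f b)"
    by (intro sum.cong refl)
      (simp add: representation_sum[OF E] representation_scale[OF E] FE span_scale)
  also have "\<dots> = (\<Sum>f\<in>F. \<Sum>b\<in>E. representation F (e * b) f * representation E f b)"
    by (rule sum.swap)
  also have "\<dots> = (\<Sum>f\<in>F. representation F (\<Sum>b\<in>E. scale (representation E f b) (e * b)) f)"
    by (intro sum.cong refl)
      (simp add: representation_sum[OF F(2)] representation_scale[OF F(2)] F_span span_base span_scale
        mult.commute)
  also have "\<dots> = (\<Sum>f\<in>F. representation F f f)"
  proof (intro sum.cong refl)
    fix f assume f: "f \<in> F"
    have "(\<Sum>b\<in>E. scale (representation E f b) (e * b)) = e * (\<Sum>b\<in>E. scale (representation E f b) b)"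
      by (simp add: sum_distrib_left scale_mult_right)
    also have "(\<Sum>b\<in>E. scale (representation E f b) b) = f"
      using E FE[OF f] finE by (intro sum_representation_eq) auto
    finally show "representation F (\<Sum>b\<in>E. scale (representation E f b) (e * b)) f = representation F f f"
      using eF[OF f] by simp
  qed
  also have "\<dots> = of_nat (card F)"
    using F(2) by (simp add: representation_basis)
  finally show ?thesis using card by simp
qed

text \<open>
  The radical \<open>R\<close> of the trace form is a left ideal. It meets each \<open>D i\<close> in a nil left ideal:
  an idempotent \<open>e \<noteq> 0\<close> in the intersection would have trace \<open>t (e e) = 0\<close>. So the
  intersection is \<open>0\<close> by semisimplicity. For \<open>v\<close> in \<open>R\<close> this gives \<open>D i * g i = 0\<close>, and the
  right annihilator of \<open>D i\<close> in \<open>D i\<close> has square \<open>0\<close>, so it vanishes for the same reason.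
\<close>

lemma mult_trace_nondegenerate:
  assumes I: "finite I"
    and sub: "\<And>i. i \<in> I \<Longrightarrow> subalgebra scale (D i)" "\<And>i. i \<in> I \<Longrightarrow> D i \<subseteq> span E"
    and orth: "\<And>i j x y. i \<in> I \<Longrightarrow> j \<in> I \<Longrightarrow> i \<noteq> j \<Longrightarrow> x \<in> D i \<Longrightarrow> y \<in> D j \<Longrightarrow> x * y = 0"
    and ss: "\<And>i. i \<in> I \<Longrightarrow> semisimple_algebra scale (D i)"
    and v: "v = (\<Sum>i\<in>I. g i)" "\<And>i. i \<in> I \<Longrightarrow> g i \<in> D i"
    and zero: "\<And>u. u \<in> span E \<Longrightarrow> mult_trace E (u * v) = 0"
  shows "v = 0"
proof -
  have Dsub: "subspace (D i)" and Dmult: "\<And>x y. x \<in> D i \<Longrightarrow> y \<in> D i \<Longrightarrow> x * y \<in> D i"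
    if "i \<in> I" for i
    using sub(1)[OF that] by (auto simp: subalgebra_def)
  define R where "R = {x \<in> span E. \<forall>u\<in>span E. mult_trace E (u * x) = 0}"
  have vV: "v \<in> span E"
    unfolding v(1) using v(2) sub(2) by (intro span_sum) blast
  have R_sub: "subspace R"
    unfolding R_def
    by (rule subspaceI)
      (auto simp: distrib_left mult_trace_add scale_mult_right[symmetric] mult_trace_scale span_mult
        span_zero span_add span_scale mult_trace_scale[of 0 0, simplified])
  have R_mult: "a * x \<in> R" if "x \<in> R" "a \<in> span E" for a x
    using that span_mult by (auto simp: R_def mult.assoc[symmetric])
  have R0: "R \<inter> D i = {0}" if i: "i \<in> I" for i
  proof -
    have N: "left_ideal scale (D i) (R \<inter> D i)"
      using R_sub Dsub[OF i] Dmult[OF i] R_mult sub(2)[OF i]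
      by (auto simp: left_ideal_def intro: subspace_inter)
    then have N': "subalgebra scale (R \<inter> D i)"
      by (auto simp: left_ideal_def subalgebra_def)
    have nil: "\<exists>k. suc_power x k = 0" if x: "x \<in> R \<inter> D i" for x
    proof (rule ccontr)
      assume "\<nexists>k. suc_power x k = 0"
      then obtain e where e: "e \<in> R \<inter> D i" "e * e = e" "e \<noteq> 0"
        using idempotent_if_not_nilpotent[OF N' x] by metis
      then have "mult_trace E (e * e) = 0" by (auto simp: R_def)
      then show False using e mult_trace_idempotent[of e] sub(2)[OF i] by auto
    qed
    have "R \<inter> D i \<subseteq> jacobson_radical scale (D i)"
      by (rule nil_left_ideal_subset_jacobson[OF sub(1)[OF i] N nil])
    then show ?thesis
      using ss[OF i] subspace_0[OF R_sub] subspace_0[OF Dsub[OF i]]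
      by (auto simp: semisimple_algebra_def)
  qed
  have vR: "v \<in> R" using vV zero by (simp add: R_def)
  have "g i = 0" if i: "i \<in> I" for i
  proof -
    define N where "N = {x \<in> D i. \<forall>u\<in>D i. u * x = 0}"
    have "left_ideal scale (D i) N"
      unfolding left_ideal_def N_def using Dsub[OF i] Dmult[OF i]
      by (auto simp: distrib_left scale_mult_right[symmetric] subspace_0 subspace_add subspace_scale
          mult.assoc[symmetric] intro!: subspaceI)
    moreover have "\<exists>k. suc_power x k = 0" if "x \<in> N" for x
      using that by (intro exI[of _ 1]) (auto simp: N_def suc_power_Suc)
    ultimately have "N \<subseteq> jacobson_radical scale (D i)"
      by (rule nil_left_ideal_subset_jacobson[OF sub(1)[OF i]])
    then have N0: "N \<subseteq> {0}" using ss[OF i] by (simp add: semisimple_algebra_def)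
    have "u * g i = 0" if u: "u \<in> D i" for u
    proof -
      have "u * v = (\<Sum>j\<in>I. u * g j)" by (simp add: v(1) sum_distrib_left)
      also have "\<dots> = (\<Sum>j\<in>I. if j = i then u * g i else 0)"
        using orth[OF i _ _ u] v(2) by (intro sum.cong) auto
      also have "\<dots> = u * g i" using I i by simp
      finally have "u * v = u * g i" .
      moreover have "u * v \<in> R" using R_mult[OF vR] sub(2)[OF i] u by blast
      moreover have "u * g i \<in> D i" using Dmult[OF i u v(2)[OF i]] .
      ultimately show ?thesis using R0[OF i] by auto
    qed
    then have "g i \<in> N" using v(2)[OF i] by (simp add: N_def)
    then show ?thesis using N0 by auto
  qed
  then show ?thesis by (simp add: v(1))
qed

end

end

section \<open>The operators of an \<open>H\<close>-simple algebra\<close>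

locale fd_action =
  generalized_action scaleH scaleA act + A: acf_algebra scaleA Basis
  for scaleH :: "'f::{alg_closed_field,field_char_0} \<Rightarrow> 'h::ring_1 \<Rightarrow> 'h"
    and scaleA :: "'f \<Rightarrow> 'a::ring \<Rightarrow> 'a"
    and act :: "'h \<Rightarrow> 'a \<Rightarrow> 'a" and Basis
begin

lemma act_product_sum:
  "\<exists>(n::nat) h1 h2 h3 h4. \<forall>a b. act h (a * b) =
     (\<Sum>i<n. act (h1 i) a * act (h2 i) b + act (h3 i) b * act (h4 i) a)"
proof -
  obtain ts where ts: "\<And>a b. act h (a * b) =
      (\<Sum>(h1, h2, h3, h4) \<leftarrow> ts. act h1 a * act h2 b + act h3 b * act h4 a)"
    using act_product[of h] by blast
  have "act h (a * b) = (\<Sum>i<length ts. act (fst (ts ! i)) a * act (fst (snd (ts ! i))) b +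
      act (fst (snd (snd (ts ! i)))) b * act (snd (snd (snd (ts ! i)))) a)" for a b
    unfolding ts by (simp add: sum_list_sum_nth case_prod_beta atLeast0LessThan)
  then show ?thesis by (intro exI allI)
qed

text \<open>
  The operators that an \<open>H\<close>-polynomial can realise on one variable with coefficients in \<open>P\<close> on
  both sides. Requiring coefficients on both sides makes the operators with coefficients in
  \<open>B\<^sub>i\<close> vanish on all \<open>B\<^sub>j\<close> with \<open>j \<noteq> i\<close>.
\<close>

inductive_set sandwich :: "'a set \<Rightarrow> ('a \<Rightarrow> 'a) set" for P where
  sandwich_zero: "(\<lambda>x. 0) \<in> sandwich P"
| sandwich_add: "S \<in> sandwich P \<Longrightarrow> T \<in> sandwich P \<Longrightarrow> (\<lambda>x. S x + T x) \<in> sandwich P"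
| sandwich_basic: "p \<in> P \<Longrightarrow> s \<in> P \<Longrightarrow> (\<lambda>x. p * act h x * s) \<in> sandwich P"

lemma sandwich_mono: "T \<in> sandwich P \<Longrightarrow> P \<subseteq> Q \<Longrightarrow> T \<in> sandwich Q"
  by (induction rule: sandwich.induct) (auto intro: sandwich.intros)

lemma sandwich_additive: "T \<in> sandwich P \<Longrightarrow> T (x + y) = T x + T y"
  by (induction rule: sandwich.induct) (auto simp: act_add_right algebra_simps)

lemma sandwich_scale: "T \<in> sandwich P \<Longrightarrow> T (scaleA c x) = scaleA c (T x)"
  by (induction rule: sandwich.induct)
    (auto simp: act_scale_right A.scale_right_distrib A.scale_mult_left[symmetric]
      A.scale_mult_right[symmetric])

lemma sandwich_sum:
  assumes "finite I" "\<And>i. i \<in> I \<Longrightarrow> T i \<in> sandwich P"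
  shows "(\<lambda>x. \<Sum>i\<in>I. T i x) \<in> sandwich P"
  using assms by (induction I rule: finite_induct) (auto intro: sandwich_zero sandwich_add)

lemma sandwich_mult_right: "T \<in> sandwich UNIV \<Longrightarrow> (\<lambda>x. T x * a) \<in> sandwich UNIV"
proof (induction rule: sandwich.induct)
  case (sandwich_add S T)
  then show ?case using sandwich.sandwich_add by (simp add: distrib_right)
next
  case (sandwich_basic p s h)
  then show ?case using sandwich.sandwich_basic[of p UNIV "s * a" h] by (simp add: mult.assoc)
qed (simp add: sandwich_zero)

context
  fixes P :: "'a set"
  assumes P: "subalgebra scaleA P" and inv: "invariant act P"
begin

lemma P_sub: "A.subspace P" and P_mult: "x \<in> P \<Longrightarrow> y \<in> P \<Longrightarrow> x * y \<in> P"
  and P_act: "x \<in> P \<Longrightarrow> act h x \<in> P"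
  using P inv by (auto simp: subalgebra_def invariant_def)

lemma sandwich_maps: "T \<in> sandwich P \<Longrightarrow> x \<in> P \<Longrightarrow> T x \<in> P"
  by (induction rule: sandwich.induct)
    (auto intro: A.subspace_0[OF P_sub] A.subspace_add[OF P_sub] P_mult P_act)

lemma sandwich_scale_closed: "T \<in> sandwich P \<Longrightarrow> (\<lambda>x. scaleA c (T x)) \<in> sandwich P"
proof (induction rule: sandwich.induct)
  case (sandwich_add S T)
  then show ?case using sandwich.sandwich_add by (simp add: A.scale_right_distrib)
next
  case (sandwich_basic p s h)
  have "scaleA c p \<in> P" using A.subspace_scale[OF P_sub sandwich_basic(1)] .
  then show ?case using sandwich.sandwich_basic[of "scaleA c p" P s h] sandwich_basic
    by (simp add: A.scale_mult_left)
qed (simp add: sandwich_zero)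

text \<open>
  The rule for \<open>h (a b)\<close> moves an operator inside to the variable itself, possibly on the
  other side of the coefficient; the outer coefficients \<open>p\<close> and \<open>s\<close> keep the variable
  enclosed.
\<close>

lemma sandwich_act_mult:
  assumes p: "p \<in> P" and s: "s \<in> P" and r: "r \<in> P"
  shows "(\<lambda>x. p * act h (act k x * r) * s) \<in> sandwich P"
proof -
  obtain n h1 h2 h3 h4 where e: "\<And>a b. act h (a * b) =
     (\<Sum>i<n::nat. act (h1 i) a * act (h2 i) b + act (h3 i) b * act (h4 i) a)"
    using act_product_sum[of h] by blast
  have eq: "p * act h (act k x * r) * s = (\<Sum>i<n. p * act (h1 i * k) x * (act (h2 i) r * s) +
      (p * act (h3 i) r) * act (h4 i * k) x * s)" for x
    by (simp add: e act_mult sum_distrib_left sum_distrib_right distrib_left distrib_right mult.assoc)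
  show ?thesis
    unfolding eq using p s r
    by (intro sandwich_sum sandwich_add sandwich_basic P_mult P_act) auto
qed

lemma sandwich_act_mult2:
  assumes p: "p \<in> P" and s: "s \<in> P" and r: "r \<in> P" and q: "q \<in> P"
  shows "(\<lambda>x. p * act h (q * act k x * r) * s) \<in> sandwich P"
proof -
  obtain n h1 h2 h3 h4 where e: "\<And>a b. act h (a * b) =
     (\<Sum>i<n::nat. act (h1 i) a * act (h2 i) b + act (h3 i) b * act (h4 i) a)"
    using act_product_sum[of h] by blast
  have eq: "p * act h (q * act k x * r) * s = (\<Sum>i<n. (p * act (h1 i) q) * act (h2 i) (act k x * r) * s +
      p * act (h3 i) (act k x * r) * (act (h4 i) q * s))" for x
    by (simp add: e mult.assoc sum_distrib_left sum_distrib_right distrib_left distrib_right)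
  show ?thesis
    unfolding eq using p s r q
    by (intro sandwich_sum sandwich_add sandwich_act_mult P_mult P_act) auto
qed

lemma sandwich_comp: "T \<in> sandwich P \<Longrightarrow> S \<in> sandwich P \<Longrightarrow> (\<lambda>x. T (S x)) \<in> sandwich P"
proof (induction rule: sandwich.induct)
  case (sandwich_basic p s h)
  from sandwich_basic(3) show ?case
  proof (induction rule: sandwich.induct)
    case sandwich_zero
    have "act h 0 = 0" using act_scale_right[of h 0 0] by simp
    then show ?case by (simp add: sandwich.sandwich_zero)
  next
    case (sandwich_add S T)
    then show ?case using sandwich.sandwich_add by (simp add: act_add_right distrib_left distrib_right)
  next
    case (sandwich_basic q r k)
    then show ?case using sandwich_act_mult2 \<open>p \<in> P\<close> \<open>s \<in> P\<close> by simp
  qed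
qed (auto intro: sandwich.intros)

text \<open>
  The span of the products is a nonzero invariant ideal.
\<close>

lemma H_simple_square:
  assumes "H_simple scaleA act P"
  shows "P \<subseteq> A.span {a * b | a b. a \<in> P \<and> b \<in> P}"
proof -
  let ?G = "{a * b | a b. a \<in> P \<and> b \<in> P}"
  have GP: "A.span ?G \<subseteq> P"
    using P_mult by (intro A.span_minimal[OF _ P_sub]) auto
  have "two_sided_ideal scaleA P (A.span ?G)"
    unfolding two_sided_ideal_def
  proof (intro conjI ballI)
    fix s x assume "s \<in> P" "x \<in> A.span ?G"
    then have "x \<in> P" "s \<in> P" using GP by auto
    then show "s * x \<in> A.span ?G" "x * s \<in> A.span ?G"
      by (auto intro!: A.span_base)
  qed (use GP in auto)
  moreover have "invariant act (A.span ?G)"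
    unfolding invariant_def
  proof (intro allI ballI)
    fix h x assume "x \<in> A.span ?G"
    moreover have "A.span ?G \<subseteq> {x. act h x \<in> A.span ?G}"
    proof (rule A.span_minimal)
      show "A.subspace {x. act h x \<in> A.span ?G}"
        using act_scale_right[of h 0 0]
        by (intro A.subspaceI) (auto simp: act_add_right act_scale_right A.span_zero
            intro: A.span_add A.span_scale)
      show "?G \<subseteq> {x. act h x \<in> A.span ?G}"
      proof clarify
        fix a b assume ab: "a \<in> P" "b \<in> P"
        obtain n h1 h2 h3 h4 where e: "\<And>a b. act h (a * b) =
           (\<Sum>i<n::nat. act (h1 i) a * act (h2 i) b + act (h3 i) b * act (h4 i) a)"
          using act_product_sum[of h] by blast
        show "act h (a * b) \<in> A.span ?G"
          unfolding e using ab P_act by (intro A.span_sum A.span_add A.span_base) auto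
      qed
    qed
    ultimately show "act h x \<in> A.span ?G" by blast
  qed
  ultimately have "A.span ?G = {0} \<or> A.span ?G = P"
    using assms by (simp add: H_simple_def)
  moreover obtain x y where "x \<in> P" "y \<in> P" "x * y \<noteq> 0"
    using assms by (auto simp: H_simple_def)
  then have "A.span ?G \<noteq> {0}" using A.span_base[of "x * y" ?G] by auto
  ultimately show ?thesis by simp
qed

text \<open>
  The values \<open>T x\<close> form a subspace \<open>M\<close>. The elements \<open>n\<close> with \<open>P (H n) P \<subseteq> M\<close> form an
  invariant ideal that contains \<open>x\<close>, hence all of \<open>P\<close>; so \<open>M\<close> contains \<open>P P P\<close>, which spans
  \<open>P\<close>.
\<close>

lemma sandwich_transitive:
  assumes simple: "H_simple scaleA act P" and x: "x \<in> P" "x \<noteq> 0" and y: "y \<in> P"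
  shows "\<exists>T\<in>sandwich P. T x = y"
proof -
  define M where "M = {T x | T. T \<in> sandwich P}"
  have M: "A.subspace M"
  proof (rule A.subspaceI)
    show "0 \<in> M" by (auto simp: M_def intro!: exI[of _ "\<lambda>x. 0"] sandwich_zero)
    show "u + v \<in> M" if "u \<in> M" "v \<in> M" for u v
    proof -
      from that obtain S T where "S \<in> sandwich P" "u = S x" "T \<in> sandwich P" "v = T x"
        by (auto simp: M_def)
      then show ?thesis using sandwich_add[of S P T] by (auto simp: M_def)
    qed
    show "scaleA c u \<in> M" if "u \<in> M" for c u
    proof -
      from that obtain T where "T \<in> sandwich P" "u = T x" by (auto simp: M_def)
      then show ?thesis using sandwich_scale_closed[of T c] by (auto simp: M_def)
    qed
  qed
  define Q where "Q = {n \<in> P. \<forall>a\<in>P. \<forall>b\<in>P. \<forall>k. a * act k n * b \<in> M}"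
  have QP: "Q \<subseteq> P" by (auto simp: Q_def)
  have act0: "act k 0 = 0" for k using act_scale_right[of k 0 0] by simp
  have Qsub: "A.subspace Q"
    by (rule A.subspaceI)
      (auto simp: Q_def act0 A.subspace_0[OF M] A.subspace_0[OF P_sub] A.subspace_add[OF M] A.subspace_add[OF P_sub]
        A.subspace_scale[OF M] A.subspace_scale[OF P_sub] act_add_right act_scale_right distrib_left distrib_right
        A.scale_mult_left[symmetric] A.scale_mult_right[symmetric])
  have "two_sided_ideal scaleA P Q"
    unfolding two_sided_ideal_def
  proof (intro conjI ballI)
    fix c n assume c: "c \<in> P" and n: "n \<in> Q"
    have nP: "n \<in> P" and nQ: "\<And>a b k. a \<in> P \<Longrightarrow> b \<in> P \<Longrightarrow> a * act k n * b \<in> M"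
      using n by (auto simp: Q_def)
    have 1: "a * act k (c * n) * b \<in> M" and 2: "a * act k (n * c) * b \<in> M"
      if a: "a \<in> P" and b: "b \<in> P" for a b k
    proof -
      obtain m h1 h2 h3 h4 where e: "\<And>a b. act k (a * b) =
         (\<Sum>i<m::nat. act (h1 i) a * act (h2 i) b + act (h3 i) b * act (h4 i) a)"
        using act_product_sum[of k] by blast
      have "a * act k (c * n) * b = (\<Sum>i<m. (a * act (h1 i) c) * act (h2 i) n * b +
          a * act (h3 i) n * (act (h4 i) c * b))"
        by (simp add: e mult.assoc sum_distrib_left sum_distrib_right distrib_left distrib_right)
      then show "a * act k (c * n) * b \<in> M"
        using a b c by (auto intro!: A.subspace_sum[OF M] A.subspace_add[OF M] nQ P_mult P_act)
      have "a * act k (n * c) * b = (\<Sum>i<m. a * act (h1 i) n * (act (h2 i) c * b) +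
          (a * act (h3 i) c) * act (h4 i) n * b)"
        by (simp add: e mult.assoc sum_distrib_left sum_distrib_right distrib_left distrib_right)
      then show "a * act k (n * c) * b \<in> M"
        using a b c by (auto intro!: A.subspace_sum[OF M] A.subspace_add[OF M] nQ P_mult P_act)
    qed
    show "c * n \<in> Q" using 1 P_mult[OF c nP] by (simp add: Q_def)
    show "n * c \<in> Q" using 2 P_mult[OF nP c] by (simp add: Q_def)
  qed (use QP Qsub in auto)
  moreover have "invariant act Q"
    by (auto simp: invariant_def Q_def P_act act_mult[symmetric])
  ultimately have "Q = {0} \<or> Q = P" using simple by (simp add: H_simple_def)
  moreover have "x \<in> Q"
    using x(1) unfolding Q_def M_def by (auto intro!: sandwich_basic exI)
  ultimately have QP: "Q = P" using x(2) by auto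
  have abc: "a * n * b \<in> M" if "a \<in> P" "n \<in> P" "b \<in> P" for a n b
  proof -
    have "a * act 1 n * b \<in> M" using that QP by (auto simp: Q_def)
    then show ?thesis by (simp add: act_one)
  qed
  have ab: "a * b \<in> M" if a: "a \<in> P" and b: "b \<in> P" for a b
  proof -
    have "A.span {a * b | a b. a \<in> P \<and> b \<in> P} \<subseteq> {b. a * b \<in> M}"
    proof (rule A.span_minimal)
      show "A.subspace {b. a * b \<in> M}"
        by (rule A.subspaceI)
          (auto simp: A.subspace_0[OF M] A.subspace_add[OF M] A.subspace_scale[OF M] distrib_left
            A.scale_mult_right[symmetric])
      show "{a * b | a b. a \<in> P \<and> b \<in> P} \<subseteq> {b. a * b \<in> M}"
        using abc a by (auto simp: mult.assoc[symmetric])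
    qed
    then show ?thesis using H_simple_square[OF simple] b by blast
  qed
  have "A.span {a * b | a b. a \<in> P \<and> b \<in> P} \<subseteq> M"
    using ab by (intro A.span_minimal[OF _ M]) auto
  then have "y \<in> M" using H_simple_square[OF simple] y by blast
  then show ?thesis by (auto simp: M_def)
qed

lemma sandwich_interpolate:
  assumes simple: "H_simple scaleA act P"
    and S: "finite S" "S \<subseteq> P" and w: "w \<in> P" "w \<notin> A.span S" and y: "y \<in> P"
  shows "\<exists>T\<in>sandwich P. (\<forall>s\<in>S. T s = 0) \<and> T w = y"
proof -
  obtain T where T: "T \<in> sandwich P" "\<forall>s\<in>S. T s = 0" "T w \<noteq> 0"
  proof -
    have "\<exists>T\<in>sandwich P. (\<forall>s\<in>S. T s = 0) \<and> T w \<noteq> 0"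
      by (rule A.density[of P "sandwich P" S w])
        (fact P_sub sandwich_additive sandwich_scale sandwich_maps sandwich_add sandwich_scale_closed sandwich_comp
          sandwich_transitive[OF simple] S w)+
    then show thesis using that by blast
  qed
  obtain R where R: "R \<in> sandwich P" "R (T w) = y"
    using sandwich_transitive[OF simple sandwich_maps[OF T(1) w(1)] T(3) y] by blast
  have "R 0 = 0" using sandwich_scale[OF R(1), of 0 0] by simp
  then show ?thesis
    using T R sandwich_comp[OF R(1) T(1)] by (intro bexI[of _ "\<lambda>x. R (T x)"]) auto
qed

end

end

section \<open>Operators along a radical chain\<close>

locale wedderburn_action =
  fd_action scaleH scaleA act Basis
  for scaleH :: "'f::{alg_closed_field,field_char_0} \<Rightarrow> 'h::ring_1 \<Rightarrow> 'h"
    and scaleA :: "'f \<Rightarrow> 'a::ring \<Rightarrow> 'a"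
    and act :: "'h \<Rightarrow> 'a \<Rightarrow> 'a" and Basis +
  fixes J B :: "'a set" and Bs :: "nat \<Rightarrow> 'a set" and q :: nat
  assumes not_nilpotent: "\<not> nilpotent_algebra (UNIV :: 'a set)"
    and J_eq: "J = jacobson_radical scaleA UNIV"
    and J_invariant: "invariant act J"
    and B_subalgebra: "subalgebra scaleA B"
    and B_plus_J: "\<forall>a. \<exists>b\<in>B. \<exists>j\<in>J. a = b + j"
    and B_direct: "direct_sum_of B {1..q} Bs"
    and Bs_props: "\<forall>i\<in>{1..q}. two_sided_ideal scaleA B (Bs i) \<and> invariant act (Bs i) \<and>
           H_simple scaleA act (Bs i) \<and> semisimple_algebra scaleA (Bs i)"
begin

lemma J_ideal: "two_sided_ideal scaleA UNIV J"
  unfolding J_eq by (rule A.two_sided_ideal_jacobson)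

lemma Bs_subspace: "i \<in> {1..q} \<Longrightarrow> A.subspace (Bs i)"
  and Bs_B: "i \<in> {1..q} \<Longrightarrow> Bs i \<subseteq> B"
  and Bs_invariant: "i \<in> {1..q} \<Longrightarrow> invariant act (Bs i)"
  and Bs_simple: "i \<in> {1..q} \<Longrightarrow> H_simple scaleA act (Bs i)"
  and Bs_semisimple: "i \<in> {1..q} \<Longrightarrow> semisimple_algebra scaleA (Bs i)"
  and Bs_left: "i \<in> {1..q} \<Longrightarrow> b \<in> B \<Longrightarrow> x \<in> Bs i \<Longrightarrow> b * x \<in> Bs i"
  and Bs_right: "i \<in> {1..q} \<Longrightarrow> b \<in> B \<Longrightarrow> x \<in> Bs i \<Longrightarrow> x * b \<in> Bs i"
  using Bs_props by (auto simp: two_sided_ideal_def)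

lemma Bs_subalgebra: "i \<in> {1..q} \<Longrightarrow> subalgebra scaleA (Bs i)"
  unfolding subalgebra_def using Bs_subspace Bs_left Bs_B by blast

lemma Bs_independent:
  assumes "\<And>i. i \<in> {1..q} \<Longrightarrow> f i \<in> Bs i" "(\<Sum>i\<in>{1..q}. f i) = 0" "i \<in> {1..q}"
  shows "f i = 0"
  using B_direct assms unfolding direct_sum_of_def by blast

lemma Bs_Int:
  assumes i: "i \<in> {1..q}" "j \<in> {1..q}" "i \<noteq> j" and x: "x \<in> Bs i" "x \<in> Bs j"
  shows "x = 0"
proof -
  define f where "f k = (if k = i then x else if k = j then - x else 0)" for k
  have "f k \<in> Bs k" if "k \<in> {1..q}" for k
    using x i that by (simp add: f_def A.subspace_0[OF Bs_subspace] A.subspace_neg[OF Bs_subspace])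
  moreover have "(\<Sum>k\<in>{1..q}. f k) = (\<Sum>k\<in>{1..q}. (if k = i then x else 0) + (if k = j then - x else 0))"
    using i(3) by (intro sum.cong) (auto simp: f_def)
  then have "(\<Sum>k\<in>{1..q}. f k) = 0"
    using i by (simp only: sum.distrib) simp
  ultimately have "f i = 0" using i by (intro Bs_independent[of f i])
  then show ?thesis by (simp add: f_def)
qed

lemma Bs_orth: "i \<in> {1..q} \<Longrightarrow> j \<in> {1..q} \<Longrightarrow> i \<noteq> j \<Longrightarrow> x \<in> Bs i \<Longrightarrow> y \<in> Bs j \<Longrightarrow> x * y = 0"
  using Bs_Int[of i j "x * y"] Bs_left[of j x y] Bs_right[of i y x] Bs_B by blast

lemma decompose:
  obtains f j where "\<And>i. i \<in> {1..q} \<Longrightarrow> f i \<in> Bs i" "j \<in> J" "a = (\<Sum>i\<in>{1..q}. f i) + j"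
proof -
  obtain b j where "b \<in> B" "j \<in> J" "a = b + j" using B_plus_J by blast
  moreover obtain f where "b = (\<Sum>i\<in>{1..q}. f i)" "\<forall>i\<in>{1..q}. f i \<in> Bs i"
    using \<open>b \<in> B\<close> B_direct unfolding direct_sum_of_def by blast
  ultimately show thesis using that by blast
qed

definition basis_of :: "nat \<Rightarrow> 'a set" where
  "basis_of i = (SOME E. E \<subseteq> Bs i \<and> A.independent E \<and> Bs i \<subseteq> A.span E)"

lemma basis_of: "basis_of i \<subseteq> Bs i \<and> A.independent (basis_of i) \<and> Bs i \<subseteq> A.span (basis_of i)"
proof -
  obtain E where "E \<subseteq> Bs i" "A.independent E" "Bs i \<subseteq> A.span E"
    using A.maximal_independent_subset[of "Bs i"] by metis
  then have "\<exists>E. E \<subseteq> Bs i \<and> A.independent E \<and> Bs i \<subseteq> A.span E"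
    by (intro exI[of _ E]) simp
  then show ?thesis unfolding basis_of_def by (rule someI_ex)
qed

lemma finite_basis_of: "finite (basis_of i)"
  using basis_of A.finiteI_independent by blast

lemma span_basis_of: "i \<in> {1..q} \<Longrightarrow> A.span (basis_of i) = Bs i"
  using basis_of[of i] Bs_subspace A.span_minimal by blast

definition basis_union :: "nat set \<Rightarrow> 'a set" where
  "basis_union I = (\<Union>i\<in>I. basis_of i)"

lemma disjoint_basis_of:
  "i \<in> {1..q} \<Longrightarrow> j \<in> {1..q} \<Longrightarrow> i \<noteq> j \<Longrightarrow> basis_of i \<inter> basis_of j = {}"
proof -
  assume a: "i \<in> {1..q}" "j \<in> {1..q}" "i \<noteq> j"
  have "x = 0" if "x \<in> basis_of i" "x \<in> basis_of j" for x
    using that basis_of[of i] basis_of[of j] Bs_Int[OF a] by blast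
  moreover have "0 \<notin> basis_of i" using basis_of[of i] A.dependent_zero by blast
  ultimately show ?thesis by blast
qed

lemma finite_basis_union: "I \<subseteq> {1..q} \<Longrightarrow> finite (basis_union I)"
  unfolding basis_union_def using finite_basis_of finite_subset by blast

lemma independent_basis_union:
  assumes I: "I \<subseteq> {1..q}"
  shows "A.independent (basis_union I)"
proof (rule A.independent_if_scalars_zero)
  show "finite (basis_union I)" using I by (rule finite_basis_union)
  fix c x assume zero: "(\<Sum>x\<in>basis_union I. scaleA (c x) x) = 0" and x: "x \<in> basis_union I"
  have finI: "finite I" using I finite_subset by blast
  define f where "f i = (if i \<in> I then \<Sum>x\<in>basis_of i. scaleA (c x) x else 0)" for i
  have f_Bs: "f i \<in> Bs i" if "i \<in> {1..q}" for i
    unfolding f_def using that basis_of[of i]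
    by (auto intro!: A.subspace_sum A.subspace_scale A.subspace_0 Bs_subspace)
  have "(\<Sum>i\<in>{1..q}. f i) = (\<Sum>i\<in>I. \<Sum>x\<in>basis_of i. scaleA (c x) x)"
    using I by (intro sum.mono_neutral_cong_right) (auto simp: f_def)
  also have "\<dots> = (\<Sum>x\<in>basis_union I. scaleA (c x) x)"
    unfolding basis_union_def using I finI finite_basis_of disjoint_basis_of
    by (intro sum.UNION_disjoint[symmetric]) blast+
  finally have "(\<Sum>i\<in>{1..q}. f i) = 0" using zero by simp
  obtain i where i: "i \<in> I" "x \<in> basis_of i" using x by (auto simp: basis_union_def)
  then have "f i = 0" using Bs_independent[OF f_Bs \<open>(\<Sum>i\<in>{1..q}. f i) = 0\<close>, of i] I by blast
  then have "(\<Sum>x\<in>basis_of i. scaleA (c x) x) = 0" using i by (simp add: f_def)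
  then show "c x = 0"
    using A.independentD[of "basis_of i" "basis_of i" c x] basis_of[of i] finite_basis_of i by blast
qed

lemma span_basis_union: "A.span (basis_union I) = A.span (\<Union>i\<in>I. Bs i)"
proof
  show "A.span (basis_union I) \<subseteq> A.span (\<Union>i\<in>I. Bs i)"
    unfolding basis_union_def using basis_of by (intro A.span_mono) blast
  have "Bs i \<subseteq> A.span (basis_union I)" if "i \<in> I" for i
    using that basis_of[of i] A.span_mono[of "basis_of i" "basis_union I"]
    unfolding basis_union_def by blast
  then show "A.span (\<Union>i\<in>I. Bs i) \<subseteq> A.span (basis_union I)"
    by (intro A.span_minimal) auto
qed

lemma dim_Bs: "I \<subseteq> {1..q} \<Longrightarrow> A.dim (A.span (\<Union>i\<in>I. Bs i)) = card (basis_union I)"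
  unfolding span_basis_union[symmetric]
  by (rule A.dim_span_eq_card_independent) (rule independent_basis_union)

definition interpolated :: "'a \<Rightarrow> 'a set" where
  "interpolated e = {T e | T. T \<in> sandwich UNIV \<and> (\<forall>e' \<in> basis_union {1..q} - {e}. T e' = 0)}"

lemma interpolated_mult_right: "y \<in> interpolated e \<Longrightarrow> y * a \<in> interpolated e"
proof -
  assume "y \<in> interpolated e"
  then obtain T where T: "T \<in> sandwich UNIV" "\<forall>e' \<in> basis_union {1..q} - {e}. T e' = 0" "y = T e"
    by (auto simp: interpolated_def)
  have "\<forall>e' \<in> basis_union {1..q} - {e}. T e' * a = 0" using T(2) by simp
  then show ?thesis
    unfolding interpolated_def using sandwich_mult_right[OF T(1), of a] T(3)
    by (intro CollectI exI[of _ "\<lambda>x. T x * a"]) simp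
qed

lemma sandwich_Bs_orth:
  assumes T: "T \<in> sandwich (Bs i)" and ij: "i \<in> {1..q}" "j \<in> {1..q}" "i \<noteq> j" and x: "x \<in> Bs j"
  shows "T x = 0"
  using T
proof (induction rule: sandwich.induct)
  case (sandwich_basic p s h)
  have "act h x \<in> Bs j" using Bs_invariant[OF ij(2)] x by (auto simp: invariant_def)
  then show ?case using Bs_orth[OF ij sandwich_basic(1)] by simp
qed auto

lemma Bs_interpolated:
  assumes i: "i \<in> {1..q}" and e: "e \<in> basis_of i"
  shows "Bs i \<subseteq> interpolated e"
proof
  fix y assume y: "y \<in> Bs i"
  have ind: "A.independent (basis_of i)" and sub: "basis_of i \<subseteq> Bs i" using basis_of by auto
  have "e \<notin> A.span (basis_of i - {e})"
    using ind e by (auto simp: A.dependent_def)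
  then obtain T where T: "T \<in> sandwich (Bs i)" "\<forall>s\<in>basis_of i - {e}. T s = 0" "T e = y"
    using sandwich_interpolate[OF Bs_subalgebra[OF i] Bs_invariant[OF i] Bs_simple[OF i], of "basis_of i - {e}" e y]
      finite_basis_of sub e y by blast
  have "T e' = 0" if "e' \<in> basis_union {1..q} - {e}" for e'
  proof -
    from that obtain j where j: "j \<in> {1..q}" "e' \<in> basis_of j" "e' \<noteq> e" by (auto simp: basis_union_def)
    then show ?thesis
      using T(2) sandwich_Bs_orth[OF T(1) i j(1)] basis_of[of j] by (cases "i = j") auto
  qed
  then show "y \<in> interpolated e"
    unfolding interpolated_def using T sandwich_mono[OF T(1)] by (auto intro!: exI[of _ T])
qed

definition interpolated_products :: "'a list \<Rightarrow> 'a set" where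
  "interpolated_products es =
     A.span {list_product cs | cs. list_all2 (\<lambda>e c. c \<in> interpolated e) es cs}"

lemma list_product_mult_right:
  assumes "list_all2 (\<lambda>e c. c \<in> interpolated e) es cs" "es \<noteq> []"
  shows "\<exists>cs'. list_all2 (\<lambda>e c. c \<in> interpolated e) es cs' \<and> list_product cs' = list_product cs * a"
  using assms
proof (induction es cs rule: list_all2_induct)
  case (Cons e es c cs)
  show ?case
  proof (cases "es = []")
    case True
    then have "cs = []" using Cons by simp
    then show ?thesis
      using True Cons interpolated_mult_right by (intro exI[of _ "[c * a]"]) auto
  next
    case False
    then obtain cs' where cs': "list_all2 (\<lambda>e c. c \<in> interpolated e) es cs'"
      "list_product cs' = list_product cs * a" using Cons by blast
    obtain x xs y ys where "cs = x # xs" "cs' = y # ys"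
      using False Cons cs' by (metis list_all2_Cons1 neq_Nil_conv)
    then show ?thesis
      using Cons cs' by (intro exI[of _ "c # cs'"]) (auto simp: mult.assoc)
  qed
qed simp

lemma interpolated_products_mult_right:
  assumes "x \<in> interpolated_products es" "es \<noteq> []"
  shows "x * a \<in> interpolated_products es"
proof -
  have "interpolated_products es \<subseteq> {x. x * a \<in> interpolated_products es}"
    unfolding interpolated_products_def
  proof (rule A.span_minimal)
    let ?G = "{list_product cs | cs. list_all2 (\<lambda>e c. c \<in> interpolated e) es cs}"
    show "?G \<subseteq> {x. x * a \<in> A.span ?G}"
    proof clarify
      fix cs assume "list_all2 (\<lambda>e c. c \<in> interpolated e) es cs"
      then obtain cs' where cs': "list_all2 (\<lambda>e c. c \<in> interpolated e) es cs'"
        "list_product cs' = list_product cs * a"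
        using list_product_mult_right[OF _ assms(2)] by blast
      show "list_product cs * a \<in> A.span ?G"
        unfolding cs'(2)[symmetric] using cs'(1) by (intro A.span_base) blast
    qed
    show "A.subspace {x. x * a \<in> A.span ?G}"
      by (rule A.subspaceI)
        (auto simp: A.span_zero distrib_right A.scale_mult_left[symmetric] intro: A.span_add A.span_scale)
  qed
  then show ?thesis using assms(1) by blast
qed

lemma span_mult_closed:
  assumes "x \<in> A.span X" "y \<in> A.span Y" and XY: "\<And>x y. x \<in> X \<Longrightarrow> y \<in> Y \<Longrightarrow> x * y \<in> A.span Z"
  shows "x * y \<in> A.span Z"
proof -
  have 1: "x * y \<in> A.span Z" if "x \<in> X" "y \<in> A.span Y" for x y
  proof -
    have "A.span Y \<subseteq> {y. x * y \<in> A.span Z}"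
      using XY[OF that(1)]
      by (intro A.span_minimal A.subspaceI)
        (auto simp: A.span_zero distrib_left A.scale_mult_right[symmetric] intro: A.span_add A.span_scale)
    then show ?thesis using that by blast
  qed
  have "A.span X \<subseteq> {x. x * y \<in> A.span Z}"
    using 1 assms(2)
    by (intro A.span_minimal A.subspaceI)
      (auto simp: A.span_zero distrib_right A.scale_mult_left[symmetric] intro: A.span_add A.span_scale)
  then show ?thesis using assms(1) by blast
qed

lemma interpolated_products_append:
  assumes "x \<in> interpolated_products es" "y \<in> interpolated_products es'" "es \<noteq> []" "es' \<noteq> []"
  shows "x * y \<in> interpolated_products (es @ es')"
  using assms(1,2) unfolding interpolated_products_def
proof (rule span_mult_closed)
  fix x y
  assume "x \<in> {list_product cs | cs. list_all2 (\<lambda>e c. c \<in> interpolated e) es cs}"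
    "y \<in> {list_product cs | cs. list_all2 (\<lambda>e c. c \<in> interpolated e) es' cs}"
  then obtain cs cs' where cs: "x = list_product cs" "list_all2 (\<lambda>e c. c \<in> interpolated e) es cs"
    "y = list_product cs'" "list_all2 (\<lambda>e c. c \<in> interpolated e) es' cs'"
    by blast
  have "cs \<noteq> []" "cs' \<noteq> []" using cs assms(3,4) by auto
  then have "x * y = list_product (cs @ cs')" by (simp add: cs list_product_append)
  moreover have "list_all2 (\<lambda>e c. c \<in> interpolated e) (es @ es') (cs @ cs')"
    using cs by (simp add: list_all2_appendI)
  ultimately show "x * y \<in> A.span {list_product cs | cs. list_all2 (\<lambda>e c. c \<in> interpolated e) (es @ es') cs}"
    by (intro A.span_base) blast
qed

text \<open>
  Every element of \<open>B\<^sub>i\<close> is a sum of products of any prescribed number of elements of \<open>B\<^sub>i\<close>,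
  by \<open>H_simple_square\<close>, and each factor can be interpolated at a basis element of its own.
\<close>

lemma Bs_interpolated_products:
  assumes i: "i \<in> {1..q}" and es: "set es \<subseteq> basis_of i" "es \<noteq> []"
  shows "Bs i \<subseteq> interpolated_products es"
  using es
proof (induction es)
  case (Cons e es)
  show ?case
  proof (cases "es = []")
    case True
    have "x \<in> interpolated_products [e]" if "x \<in> interpolated e" for x
      unfolding interpolated_products_def using that
      by (intro A.span_base CollectI exI[of _ "[x]"]) auto
    then show ?thesis
      using True Bs_interpolated[OF i, of e] Cons by auto
  next
    case False
    have "x \<in> interpolated_products (e # es)" if "x \<in> {a * b | a b. a \<in> Bs i \<and> b \<in> Bs i}" for x
    proof -
      from that obtain a b where ab: "x = a * b" "a \<in> Bs i" "b \<in> Bs i" by blast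
      have "a \<in> interpolated e" using ab Bs_interpolated[OF i, of e] Cons by auto
      then have "a \<in> interpolated_products [e]"
        unfolding interpolated_products_def by (intro A.span_base CollectI exI[of _ "[a]"]) auto
      moreover have "b \<in> interpolated_products es" using Cons ab False by auto
      ultimately have "a * b \<in> interpolated_products ([e] @ es)"
        using False by (intro interpolated_products_append) auto
      then show ?thesis by (simp add: ab)
    qed
    moreover have "A.subspace (interpolated_products (e # es))"
      by (simp add: interpolated_products_def)
    ultimately have "A.span {a * b | a b. a \<in> Bs i \<and> b \<in> Bs i} \<subseteq> interpolated_products (e # es)"
      by (intro A.span_minimal) auto
    then show ?thesis
      using H_simple_square[OF Bs_subalgebra[OF i] Bs_invariant[OF i] Bs_simple[OF i]] by blast
  qed
qed simp

definition basis_list :: "nat \<Rightarrow> 'a list" where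
  "basis_list i = (SOME l. set l = basis_of i \<and> distinct l)"

lemma basis_list: "set (basis_list i) = basis_of i" "distinct (basis_list i)"
  unfolding basis_list_def using someI_ex[OF finite_distinct_list[OF finite_basis_of]] by auto

lemma basis_list_nonempty: "i \<in> {1..q} \<Longrightarrow> basis_list i \<noteq> []"
proof
  assume i: "i \<in> {1..q}" and "basis_list i = []"
  then have "basis_of i = {}" using basis_list(1)[of i] by simp
  then have "Bs i = {0}" using span_basis_of[OF i] by simp
  then show False using Bs_simple[OF i] by (auto simp: H_simple_def)
qed

text \<open>
  The factors from \<open>J\<close> are absorbed into the interpolated value on their left.
\<close>

lemma radical_chain_interpolated:
  assumes "is \<noteq> []" "set is \<subseteq> {1..q}"
  shows "radical_chain scaleA J Bs is \<subseteq> interpolated_products (concat (map basis_list is))"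
  using assms
proof (induction "is" rule: list_nonempty_induct)
  case (single i)
  then show ?case
    using Bs_interpolated_products[of i "basis_list i"] basis_list basis_list_nonempty by simp
next
  case (cons i "is")
  then have i: "i \<in> {1..q}" and ne: "concat (map basis_list is) \<noteq> []"
    using basis_list_nonempty by (auto simp: neq_Nil_conv)
  obtain k ks where "is": "is = k # ks" using cons by (cases "is") auto
  have chain: "radical_chain scaleA J Bs (i # is) =
    subspace_product scaleA (subspace_product scaleA (Bs i) J) (radical_chain scaleA J Bs is)"
    by (simp add: "is")
  have sp: "A.subspace (interpolated_products es)" for es
    by (simp add: interpolated_products_def)
  have "subspace_product scaleA (Bs i) J \<subseteq> interpolated_products (basis_list i)"
    unfolding subspace_product_def
  proof (rule A.span_minimal[OF _ sp], clarify)
    fix u v assume u: "u \<in> Bs i"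
    then have "u \<in> interpolated_products (basis_list i)"
      using Bs_interpolated_products[OF i, of "basis_list i"] basis_list basis_list_nonempty[OF i] by auto
    then show "u * v \<in> interpolated_products (basis_list i)"
      using basis_list_nonempty[OF i] by (rule interpolated_products_mult_right)
  qed
  then show ?case
    unfolding chain subspace_product_def[of _ "subspace_product scaleA (Bs i) J"]
    using cons interpolated_products_append[OF _ _ basis_list_nonempty[OF i] ne]
    by (intro A.span_minimal[OF _ sp]) auto
qed

text \<open>
  The operators whose product, applied to the right basis elements, is a nonzero value along
  the chain. They separate the basis elements, so permuting the arguments makes the product
  vanish.
\<close>

lemma interpolation_operators:
  assumes "is \<noteq> []" "set is \<subseteq> {1..q}" "radical_chain scaleA J Bs is \<noteq> {0}"
  defines "es \<equiv> concat (map basis_list is)"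
  obtains T where "\<And>k. k < length es \<Longrightarrow> T k \<in> sandwich UNIV"
    "\<And>k e. k < length es \<Longrightarrow> e \<in> set es \<Longrightarrow> e \<noteq> es ! k \<Longrightarrow> T k e = 0"
    "list_product (map (\<lambda>k. T k (es ! k)) [0..<length es]) \<noteq> 0"
proof -
  have "\<exists>cs. list_all2 (\<lambda>e c. c \<in> interpolated e) es cs \<and> list_product cs \<noteq> 0"
  proof (rule ccontr)
    assume n: "\<not> ?thesis"
    then have "interpolated_products es \<subseteq> {0}"
      unfolding interpolated_products_def by (intro A.span_minimal) auto
    then have sub: "radical_chain scaleA J Bs is \<subseteq> {0}"
      using radical_chain_interpolated[OF assms(1,2)] by (simp add: es_def)
    moreover have "0 \<in> radical_chain scaleA J Bs is"
    proof -
      obtain i ks where "is": "is = i # ks" using assms(1) by (cases "is") auto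
      then show ?thesis
        using assms(2) A.subspace_0[OF Bs_subspace[of i]]
        by (cases ks) (auto simp: subspace_product_def A.span_zero)
    qed
    ultimately show False using assms(3) by blast
  qed
  then obtain cs where cs: "list_all2 (\<lambda>e c. c \<in> interpolated e) es cs" "list_product cs \<noteq> 0"
    by blast
  have len: "length cs = length es" using cs(1) by (simp add: list_all2_lengthD)
  have "\<forall>k<length es. \<exists>T. T \<in> sandwich UNIV \<and> (\<forall>e'\<in>basis_union {1..q} - {es ! k}. T e' = 0) \<and> T (es ! k) = cs ! k"
  proof (intro allI impI)
    fix k assume "k < length es"
    then have "cs ! k \<in> interpolated (es ! k)" using cs(1) by (simp add: list_all2_conv_all_nth)
    then show "\<exists>T. T \<in> sandwich UNIV \<and> (\<forall>e'\<in>basis_union {1..q} - {es ! k}. T e' = 0) \<and> T (es ! k) = cs ! k"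
      by (auto simp: interpolated_def)
  qed
  then obtain T where T: "\<And>k. k < length es \<Longrightarrow> T k \<in> sandwich UNIV"
    "\<And>k e. k < length es \<Longrightarrow> e \<in> basis_union {1..q} - {es ! k} \<Longrightarrow> T k e = 0"
    "\<And>k. k < length es \<Longrightarrow> T k (es ! k) = cs ! k"
    by metis
  have "set es \<subseteq> basis_union {1..q}"
    using assms(2) basis_list by (auto simp: es_def basis_union_def)
  moreover have "map (\<lambda>k. T k (es ! k)) [0..<length es] = cs"
    using len T(3) by (intro nth_equalityI) auto
  ultimately show thesis using that[of T] T cs(2) by auto
qed


lemma B_combination:
  assumes "\<And>i. i \<in> {1..q} \<Longrightarrow> f i \<in> Bs i"
  shows "(\<Sum>i\<in>{1..q}. f i) \<in> B"
  using assms Bs_B B_subalgebra unfolding subalgebra_def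
  by (intro A.subspace_sum) auto

end

section \<open>Nonzero products of elements of the components\<close>

context wedderburn_action begin

abbreviation J_chain :: "nat \<Rightarrow> 'a set" where
  "J_chain \<equiv> A.annihilator_chain J"

lemma J_chain_UNIV: "J_chain (Suc A.dimension) = UNIV"
  using J_ideal A.jacobson_nil unfolding J_eq by (intro A.annihilator_chain_exhausts)

lemma J_chain_left: "y \<in> J_chain k \<Longrightarrow> a * y \<in> J_chain k"
  using A.annihilator_chain_left_ideal[OF J_ideal, of k] by (auto simp: left_ideal_def)

lemma J_chain_step: "x \<in> J \<Longrightarrow> y \<in> J_chain k \<Longrightarrow> x * y \<in> J_chain (k - 1)"
  by (cases k) auto

text \<open>
  Colour \<open>0\<close> stands for the radical, colour \<open>i\<close> for \<open>B\<^sub>i\<close>.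
\<close>

definition has_colour :: "nat \<Rightarrow> 'a \<Rightarrow> bool" where
  "has_colour c x \<longleftrightarrow> (if c = 0 then x \<in> J else c \<in> {1..q} \<and> x \<in> Bs c)"

text \<open>
  Reading the product from the right, each factor from \<open>J\<close> descends one step in the chain and
  the other factors do not leave a member of it. The rightmost factor is only known to lie in
  the top member, whatever its colour, which accounts for the \<open>- 1\<close>.
\<close>

lemma coloured_product_J_chain:
  assumes "list_all2 has_colour cs xs" "xs \<noteq> []"
  shows "list_product xs \<in> J_chain (Suc A.dimension - (count_list cs 0 - 1))"
  using assms
proof (induction cs xs rule: list_all2_induct)
  case (Cons c cs x xs)
  show ?case
  proof (cases "xs = []")
    case True
    then have "cs = []" using Cons by simp
    then show ?thesis using J_chain_UNIV by simp
  next
    case False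
    then have y: "list_product xs \<in> J_chain (Suc A.dimension - (count_list cs 0 - 1))"
      using Cons by simp
    have eq: "list_product (x # xs) = x * list_product xs" using False by (cases xs) auto
    show ?thesis
    proof (cases "c = 0 \<and> count_list cs 0 > 0")
      case True
      then have "x \<in> J" using Cons by (simp add: has_colour_def)
      then have "x * list_product xs \<in> J_chain (Suc A.dimension - (count_list cs 0 - 1) - 1)"
        using y by (rule J_chain_step)
      moreover have "Suc A.dimension - (count_list cs 0 - 1) - 1 = Suc A.dimension - (count_list (c # cs) 0 - 1)"
        using True by auto
      ultimately show ?thesis by (simp only: eq)
    next
      case F: False
      have "count_list (c # cs) 0 - 1 = count_list cs 0 - 1" using F by auto
      then show ?thesis using J_chain_left[OF y, of x] by (simp only: eq)
    qed
  qed
qed simp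

lemma coloured_product_few_J:
  assumes "list_all2 has_colour cs xs" "xs \<noteq> []" "list_product xs \<noteq> 0"
  shows "count_list cs 0 \<le> Suc A.dimension"
proof (rule ccontr)
  assume "\<not> ?thesis"
  then have "Suc A.dimension - (count_list cs 0 - 1) = 0" by simp
  then show False using coloured_product_J_chain[OF assms(1,2)] assms(3) by simp
qed

lemma J_not_UNIV: "J \<noteq> UNIV"
proof
  assume J: "J = UNIV"
  then have all_J: "x \<in> J" for x by blast
  have "list_product xs = 0" if "length xs = Suc (Suc A.dimension)" for xs :: "'a list"
  proof -
    have "list_all2 has_colour (replicate (length xs) 0) xs"
      by (simp add: list_all2_conv_all_nth has_colour_def all_J)
    moreover have "count_list (replicate (length xs) (0::nat)) 0 = length xs"
      by (induction xs) auto
    moreover have "xs \<noteq> []" using that by auto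
    ultimately show ?thesis using coloured_product_few_J that by fastforce
  qed
  then have "nilpotent_algebra (UNIV :: 'a set)"
    unfolding nilpotent_algebra_def by (intro exI[of _ "Suc (Suc A.dimension)"]) auto
  then show False using not_nilpotent by simp
qed

lemma q_pos: "q \<ge> 1"
proof (rule ccontr)
  assume "\<not> q \<ge> 1"
  then have q0: "q = 0" by simp
  have "a \<in> J" for a
  proof -
    obtain f j where "j \<in> J" "a = (\<Sum>i\<in>{1..q}. f i) + j" using decompose[of a] by metis
    then show ?thesis using q0 by simp
  qed
  then show False using J_not_UNIV by blast
qed

definition generated_ideal :: "'a set \<Rightarrow> 'a set" where
  "generated_ideal C = \<Inter>{I. two_sided_ideal scaleA UNIV I \<and> C \<subseteq> I}"

lemma generated_ideal_superset: "C \<subseteq> generated_ideal C"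
  by (auto simp: generated_ideal_def)

lemma generated_ideal_ideal: "two_sided_ideal scaleA UNIV (generated_ideal C)"
  unfolding generated_ideal_def two_sided_ideal_def
  by (auto intro!: A.subspace_Inter)

lemma generated_ideal_least: "two_sided_ideal scaleA UNIV I \<Longrightarrow> C \<subseteq> I \<Longrightarrow> generated_ideal C \<subseteq> I"
  by (auto simp: generated_ideal_def)

lemma generated_ideal_mult:
  "y \<in> generated_ideal C \<Longrightarrow> a * y \<in> generated_ideal C"
  "y \<in> generated_ideal C \<Longrightarrow> y * a \<in> generated_ideal C"
  using generated_ideal_ideal[of C] by (auto simp: two_sided_ideal_def)

lemma radical_chain_orth:
  assumes "is \<noteq> []" "set is \<subseteq> {1..q}" "i \<in> {1..q}" "i \<noteq> hd is" "x \<in> Bs i"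
    and c: "c \<in> radical_chain scaleA J Bs is"
  shows "x * c = 0"
proof -
  obtain k ks where "is": "is = k # ks" using assms(1) by (cases "is") auto
  have k: "k \<in> {1..q}" "i \<noteq> k" using assms "is" by auto
  have ann: "A.subspace {c. x * c = 0}"
    by (rule A.subspaceI) (auto simp: distrib_left A.scale_mult_right[symmetric])
  show ?thesis
  proof (cases ks)
    case Nil
    then show ?thesis using c Bs_orth[OF assms(3) k(1,2) assms(5)] "is" by simp
  next
    case (Cons l ls)
    have 1: "subspace_product scaleA (Bs k) J \<subseteq> {c. x * c = 0}"
      unfolding subspace_product_def
      using Bs_orth[OF assms(3) k(1,2) assms(5)]
      by (intro A.span_minimal[OF _ ann]) (auto simp: mult.assoc[symmetric])
    have "radical_chain scaleA J Bs is \<subseteq> {c. x * c = 0}"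
      unfolding "is" Cons radical_chain.simps subspace_product_def[of _ "subspace_product scaleA (Bs k) J"]
      using 1 by (intro A.span_minimal[OF _ ann]) (auto simp: mult.assoc[symmetric])
    then show ?thesis using c by blast
  qed
qed

text \<open>
  Write an arbitrary factor between \<open>x\<close> and a chain product \<open>c\<close> as a sum of elements of the
  \<open>B\<^sub>k\<close> and of \<open>J\<close>. Only its component in \<open>B\<^sub>i\<close> is not killed by \<open>x\<close> from the left, and the
  product lies in \<open>B\<^sub>i\<close>, so it kills \<open>c\<close>; what remains is an element of \<open>B\<^sub>i J\<close> times \<open>c\<close>. The
  ideal generated by the chain takes care of the factors on the outside.
\<close>

lemma extend_radical_chain:
  assumes "is": "is \<noteq> []" "set is \<subseteq> {1..q}" and i: "i \<in> {1..q}" "i \<notin> set is"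
    and x: "x \<in> Bs i" and y: "y \<in> generated_ideal (radical_chain scaleA J Bs is)"
  shows "x * y \<in> generated_ideal (radical_chain scaleA J Bs (i # is))"
proof -
  let ?K = "generated_ideal (radical_chain scaleA J Bs (i # is))"
  have K: "A.subspace ?K" "\<And>u a. u \<in> ?K \<Longrightarrow> u * a \<in> ?K"
    using generated_ideal_ideal[of "radical_chain scaleA J Bs (i # is)"]
    by (auto simp: two_sided_ideal_def)
  define S where "S = {y. \<forall>x\<in>Bs i. x * y \<in> ?K \<and> (\<forall>a. x * (a * y) \<in> ?K)}"
  have "A.subspace S"
    unfolding S_def
    by (rule A.subspaceI)
      (auto simp: A.subspace_0[OF K(1)] A.subspace_add[OF K(1)] A.subspace_scale[OF K(1)]
        distrib_left A.scale_mult_right[symmetric])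
  moreover have "a * y \<in> S" if "y \<in> S" for a y
    using that by (auto simp: S_def) (metis mult.assoc)
  moreover have "y * a \<in> S" if "y \<in> S" for a y
    using that K(2) by (auto simp: S_def mult.assoc[symmetric])
  ultimately have S: "two_sided_ideal scaleA UNIV S"
    by (simp add: two_sided_ideal_def)
  have "radical_chain scaleA J Bs is \<subseteq> S"
  proof
    fix c assume c: "c \<in> radical_chain scaleA J Bs is"
    have ne: "i \<noteq> hd is" using "is"(1) i(2) by auto
    have zero: "x * c = 0" if "x \<in> Bs i" for x
      using radical_chain_orth[OF "is" i(1) ne that c] .
    have "x * (a * c) \<in> ?K" if x: "x \<in> Bs i" for x a
    proof -
      obtain f j where f: "\<And>k. k \<in> {1..q} \<Longrightarrow> f k \<in> Bs k" and j: "j \<in> J"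
        and a: "a = (\<Sum>k\<in>{1..q}. f k) + j" using decompose[of a] by metis
      have "x * (\<Sum>k\<in>{1..q}. f k) \<in> Bs i" using Bs_right[OF i(1) B_combination x] f by simp
      then have "x * (a * c) = (x * j) * c"
        using zero by (simp add: a distrib_left distrib_right mult.assoc[symmetric])
      moreover have "(x * j) * c \<in> radical_chain scaleA J Bs (i # is)"
      proof -
        obtain k ks where k: "is = k # ks" using "is"(1) by (cases "is") auto
        have "x * j \<in> subspace_product scaleA (Bs i) J"
          unfolding subspace_product_def using x j by (intro A.span_base) blast
        then show ?thesis
          unfolding k radical_chain.simps subspace_product_def[of _ "subspace_product scaleA (Bs i) J"]
          using c by (intro A.span_base) (auto simp: k)
      qed
      ultimately show ?thesis using generated_ideal_superset by auto
    qed
    then show "c \<in> S"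
      using zero A.subspace_0[OF K(1)] by (simp add: S_def)
  qed
  then have "y \<in> S" using generated_ideal_least[OF S] y by blast
  then show ?thesis using x by (simp add: S_def)
qed

text \<open>
  Reading the product from the right, the chain is extended whenever a new colour appears;
  repeated colours and radical factors are absorbed by the ideal.
\<close>

lemma coloured_product_radical_chain:
  assumes "list_all2 has_colour cs xs" "set cs - {0} \<noteq> {}"
  shows "\<exists>is. distinct is \<and> set is = set cs - {0} \<and>
    list_product xs \<in> generated_ideal (radical_chain scaleA J Bs is)"
  using assms
proof (induction cs xs rule: list_all2_induct)
  case (Cons c cs x xs)
  have Bs_chain: "x \<in> generated_ideal (radical_chain scaleA J Bs [c])" if "c \<noteq> 0"
    using Cons(1) that generated_ideal_superset[of "Bs c"] by (auto simp: has_colour_def)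
  have colours: "set cs - {0} \<subseteq> {1..q}"
    using Cons(2) by (auto simp: list_all2_conv_all_nth has_colour_def in_set_conv_nth split: if_splits)
  show ?case
  proof (cases "xs = []")
    case True
    then have "cs = []" using Cons by simp
    then show ?thesis using True Cons Bs_chain by (intro exI[of _ "[c]"]) auto
  next
    case ne: False
    have eq: "list_product (x # xs) = x * list_product xs" using ne by (cases xs) auto
    show ?thesis
    proof (cases "set cs - {0} = {}")
      case True
      then have "c \<noteq> 0" "set (c # cs) - {0} = {c}" using Cons by auto
      then show ?thesis
        using generated_ideal_mult(2)[OF Bs_chain] unfolding eq by (intro exI[of _ "[c]"]) auto
    next
      case False
      then obtain "is" where "is": "distinct is" "set is = set cs - {0}"
        "list_product xs \<in> generated_ideal (radical_chain scaleA J Bs is)"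
        using Cons by blast
      show ?thesis
      proof (cases "c = 0 \<or> c \<in> set is")
        case True
        then have "set (c # cs) - {0} = set is" using "is"(2) by auto
        then show ?thesis
          unfolding eq using "is" generated_ideal_mult(1) by (intro exI[of _ "is"]) simp
      next
        case new: False
        have "c \<in> {1..q}" "x \<in> Bs c" using new Cons(1) by (auto simp: has_colour_def)
        moreover have "is \<noteq> []" using "is"(2) False by (metis list.set(1))
        ultimately have "x * list_product xs \<in> generated_ideal (radical_chain scaleA J Bs (c # is))"
          using extend_radical_chain[of "is" c x] "is" colours new by simp
        then show ?thesis
          unfolding eq using "is" new by (intro exI[of _ "c # is"]) auto
      qed
    qed
  qed
qed simp

definition d :: nat where "d = exponent_d scaleA J Bs q"

definition admissible :: "nat list \<Rightarrow> bool" where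
  "admissible is \<longleftrightarrow> distinct is \<and> set is \<subseteq> {1..q} \<and>
     (is = [] \<or> radical_chain scaleA J Bs is \<noteq> {0})"

lemma d_eq: "d = Max {card (basis_union (set is)) | is. admissible is}"
proof -
  have "length is \<le> q" if "distinct is" "set is \<subseteq> {1..q}" for "is"
    using that card_mono[of "{1..q}" "set is"] distinct_card[of "is"] by simp
  then have "{A.dim (A.span (\<Union>i\<in>set is. Bs i)) | is. distinct is \<and> set is \<subseteq> {1..q} \<and> length is \<le> q \<and>
       (is = [] \<or> radical_chain scaleA J Bs is \<noteq> {0})} = {card (basis_union (set is)) | is. admissible is}"
    unfolding admissible_def using dim_Bs by (intro Collect_cong) metis
  then show ?thesis unfolding d_def exponent_d_def by simp
qed

lemma finite_admissible: "finite {card (basis_union (set is)) | is. admissible is}"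
proof -
  have "{card (basis_union (set is)) | is. admissible is} \<subseteq> (\<lambda>is. card (basis_union (set is))) ` {xs. set xs \<subseteq> {1..q} \<and> length xs \<le> q}"
  proof clarify
    fix "is" assume a: "admissible is"
    then have "length is \<le> q"
      using card_mono[of "{1..q}" "set is"] distinct_card[of "is"] by (simp add: admissible_def)
    then show "card (basis_union (set is)) \<in> (\<lambda>is. card (basis_union (set is))) ` {xs. set xs \<subseteq> {1..q} \<and> length xs \<le> q}"
      using a by (auto simp: admissible_def)
  qed
  moreover have "finite {xs. set xs \<subseteq> {1..q} \<and> length xs \<le> q}"
    by (rule finite_lists_length_le) simp
  ultimately show ?thesis using finite_subset by blast
qed

lemma card_basis_union_le_d: "admissible is \<Longrightarrow> card (basis_union (set is)) \<le> d"
  unfolding d_eq by (rule Max_ge[OF finite_admissible]) blast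

lemma d_pos: "d \<ge> 1"
proof -
  have q1: "1 \<in> {1..q}" using q_pos by simp
  have "Bs 1 \<noteq> {0}" using Bs_simple[OF q1] by (auto simp: H_simple_def)
  then have "admissible [1]" using q1 by (simp add: admissible_def)
  then have "card (basis_of 1) \<le> d" using card_basis_union_le_d[of "[1]"] by (simp add: basis_union_def)
  moreover have "basis_of 1 \<noteq> {}"
    using span_basis_of[OF q1] \<open>Bs 1 \<noteq> {0}\<close> by auto
  then have "card (basis_of 1) \<noteq> 0" using finite_basis_of[of 1] by simp
  ultimately show ?thesis by simp
qed

lemma d_attained:
  obtains "is" where "is \<noteq> []" "distinct is" "set is \<subseteq> {1..q}" "radical_chain scaleA J Bs is \<noteq> {0}"
    "card (basis_union (set is)) = d"
proof -
  have "admissible []" by (simp add: admissible_def)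
  then have "d \<in> {card (basis_union (set is)) | is. admissible is}"
    unfolding d_eq using finite_admissible by (intro Max_in) blast+
  then obtain "is" where "is": "admissible is" "card (basis_union (set is)) = d" by auto
  moreover have "is \<noteq> []" using "is"(2) d_pos by (auto simp: basis_union_def)
  ultimately show thesis using that by (auto simp: admissible_def)
qed

lemma coloured_product_dim:
  assumes "list_all2 has_colour cs xs" "list_product xs \<noteq> 0"
  shows "card (basis_union (set cs - {0})) \<le> d"
proof (cases "set cs - {0} = {}")
  case True
  show ?thesis unfolding True by (simp add: basis_union_def)
next
  case False
  then obtain "is" where "is": "distinct is" "set is = set cs - {0}"
    "list_product xs \<in> generated_ideal (radical_chain scaleA J Bs is)"
    using coloured_product_radical_chain[OF assms(1)] by blast
  have "radical_chain scaleA J Bs is \<noteq> {0}"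
  proof
    assume "radical_chain scaleA J Bs is = {0}"
    moreover have "generated_ideal {0} \<subseteq> {0}"
      by (rule generated_ideal_least) (auto simp: two_sided_ideal_def)
    ultimately show False using "is"(3) assms(2) by auto
  qed
  moreover have "set is \<subseteq> {1..q}"
    using "is"(2) assms(1) by (auto simp: list_all2_conv_all_nth has_colour_def in_set_conv_nth split: if_splits)
  ultimately have "admissible is" using "is"(1) by (simp add: admissible_def)
  then show ?thesis using card_basis_union_le_d "is"(2) by metis
qed

end

section \<open>Codimensions as dimensions of spaces of multilinear functions\<close>

lemma list_product_zero: "0 \<in> set xs \<Longrightarrow> list_product xs = 0"
  by (induction xs rule: list_product.induct) auto

lemma list_product_Cons: "xs \<noteq> [] \<Longrightarrow> list_product (x # xs) = x * list_product xs"
  by (cases xs) auto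

lemma (in assoc_algebra) list_product_update:
  assumes "distinct ks" "j \<in> set ks"
  shows "list_product (map (g(j := a + b)) ks) =
      list_product (map (g(j := a)) ks) + list_product (map (g(j := b)) ks)"
    and "list_product (map (g(j := scale c a)) ks) = scale c (list_product (map (g(j := a)) ks))"
proof -
  have "list_product (map (g(j := a + b)) ks) =
      list_product (map (g(j := a)) ks) + list_product (map (g(j := b)) ks) \<and>
    list_product (map (g(j := scale c a)) ks) = scale c (list_product (map (g(j := a)) ks))"
    using assms
  proof (induction ks)
    case (Cons k ks)
    show ?case
    proof (cases "ks = []")
      case True
      then show ?thesis using Cons by simp
    next
      case ne: False
      have prod: "list_product (map f (k # ks)) = f k * list_product (map f ks)" for f :: "_ \<Rightarrow> 'a"
        using ne list_product_Cons[of "map f ks" "f k"] by simp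
      show ?thesis
      proof (cases "j = k")
        case True
        then have m: "map (g(j := z)) ks = map g ks" for z using Cons.prems(1) by auto
        show ?thesis unfolding prod m using True by (simp add: distrib_right scale_mult_left)
      next
        case False
        have "list_product (map (g(j := a + b)) ks) =
            list_product (map (g(j := a)) ks) + list_product (map (g(j := b)) ks) \<and>
          list_product (map (g(j := scale c a)) ks) = scale c (list_product (map (g(j := a)) ks))"
          by (rule Cons.IH) (use Cons.prems False in auto)
        then show ?thesis unfolding prod using False by (simp add: distrib_left scale_mult_right)
      qed
    qed
  qed simp
  then show "list_product (map (g(j := a + b)) ks) =
      list_product (map (g(j := a)) ks) + list_product (map (g(j := b)) ks)"
    and "list_product (map (g(j := scale c a)) ks) = scale c (list_product (map (g(j := a)) ks))"
    by blast+
qed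

text \<open>
  The map \<open>L\<close> identifies the quotient with the image: it maps a basis modulo the kernel
  bijectively to a basis of the image, and bases of the image lift. Infinite dimensions are
  covered, because both dimensions are then \<open>0\<close> by convention.
\<close>

lemma (in vector_space_pair) quotient_dim_eq_dim_image:
  assumes lin: "Vector_Spaces.linear s1 s2 L" and U: "vs1.subspace U"
  shows "quotient_dim s1 U {u \<in> U. L u = 0} = vs2.dim (L ` U)"
proof -
  let ?V = "{u \<in> U. L u = 0}"
  have L_sum: "L (\<Sum>v\<in>T. s1 (c v) v) = (\<Sum>v\<in>T. s2 (c v) (L v))" for T c
    by (simp add: linear_sum[OF lin] linear_scale[OF lin])
  have sum_U: "(\<Sum>v\<in>T. s1 (c v) v) \<in> U" if "T \<subseteq> U" for T c
    using that U by (intro vs1.subspace_sum) (auto intro: vs1.subspace_scale)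
  have card: "card S = vs2.dim (L ` U)" if qb: "quotient_basis s1 U ?V S" for S
  proof -
    have SU: "S \<subseteq> U"
      and ind: "\<And>T c v. finite T \<Longrightarrow> T \<subseteq> S \<Longrightarrow> (\<Sum>v\<in>T. s1 (c v) v) \<in> ?V \<Longrightarrow> v \<in> T \<Longrightarrow> c v = 0"
      and spn: "\<And>u. u \<in> U \<Longrightarrow> \<exists>s\<in>vs1.span S. u - s \<in> ?V"
      using qb unfolding quotient_basis_def by auto
    have inj: "inj_on L S"
    proof (rule inj_onI, rule ccontr)
      fix x y assume xy: "x \<in> S" "y \<in> S" "L x = L y" "x \<noteq> y"
      let ?c = "\<lambda>v. if v = x then 1 else - 1 :: 'a"
      have "(\<Sum>v\<in>{x, y}. s1 (?c v) v) \<in> ?V"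
        using sum_U[of "{x, y}" ?c] SU xy L_sum[of ?c "{x, y}"] by auto
      then have "?c x = 0" using xy by (intro ind[of "{x, y}" ?c]) auto
      then show False by simp
    qed
    have "vs2.independent (L ` S)"
      unfolding vs2.independent_explicit_module
    proof (intro allI impI)
      fix T c v assume T: "finite T" "T \<subseteq> L ` S" "(\<Sum>v\<in>T. s2 (c v) v) = 0" "v \<in> T"
      obtain T' where T': "T' \<subseteq> S" "T = L ` T'" using T(2) subset_imageE by metis
      have injT: "inj_on L T'" using inj T'(1) inj_on_subset by blast
      then have fin: "finite T'" using T(1) T'(2) finite_image_iff by blast
      have "L (\<Sum>v\<in>T'. s1 (c (L v)) v) = (\<Sum>v\<in>T. s2 (c v) v)"
        unfolding T'(2) sum.reindex[OF injT] L_sum by simp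
      then have "(\<Sum>v\<in>T'. s1 (c (L v)) v) \<in> ?V"
        using T(3) sum_U[of T' "\<lambda>v. c (L v)"] T'(1) SU by auto
      moreover obtain v' where "v' \<in> T'" "v = L v'" using T(4) T'(2) by blast
      ultimately show "c v = 0" using ind[OF fin T'(1), of "\<lambda>v. c (L v)" v'] by simp
    qed
    moreover have "L ` U \<subseteq> vs2.span (L ` S)"
    proof clarify
      fix u assume "u \<in> U"
      then obtain s where "s \<in> vs1.span S" "u - s \<in> ?V" using spn by blast
      then have "L u = L s" by (simp add: linear_diff[OF lin])
      then show "L u \<in> vs2.span (L ` S)"
        using \<open>s \<in> vs1.span S\<close> by (simp add: linear_span_image[OF lin])
    qed
    moreover have "L ` S \<subseteq> L ` U" using SU by blast
    ultimately have "card (L ` S) = vs2.dim (L ` U)" by (intro vs2.basis_card_eq_dim)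
    then show ?thesis using card_image[OF inj] by simp
  qed
  have "\<exists>S. quotient_basis s1 U ?V S"
  proof -
    obtain C where C: "C \<subseteq> L ` U" "vs2.independent C" "L ` U \<subseteq> vs2.span C"
      using vs2.maximal_independent_subset[of "L ` U"] by metis
    define g where "g c = (SOME u. u \<in> U \<and> L u = c)" for c
    have g: "g c \<in> U \<and> L (g c) = c" if c: "c \<in> C" for c
    proof -
      obtain u where "u \<in> U" "L u = c" using C(1) c by auto
      then show ?thesis unfolding g_def by (intro someI[where P = "\<lambda>u. u \<in> U \<and> L u = c" and x = u]) simp
    qed
    have LgC: "L ` (g ` C) = C" using g by (force simp: image_image)
    have inj: "inj_on L (g ` C)" using g by (intro inj_onI) auto
    have "quotient_basis s1 U ?V (g ` C)"
      unfolding quotient_basis_def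
    proof (intro conjI allI impI ballI)
      show "g ` C \<subseteq> U" using g by auto
      fix T c v assume T: "finite T \<and> T \<subseteq> g ` C \<and> (\<Sum>v\<in>T. s1 (c v) v) \<in> ?V" and v: "v \<in> T"
      have injT: "inj_on L T" using inj T inj_on_subset by blast
      define c' where "c' w = c (the_inv_into T L w)" for w
      have c': "c' (L v) = c v" if "v \<in> T" for v
        using the_inv_into_f_f[OF injT that] by (simp add: c'_def)
      have "(\<Sum>w\<in>L ` T. s2 (c' w) w) = (\<Sum>v\<in>T. s2 (c v) (L v))"
        unfolding sum.reindex[OF injT] by (simp add: c')
      also have "\<dots> = 0" using T by (simp add: L_sum)
      finally have "c' (L v) = 0"
        using vs2.independentD[OF C(2), of "L ` T" c' "L v"] T LgC v by blast
      then show "c v = 0" using c'[OF v] by simp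
    next
      fix u assume u: "u \<in> U"
      then have "L u \<in> vs2.span (L ` (g ` C))" using C(3) LgC by auto
      then obtain s where s: "s \<in> vs1.span (g ` C)" "L u = L s"
        by (auto simp: linear_span_image[OF lin])
      have "vs1.span (g ` C) \<subseteq> U" using g U by (intro vs1.span_minimal) auto
      then have "u - s \<in> ?V" using s u U by (auto simp: linear_diff[OF lin] intro: vs1.subspace_diff)
      then show "\<exists>s\<in>vs1.span (g ` C). u - s \<in> ?V" using s(1) by blast
    qed
    then show ?thesis by blast
  qed
  then show ?thesis
    unfolding quotient_dim_def using card someI_ex[of "quotient_basis s1 U ?V"] by auto
qed

context generalized_action
begin

definition fscale :: "'f \<Rightarrow> ((nat \<Rightarrow> 'a) \<Rightarrow> 'a) \<Rightarrow> (nat \<Rightarrow> 'a) \<Rightarrow> 'a" where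
  "fscale c f = (\<lambda>\<psi>. scaleA c (f \<psi>))"

lemma fscale_apply [simp]: "fscale c f \<psi> = scaleA c (f \<psi>)"
  by (simp add: fscale_def)

lemma vector_space_fscale: "vector_space fscale"
  by unfold_locales
    (auto simp: fun_eq_iff A.scale_right_distrib A.scale_left_distrib)

end

sublocale generalized_action \<subseteq> F: vector_space fscale
  by (rule vector_space_fscale)

context generalized_action
begin

definition word_fun :: "(nat \<times> 'h) list \<Rightarrow> (nat \<Rightarrow> 'a) \<Rightarrow> 'a" where
  "word_fun w = (\<lambda>\<psi>. eval_word act \<psi> w)"

definition words_over :: "nat set \<Rightarrow> (nat \<times> 'h) list set" where
  "words_over I = {w. distinct (map fst w) \<and> set (map fst w) = I}"

text \<open>
  The functions represented by \<open>H\<close>-polynomials that are multilinear in the variables with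
  indices in \<open>I\<close>. Arbitrary index sets are convenient for products and substitutions.
\<close>

definition multilin :: "nat set \<Rightarrow> ((nat \<Rightarrow> 'a) \<Rightarrow> 'a) set" where
  "multilin I = F.span (word_fun ` words_over I)"

lemma multilin_subspace: "F.subspace (multilin I)"
  by (simp add: multilin_def)

lemma multilin_minimal: "F.subspace {f. Q f} \<Longrightarrow> (\<And>w. w \<in> words_over I \<Longrightarrow> Q (word_fun w)) \<Longrightarrow> f \<in> multilin I \<Longrightarrow> Q f"
  using F.span_minimal[of "word_fun ` words_over I" "{f. Q f}"] by (auto simp: multilin_def)

lemma word_fun_multilin: "w \<in> words_over I \<Longrightarrow> word_fun w \<in> multilin I"
  unfolding multilin_def by (intro F.span_base) blast

lemma multilin_sum_closed: "(\<And>k. k \<in> K \<Longrightarrow> f k \<in> multilin I) \<Longrightarrow> (\<lambda>\<psi>. \<Sum>k\<in>K. f k \<psi>) \<in> multilin I"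
proof -
  assume "\<And>k. k \<in> K \<Longrightarrow> f k \<in> multilin I"
  then have "(\<Sum>k\<in>K. f k) \<in> multilin I" by (rule F.subspace_sum[OF multilin_subspace])
  moreover have "(\<Sum>k\<in>K. f k) = (\<lambda>\<psi>. \<Sum>k\<in>K. f k \<psi>)"
    by (induction K rule: infinite_finite_induct) (auto simp: fun_eq_iff)
  ultimately show ?thesis by simp
qed

lemma multilin_add_closed: "f \<in> multilin I \<Longrightarrow> g \<in> multilin I \<Longrightarrow> (\<lambda>\<psi>. f \<psi> + g \<psi>) \<in> multilin I"
  using F.subspace_add[OF multilin_subspace, of f I g] by (simp add: plus_fun_def)

lemma multilin_scale_closed: "f \<in> multilin I \<Longrightarrow> (\<lambda>\<psi>. scaleA c (f \<psi>)) \<in> multilin I"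
  using F.subspace_scale[OF multilin_subspace, of f I c] by (simp add: fscale_def)

lemma multilin_zero_closed: "(\<lambda>\<psi>. 0) \<in> multilin I"
  using F.subspace_0[OF multilin_subspace, of I] by (simp add: zero_fun_def)

lemma eval_word_cong:
  "(\<And>i. i \<in> set (map fst w) \<Longrightarrow> \<psi> i = \<psi>' i) \<Longrightarrow> eval_word act \<psi> w = eval_word act \<psi>' w"
proof -
  assume eq: "\<And>i. i \<in> set (map fst w) \<Longrightarrow> \<psi> i = \<psi>' i"
  have "\<psi> i = \<psi>' i" if "(i, h) \<in> set w" for i h
    using eq[of i] that by (force simp: image_iff)
  then have "map (\<lambda>(i, h). act h (\<psi> i)) w = map (\<lambda>(i, h). act h (\<psi>' i)) w"
    by (intro map_cong) auto
  then show ?thesis unfolding eval_word_def by (rule arg_cong)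
qed

lemma multilin_cong: 
  assumes "f \<in> multilin I" "\<And>i. i \<in> I \<Longrightarrow> \<psi> i = \<psi>' i"
  shows "f \<psi> = f \<psi>'"
proof (rule multilin_minimal[OF _ _ assms(1)])
  show "F.subspace {f. f \<psi> = f \<psi>'}" by (rule F.subspaceI) auto
  show "word_fun w \<psi> = word_fun w \<psi>'" if "w \<in> words_over I" for w
    unfolding word_fun_def using that assms(2) by (intro eval_word_cong) (auto simp: words_over_def)
qed

lemma eval_word_update:
  assumes "distinct (map fst ((j, h) # w))" "w \<noteq> []"
  shows "eval_word act (\<psi>(j := z)) ((j, h) # w) = act h z * eval_word act \<psi> w"
    and "i \<noteq> j \<Longrightarrow> eval_word act (\<psi>(i := z)) ((j, h) # w) = act h (\<psi> j) * eval_word act (\<psi>(i := z)) w"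
proof -
  have "eval_word act (\<psi>(j := z)) w = eval_word act \<psi> w"
    by (rule eval_word_cong) (use assms(1) in auto)
  then show "eval_word act (\<psi>(j := z)) ((j, h) # w) = act h z * eval_word act \<psi> w"
    by (simp only: eval_word_cons[OF assms(2)] fun_upd_same)
qed (simp add: eval_word_cons[OF assms(2)])

lemma eval_word_fun_upd:
  assumes "distinct (map fst w)" "(i, h) \<in> set w"
  shows "eval_word act (\<psi>(i := x)) w =
    list_product (map ((\<lambda>(j, k). act k (\<psi> j))((i, h) := act h x)) w)"
  unfolding eval_word_def
proof (rule arg_cong[of _ _ list_product], rule map_cong[OF refl])
  fix jk assume jk: "jk \<in> set w"
  obtain j k where [simp]: "jk = (j, k)" by (cases jk)
  have "k = h" if "j = i" using eq_key_imp_eq_value[OF assms(1)] assms(2) jk that by auto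
  then show "(case jk of (j, k) \<Rightarrow> act k ((\<psi>(i := x)) j)) = ((\<lambda>(j, k). act k (\<psi> j))((i, h) := act h x)) jk"
    by auto
qed

lemma eval_word_update_linear:
  assumes w: "distinct (map fst w)" "i \<in> set (map fst w)"
  shows "eval_word act (\<psi>(i := x + y)) w = eval_word act (\<psi>(i := x)) w + eval_word act (\<psi>(i := y)) w"
    and "eval_word act (\<psi>(i := scaleA c x)) w = scaleA c (eval_word act (\<psi>(i := x)) w)"
proof -
  obtain h where h: "(i, h) \<in> set w" using w(2) by auto
  have "distinct w" using w(1) by (simp add: distinct_map)
  note lin = A.list_product_update[OF this h]
  show "eval_word act (\<psi>(i := x + y)) w = eval_word act (\<psi>(i := x)) w + eval_word act (\<psi>(i := y)) w"
    unfolding eval_word_fun_upd[OF w(1) h] act_add_right by (rule lin(1))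
  show "eval_word act (\<psi>(i := scaleA c x)) w = scaleA c (eval_word act (\<psi>(i := x)) w)"
    unfolding eval_word_fun_upd[OF w(1) h] act_scale_right by (rule lin(2))
qed

lemma multilin_update_add:
  assumes "f \<in> multilin I" "i \<in> I"
  shows "f (\<psi>(i := x + y)) = f (\<psi>(i := x)) + f (\<psi>(i := y))"
proof (rule multilin_minimal[OF _ _ assms(1)])
  show "F.subspace {f. f (\<psi>(i := x + y)) = f (\<psi>(i := x)) + f (\<psi>(i := y))}"
    by (rule F.subspaceI) (auto simp: A.scale_right_distrib)
  show "word_fun w (\<psi>(i := x + y)) = word_fun w (\<psi>(i := x)) + word_fun w (\<psi>(i := y))"
    if "w \<in> words_over I" for w
    unfolding word_fun_def using that assms(2) by (intro eval_word_update_linear(1)) (auto simp: words_over_def)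
qed

lemma multilin_update_scale:
  assumes "f \<in> multilin I" "i \<in> I"
  shows "f (\<psi>(i := scaleA c x)) = scaleA c (f (\<psi>(i := x)))"
proof (rule multilin_minimal[OF _ _ assms(1)])
  show "F.subspace {f. f (\<psi>(i := scaleA c x)) = scaleA c (f (\<psi>(i := x)))}"
    by (rule F.subspaceI) (auto simp: A.scale_right_distrib mult.commute)
  show "word_fun w (\<psi>(i := scaleA c x)) = scaleA c (word_fun w (\<psi>(i := x)))"
    if "w \<in> words_over I" for w
    unfolding word_fun_def using that assms(2) by (intro eval_word_update_linear(2)) (auto simp: words_over_def)
qed

lemma multilin_update_sum:
  assumes "f \<in> multilin I" "i \<in> I" "finite K"
  shows "f (\<psi>(i := \<Sum>k\<in>K. scaleA (c k) (e k))) = (\<Sum>k\<in>K. scaleA (c k) (f (\<psi>(i := e k))))"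
  using assms(3)
proof (induction K rule: finite_induct)
  case empty
  show ?case
    using multilin_update_scale[OF assms(1,2), of \<psi> 0 0] by (simp only: A.scale_zero_left sum.empty)
next
  case (insert k K)
  show ?case
    unfolding sum.insert[OF insert.hyps] multilin_update_add[OF assms(1,2)]
      multilin_update_scale[OF assms(1,2)] insert.IH ..
qed

lemma multilin_permute:
  assumes "f \<in> multilin I" "\<sigma> permutes I"
  shows "(\<lambda>\<psi>. f (\<psi> \<circ> \<sigma>)) \<in> multilin I"
proof (rule multilin_minimal[OF _ _ assms(1)])
  show "F.subspace {f. (\<lambda>\<psi>. f (\<psi> \<circ> \<sigma>)) \<in> multilin I}"
    by (rule F.subspaceI) (auto simp: multilin_zero_closed multilin_add_closed multilin_scale_closed)
  fix w assume w: "w \<in> words_over I"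
  let ?w = "map (\<lambda>(i, h). (\<sigma> i, h)) w"
  have fst_w: "map fst ?w = map \<sigma> (map fst w)" by (induction w) auto
  have "inj_on \<sigma> (set (map fst w))" using permutes_inj_on[OF assms(2)] by blast
  then have "?w \<in> words_over I"
    unfolding words_over_def mem_Collect_eq fst_w
    using w permutes_image[OF assms(2)] by (auto simp: words_over_def distinct_map intro: comp_inj_on)
  moreover have "(\<lambda>\<psi>. word_fun w (\<psi> \<circ> \<sigma>)) = word_fun ?w"
    unfolding word_fun_def eval_word_def
    by (intro ext arg_cong[of _ _ list_product]) (auto simp: case_prod_beta)
  ultimately show "(\<lambda>\<psi>. word_fun w (\<psi> \<circ> \<sigma>)) \<in> multilin I" using word_fun_multilin by simp
qed

lemma multilin_mult:
  assumes f: "f \<in> multilin I" and g: "g \<in> multilin I'" and disj: "I \<inter> I' = {}"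
  shows "(\<lambda>\<psi>. f \<psi> * g \<psi>) \<in> multilin (I \<union> I')"
proof -
  have 1: "(\<lambda>\<psi>. word_fun w \<psi> * word_fun v \<psi>) \<in> multilin (I \<union> I')" if w: "w \<in> words_over I" and v: "v \<in> words_over I'" for w v
  proof (cases "w = [] \<or> v = []")
    case True
    then show ?thesis using multilin_zero_closed by (auto simp: word_fun_def eval_word_def)
  next
    case False
    then have "(\<lambda>\<psi>. word_fun w \<psi> * word_fun v \<psi>) = word_fun (w @ v)"
      by (auto simp: word_fun_def eval_word_append)
    moreover have "w @ v \<in> words_over (I \<union> I')" using w v disj by (auto simp: words_over_def)
    ultimately show ?thesis using word_fun_multilin by simp
  qed
  have 2: "(\<lambda>\<psi>. word_fun w \<psi> * g \<psi>) \<in> multilin (I \<union> I')" if w: "w \<in> words_over I" for w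
  proof (rule multilin_minimal[OF _ _ g])
    show "F.subspace {g. (\<lambda>\<psi>. word_fun w \<psi> * g \<psi>) \<in> multilin (I \<union> I')}"
      by (rule F.subspaceI)
        (auto simp: multilin_zero_closed multilin_add_closed multilin_scale_closed distrib_left A.scale_mult_right[symmetric])
  qed (use 1 w in auto)
  show ?thesis
  proof (rule multilin_minimal[OF _ _ f])
    show "F.subspace {f. (\<lambda>\<psi>. f \<psi> * g \<psi>) \<in> multilin (I \<union> I')}"
      by (rule F.subspaceI)
        (auto simp: multilin_zero_closed multilin_add_closed multilin_scale_closed distrib_right A.scale_mult_left[symmetric])
  qed (use 2 in auto)
qed

lemma act_multilin: "(\<lambda>\<psi>. act h (\<psi> i)) \<in> multilin {i}"
  using word_fun_multilin[of "[(i, h)]" "{i}"] by (simp add: words_over_def word_fun_def)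

lemma act_product_multilin:
  assumes "i \<noteq> j"
  shows "(\<lambda>\<psi>. act h (\<psi> j * \<psi> i)) \<in> multilin {j, i}"
proof -
  obtain ts where ts: "\<And>a b. act h (a * b) =
      (\<Sum>(h1, h2, h3, h4) \<leftarrow> ts. act h1 a * act h2 b + act h3 b * act h4 a)"
    using act_product[of h] by blast
  have "(\<lambda>\<psi>. \<Sum>(h1, h2, h3, h4) \<leftarrow> ts. act h1 (\<psi> j) * act h2 (\<psi> i) + act h3 (\<psi> i) * act h4 (\<psi> j)) \<in> multilin {j, i}"
  proof (induction ts)
    case (Cons t ts)
    obtain h1 h2 h3 h4 where t: "t = (h1, h2, h3, h4)" by (cases t)
    have "(\<lambda>\<psi>. act h1 (\<psi> j) * act h2 (\<psi> i)) \<in> multilin ({j} \<union> {i})"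
      "(\<lambda>\<psi>. act h3 (\<psi> i) * act h4 (\<psi> j)) \<in> multilin ({i} \<union> {j})"
      using assms by (intro multilin_mult act_multilin; auto)+
    then have "(\<lambda>\<psi>. act h1 (\<psi> j) * act h2 (\<psi> i) + act h3 (\<psi> i) * act h4 (\<psi> j)) \<in> multilin {j, i}"
      by (intro multilin_add_closed) (simp_all add: insert_commute)
    then show ?case using multilin_add_closed[OF _ Cons] by (simp add: t)
  qed (simp add: multilin_zero_closed)
  then show ?thesis by (simp add: ts)
qed

text \<open>
  This is where the axiom on \<open>h (a b)\<close> enters: it makes \<open>h\<close> applied to the substituted product
  an \<open>H\<close>-polynomial again.
\<close>

lemma multilin_substitute_product:
  assumes f: "f \<in> multilin I" and i: "i \<in> I" and j: "j \<notin> I"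
  shows "(\<lambda>\<psi>. f (\<psi>(i := \<psi> j * \<psi> i))) \<in> multilin (insert j I)"
proof (rule multilin_minimal[OF _ _ f])
  show "F.subspace {f. (\<lambda>\<psi>. f (\<psi>(i := \<psi> j * \<psi> i))) \<in> multilin (insert j I)}"
    by (rule F.subspaceI) (auto simp: multilin_zero_closed multilin_add_closed multilin_scale_closed)
  have "(\<lambda>\<psi>. eval_word act (\<psi>(i := \<psi> j * \<psi> i)) w) \<in> multilin (insert j (set (map fst w)))"
    if "distinct (map fst w)" "i \<in> set (map fst w)" "j \<notin> set (map fst w)" for w
    using that
  proof (induction w)
    case (Cons a w)
    obtain k h where a: "a = (k, h)" by (cases a)
    show ?case
    proof (cases "w = []")
      case True
      then show ?thesis using Cons a act_product_multilin[of i j h] by auto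
    next
      case ne: False
      show ?thesis
      proof (cases "i = k")
        case True
        have "(\<lambda>\<psi>. act h (\<psi> j * \<psi> i) * word_fun w \<psi>) \<in> multilin ({j, i} \<union> set (map fst w))"
          using Cons a True by (intro multilin_mult act_product_multilin word_fun_multilin) (auto simp: words_over_def)
        moreover have "(\<lambda>\<psi>. eval_word act (\<psi>(i := \<psi> j * \<psi> i)) (a # w)) = (\<lambda>\<psi>. act h (\<psi> j * \<psi> i) * word_fun w \<psi>)"
          unfolding a True[symmetric] word_fun_def
          by (rule ext, rule eval_word_update(1)) (use Cons.prems(1) a True ne in auto)
        moreover have "insert j (set (map fst (a # w))) = {j, i} \<union> set (map fst w)"
          using a True by auto
        ultimately show ?thesis by (simp only:)
      next
        case False
        have "(\<lambda>\<psi>. act h (\<psi> k) * eval_word act (\<psi>(i := \<psi> j * \<psi> i)) w) \<in> multilin ({k} \<union> insert j (set (map fst w)))"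
          by (intro multilin_mult act_multilin Cons.IH) (use Cons.prems a False in auto)
        moreover have "(\<lambda>\<psi>. eval_word act (\<psi>(i := \<psi> j * \<psi> i)) (a # w)) = (\<lambda>\<psi>. act h (\<psi> k) * eval_word act (\<psi>(i := \<psi> j * \<psi> i)) w)"
          unfolding a
          by (rule ext, rule eval_word_update(2)) (use Cons.prems(1) a False ne in auto)
        moreover have "insert j (set (map fst (a # w))) = {k} \<union> insert j (set (map fst w))"
          using a by auto
        ultimately show ?thesis by (simp only:)
      qed
    qed
  qed simp
  then show "(\<lambda>\<psi>. word_fun w (\<psi>(i := \<psi> j * \<psi> i))) \<in> multilin (insert j I)" if "w \<in> words_over I" for w
    using that i j by (auto simp: word_fun_def words_over_def)
qed

text \<open>
  By induction on the set \<open>K\<close> of the variables whose values are not yet basis elements.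
\<close>

lemma multilin_eq_0:
  assumes f: "f \<in> multilin I" and I: "finite I" and E: "finite E" "A.span E = UNIV"
    and zero: "\<And>\<tau>. \<tau> \<in> PiE I (\<lambda>_. E) \<Longrightarrow> f \<tau> = 0"
  shows "f = 0"
proof -
  have "f \<psi> = 0" if "K \<subseteq> I" "\<And>i. i \<in> I - K \<Longrightarrow> \<psi> i \<in> E" for K \<psi>
    using finite_subset[OF that(1) I] that
  proof (induction K arbitrary: \<psi> rule: finite_induct)
    case empty
    have "f \<psi> = f (restrict \<psi> I)" using f by (rule multilin_cong) simp
    then show ?case using zero[of "restrict \<psi> I"] empty by auto
  next
    case (insert i K)
    have i: "i \<in> I" using insert by simp
    have "\<psi> i \<in> A.span E" using E by simp
    then obtain c where c: "\<psi> i = (\<Sum>e\<in>E. scaleA (c e) e)" using A.span_finite[OF E(1)] by auto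
    have "f \<psi> = f (\<psi>(i := \<Sum>e\<in>E. scaleA (c e) e))" by (simp flip: c)
    also have "\<dots> = (\<Sum>e\<in>E. scaleA (c e) (f (\<psi>(i := e))))"
      by (rule multilin_update_sum[OF f i E(1)])
    also have "\<dots> = 0"
      using insert by (intro sum.neutral ballI) auto
    finally show ?case .
  qed
  from this[of I] show ?thesis by (auto simp: fun_eq_iff)
qed

lemma multilinear_words_eq: "multilinear_words n = words_over {1..n}"
proof (rule set_eqI)
  fix w :: "(nat \<times> 'h) list"
  show "w \<in> multilinear_words n \<longleftrightarrow> w \<in> words_over {1..n}"
  proof
    assume "w \<in> multilinear_words n"
    then obtain \<sigma> where s: "\<sigma> permutes {1..n}" "map fst w = map \<sigma> [1..<Suc n]"
      by (auto simp: multilinear_words_def)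
    have "\<sigma> ` {1..<Suc n} = {1..n}" using permutes_image[OF s(1)] by (simp add: atLeastLessThanSuc_atLeastAtMost)
    then show "w \<in> words_over {1..n}"
      unfolding words_over_def mem_Collect_eq s(2)
      using permutes_inj_on[OF s(1)] by (simp only: distinct_map set_map set_upt distinct_upt)
  next
    assume w: "w \<in> words_over {1..n}"
    let ?l = "map fst w"
    have len: "length ?l = n" using w distinct_card[of ?l] by (simp add: words_over_def)
    define \<sigma> where "\<sigma> i = (if i \<in> {1..n} then ?l ! (i - 1) else i)" for i
    have nth: "map \<sigma> [1..<Suc n] = ?l"
      using len by (intro nth_equalityI) (auto simp: \<sigma>_def simp del: upt_Suc)
    have "\<sigma> ` {1..n} = {1..n}"
    proof -
      have "\<sigma> ` {1..n} = set (map \<sigma> [1..<Suc n])" by (simp only: set_map set_upt atLeastLessThanSuc_atLeastAtMost)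
      also have "\<dots> = {1..n}" unfolding nth using w by (simp only: words_over_def mem_Collect_eq)
      finally show ?thesis .
    qed
    moreover have "inj_on \<sigma> {1..n}"
      using calculation by (intro eq_card_imp_inj_on) auto
    ultimately have "\<sigma> permutes {1..n}"
      by (intro bij_imp_permutes) (auto simp: bij_betw_def \<sigma>_def)
    then show "w \<in> multilinear_words n"
      using nth by (auto simp: multilinear_words_def)
  qed
qed

definition poly_fun :: "('f, 'h) hpoly \<Rightarrow> (nat \<Rightarrow> 'a) \<Rightarrow> 'a" where
  "poly_fun f = (\<lambda>\<psi>. heval scaleA act \<psi> f)"

lemma linear_poly_fun: "Vector_Spaces.linear hscale fscale poly_fun"
proof -
  have "heval scaleA act \<psi> (f + g) = heval scaleA act \<psi> f + heval scaleA act \<psi> g" for f g and \<psi>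
    using heval_diff[of \<psi> "f + g" g] by (simp add: eq_diff_eq)
  then show ?thesis
    by (simp add: Vector_Spaces.linear_iff vector_space_hscale vector_space_fscale poly_fun_def fun_eq_iff heval_hscale)
qed

lemma H_codim_eq_dim:
  assumes n: "n \<ge> 1"
  shows "H_codim scaleH scaleA act n = F.dim (multilin {1..n})"
proof -
  interpret hp: vector_space hscale by (rule vector_space_hscale)
  interpret P: vector_space_pair hscale fscale by unfold_locales
  let ?U = "multilinear_hpolys scaleH n :: ('f, 'h) hpoly set"
  have U: "hp.subspace ?U" by (simp add: multilinear_hpolys_def)
  have words: "multilinear_words n \<subseteq> (hwords :: (nat \<times> 'h) list set)"
  proof
    fix w :: "(nat \<times> 'h) list" assume "w \<in> multilinear_words n"
    then have "set (map fst w) = {1..n}" by (simp add: multilinear_words_eq words_over_def)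
    moreover from this have "w \<noteq> []" using n by auto
    ultimately show "w \<in> hwords" by (force simp: hwords_def)
  qed
  have "?U \<subseteq> hpolys"
  proof -
    have "monomial ` multilinear_words n \<subseteq> (hpolys :: ('f, 'h) hpoly set)"
      unfolding hpolys_def using words by (auto intro!: hp.span_base)
    moreover have "tensor_relations scaleH \<subseteq> hpolys"
      using tensor_relations_identities by (auto simp: H_identities_def)
    ultimately show ?thesis
      unfolding multilinear_hpolys_def by (intro hp.span_minimal) (auto simp: hpolys_def)
  qed
  then have "?U \<inter> H_identities scaleA act = {u \<in> ?U. poly_fun u = 0}"
    by (auto simp: H_identities_def poly_fun_def fun_eq_iff)
  then have "H_codim scaleH scaleA act n = F.dim (poly_fun ` ?U)"
    unfolding H_codim_def by (simp add: P.quotient_dim_eq_dim_image[OF linear_poly_fun U])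
  also have "poly_fun ` ?U = multilin {1..n}"
  proof -
    have "poly_fun ` ?U = F.span (poly_fun ` (monomial ` multilinear_words n \<union> tensor_relations scaleH))"
      unfolding multilinear_hpolys_def by (rule P.linear_span_image[OF linear_poly_fun, symmetric])
    also have "\<dots> = F.span (word_fun ` words_over {1..n})"
    proof (rule antisym)
      have "poly_fun r = 0" if "r \<in> tensor_relations scaleH" for r
        using that tensor_relations_identities by (auto simp: H_identities_def poly_fun_def fun_eq_iff)
      moreover have poly_fun_monomial: "poly_fun (monomial w) = word_fun w" for w
        by (simp add: poly_fun_def word_fun_def)
      ultimately have "poly_fun ` (monomial ` multilinear_words n \<union> tensor_relations scaleH) \<subseteq> insert 0 (word_fun ` words_over {1..n})"
        by (auto simp: multilinear_words_eq)
      then show "F.span (poly_fun ` (monomial ` multilinear_words n \<union> tensor_relations scaleH)) \<subseteq> F.span (word_fun ` words_over {1..n})"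
        using F.span_mono[of _ "insert 0 (word_fun ` words_over {1..n})"] by (simp only: F.span_insert_0)
      have "word_fun ` words_over {1..n} \<subseteq> poly_fun ` (monomial ` multilinear_words n \<union> tensor_relations scaleH)"
        by (auto simp: multilinear_words_eq image_Un image_image poly_fun_monomial)
      then show "F.span (word_fun ` words_over {1..n}) \<subseteq> F.span (poly_fun ` (monomial ` multilinear_words n \<union> tensor_relations scaleH))"
        by (rule F.span_mono)
    qed
    finally show ?thesis by (simp add: multilin_def)
  qed
  finally show ?thesis .
qed

end

context fd_action
begin

text \<open>
  Evaluation at the tuples in \<open>\<Theta>\<close>, followed by taking coordinates, is injective.
\<close>

lemma multilin_finite_basis:
  fixes \<Theta> :: "(nat \<Rightarrow> 'a) set"
  assumes fin: "finite \<Theta>"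
    and det: "\<And>f. f \<in> multilin I \<Longrightarrow> (\<And>\<tau>. \<tau> \<in> \<Theta> \<Longrightarrow> f \<tau> = 0) \<Longrightarrow> f = 0"
  shows "\<exists>C. finite C \<and> C \<subseteq> multilin I \<and> F.independent C \<and> multilin I \<subseteq> F.span C \<and>
    card C \<le> card \<Theta> * card Basis"
proof -
  define gscale where "gscale c g = (\<lambda>x. c * g x)" for c :: 'f and g :: "(nat \<Rightarrow> 'a) \<times> 'a \<Rightarrow> 'f"
  interpret G: vector_space gscale
    by unfold_locales (auto simp: gscale_def fun_eq_iff algebra_simps)
  interpret P: vector_space_pair fscale gscale by unfold_locales
  define X where "X = \<Theta> \<times> Basis"
  have finX: "finite X" unfolding X_def using fin A.finite_Basis by simp
  define R where "R f = (\<lambda>x. if x \<in> X then A.representation Basis (f (fst x)) (snd x) else 0)"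
    for f :: "(nat \<Rightarrow> 'a) \<Rightarrow> 'a"
  have lin: "Vector_Spaces.linear fscale gscale R"
    unfolding Vector_Spaces.linear_iff
    by (auto simp: vector_space_fscale G.vector_space_axioms R_def fun_eq_iff gscale_def
        A.representation_add[OF A.independent_Basis] A.representation_scale[OF A.independent_Basis]
        A.span_Basis)
  obtain C where C: "C \<subseteq> multilin I" "F.independent C" "multilin I \<subseteq> F.span C"
    using F.maximal_independent_subset[of "multilin I"] by metis
  have span: "F.span C \<subseteq> multilin I" using C(1) multilin_subspace by (rule F.span_minimal)
  have ker: "f = 0" if f: "f \<in> F.span C" "R f = 0" for f
  proof (rule det)
    show "f \<in> multilin I" using f span by blast
    fix \<tau> assume \<tau>: "\<tau> \<in> \<Theta>"
    have "A.representation Basis (f \<tau>) b = 0" if "b \<in> Basis" for b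
      using fun_cong[OF f(2), of "(\<tau>, b)"] \<tau> that by (simp add: R_def X_def)
    then have "(\<Sum>b\<in>Basis. scaleA (A.representation Basis (f \<tau>) b) b) = 0" by simp
    moreover have "(\<Sum>b\<in>Basis. scaleA (A.representation Basis (f \<tau>) b) b) = f \<tau>"
      using A.span_Basis A.finite_Basis by (intro A.sum_representation_eq[OF A.independent_Basis]) auto
    ultimately show "f \<tau> = 0" by simp
  qed
  have inj: "inj_on R (F.span C)"
  proof (rule inj_onI)
    fix f g assume fg: "f \<in> F.span C" "g \<in> F.span C" "R f = R g"
    then have "f - g = 0" by (intro ker) (simp_all add: F.span_diff P.linear_diff[OF lin])
    then show "f = g" by simp
  qed
  define \<delta> :: "(nat \<Rightarrow> 'a) \<times> 'a \<Rightarrow> (nat \<Rightarrow> 'a) \<times> 'a \<Rightarrow> 'f"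
    where "\<delta> x = (\<lambda>y. if y = x then 1 else 0)" for x
  have "G.independent (R ` C)"
    by (rule P.linear_independent_injective_image[OF lin C(2) inj])
  moreover have "R ` C \<subseteq> G.span (\<delta> ` X)"
  proof clarify
    fix f
    have sum_apply: "(\<Sum>x\<in>Y. g x) y = (\<Sum>x\<in>Y. g x y)" for Y :: "((nat \<Rightarrow> 'a) \<times> 'a) set" and g :: "_ \<Rightarrow> _ \<Rightarrow> 'f" and y
      by (induction Y rule: infinite_finite_induct) auto
    have "R f y = (\<Sum>x\<in>X. gscale (R f x) (\<delta> x)) y" for y
      unfolding sum_apply using finX
      by (simp add: gscale_def \<delta>_def if_distrib cong: if_cong) (simp add: R_def)
    then have "R f = (\<Sum>x\<in>X. gscale (R f x) (\<delta> x))" by (rule ext)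
    also have "\<dots> \<in> G.span (\<delta> ` X)"
      by (intro G.span_sum G.span_scale G.span_base) blast
    finally show "R f \<in> G.span (\<delta> ` X)" .
  qed
  ultimately have b: "finite (R ` C)" "card (R ` C) \<le> card (\<delta> ` X)"
    using G.independent_span_bound[of "\<delta> ` X" "R ` C"] finX by auto
  have injC: "inj_on R C" by (rule inj_on_subset[OF inj F.span_superset])
  have "card C \<le> card \<Theta> * card Basis"
    using b(2) card_image[OF injC] card_image_le[OF finX, of \<delta>] by (simp add: X_def card_cartesian_product)
  moreover have "finite C" using b(1) injC by (rule finite_imageD)
  ultimately show ?thesis using C by (intro exI[of _ C]) simp
qed

lemma H_codim_le:
  assumes n: "n \<ge> 1" and fin: "finite \<Theta>"
    and det: "\<And>f. f \<in> multilin {1..n} \<Longrightarrow> (\<And>\<tau>. \<tau> \<in> \<Theta> \<Longrightarrow> f \<tau> = 0) \<Longrightarrow> f = 0"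
  shows "H_codim scaleH scaleA act n \<le> card \<Theta> * card Basis"
proof -
  obtain C where C: "C \<subseteq> multilin {1..n}" "F.independent C" "multilin {1..n} \<subseteq> F.span C"
    "card C \<le> card \<Theta> * card Basis"
    using multilin_finite_basis[OF fin det] by metis
  have "card C = F.dim (multilin {1..n})" by (rule F.basis_card_eq_dim[OF C(1,3,2)])
  then show ?thesis using C(4) H_codim_eq_dim[OF n] by simp
qed

lemma H_codim_ge:
  assumes n: "n \<ge> 1" and S: "finite S" and p: "\<And>s. s \<in> S \<Longrightarrow> p s \<in> multilin {1..n}"
    and ind: "\<And>c. (\<And>\<psi>. (\<Sum>s\<in>S. scaleA (c s) (p s \<psi>)) = 0) \<Longrightarrow> \<forall>s\<in>S. c s = 0"
  shows "card S \<le> H_codim scaleH scaleA act n"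
proof -
  define \<Theta> where "\<Theta> = PiE {1..n} (\<lambda>_. Basis)"
  have fin: "finite \<Theta>" unfolding \<Theta>_def using A.finite_Basis by (intro finite_PiE) auto
  have det: "f = 0" if f: "f \<in> multilin {1..n}" and z: "\<And>\<tau>. \<tau> \<in> \<Theta> \<Longrightarrow> f \<tau> = 0" for f
    by (rule multilin_eq_0[OF f _ A.finite_Basis A.span_Basis]) (simp_all add: z \<Theta>_def)
  obtain C where C: "finite C" "C \<subseteq> multilin {1..n}" "F.independent C" "multilin {1..n} \<subseteq> F.span C"
    using multilin_finite_basis[OF fin det] by metis
  have dim: "card C = F.dim (multilin {1..n})" by (rule F.basis_card_eq_dim[OF C(2,4,3)])
  have sum_apply: "(\<Sum>x\<in>Y. fscale (c x) (g x)) \<psi> = (\<Sum>x\<in>Y. scaleA (c x) (g x \<psi>))"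
    for Y :: "'s set" and c g \<psi>
    by (induction Y rule: infinite_finite_induct) auto
  have inj: "inj_on p S"
  proof (rule inj_onI, rule ccontr)
    fix s t assume st: "s \<in> S" "t \<in> S" "p s = p t" "s \<noteq> t"
    let ?c = "\<lambda>x. if x = s then 1 else if x = t then - 1 else 0 :: 'f"
    have "(\<Sum>x\<in>S. scaleA (?c x) (p x \<psi>)) = 0" for \<psi>
    proof -
      have "(\<Sum>x\<in>S. scaleA (?c x) (p x \<psi>)) =
          (\<Sum>x\<in>S. (if x = s then p s \<psi> else 0) + (if x = t then - p s \<psi> else 0))"
        using st by (intro sum.cong) auto
      also have "\<dots> = 0" using S st by (simp only: sum.distrib) simp
      finally show ?thesis .
    qed
    then have "?c s = 0" using ind[of ?c] st(1) by blast
    then show False by simp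
  qed
  have ind_p: "F.independent (p ` S)"
  proof
    assume "F.dependent (p ` S)"
    then obtain c x where c: "(\<Sum>x\<in>p ` S. fscale (c x) x) = 0" and x: "x \<in> p ` S" "c x \<noteq> 0"
      using F.dependent_finite[of "p ` S"] S by auto
    have "(\<Sum>s\<in>S. scaleA (c (p s)) (p s \<psi>)) = 0" for \<psi>
    proof -
      have "(\<Sum>s\<in>S. scaleA (c (p s)) (p s \<psi>)) = (\<Sum>x\<in>p ` S. fscale (c x) x) \<psi>"
        unfolding sum.reindex[OF inj] o_def sum_apply ..
      then show ?thesis using c by simp
    qed
    then have "\<forall>s\<in>S. c (p s) = 0" by (rule ind)
    then show False using x by auto
  qed
  have sub_p: "p ` S \<subseteq> F.span C"
  proof (rule image_subsetI)
    fix s assume "s \<in> S"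
    then have "p s \<in> multilin {1..n}" by (rule p)
    then show "p s \<in> F.span C" by (rule subsetD[OF C(4)])
  qed
  have "card (p ` S) \<le> card C" by (rule conjunct2[OF F.independent_span_bound[OF C(1) ind_p sub_p]])
  then show ?thesis using card_image[OF inj] dim H_codim_eq_dim[OF n] by simp
qed

end

section \<open>The upper bound\<close>

lemma card_small_subsets_le:
  assumes "n \<ge> 1"
  shows "card {P. P \<subseteq> {1..n} \<and> card P \<le> m} \<le> (m + 1) * n ^ m"
proof -
  have "{P. P \<subseteq> {1..n} \<and> card P \<le> m} = (\<Union>j\<in>{..m}. {P. P \<subseteq> {1..n} \<and> card P = j})"
    by auto
  then have "card {P. P \<subseteq> {1..n} \<and> card P \<le> m} \<le> (\<Sum>j\<in>{..m}. card {P. P \<subseteq> {1..n} \<and> card P = j})"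
    using card_UN_le[of "{..m}" "\<lambda>j. {P. P \<subseteq> {1..n} \<and> card P = j}"] by simp
  also have "\<dots> = (\<Sum>j\<in>{..m}. n choose j)"
    by (simp add: n_subsets)
  also have "\<dots> \<le> (\<Sum>j\<in>{..m}. n ^ m)"
  proof (rule sum_mono)
    fix j assume j: "j \<in> {..m}"
    have "n choose j \<le> n ^ j"
      by (cases "j \<le> n") (simp_all add: binomial_le_pow binomial_eq_0)
    also have "\<dots> \<le> n ^ m" using j assms by (intro power_increasing) auto
    finally show "n choose j \<le> n ^ m" .
  qed
  finally show ?thesis by simp
qed

lemma card_mixed_PiE_le:
  fixes E E' :: "'a set"
  assumes P: "P \<subseteq> {1..n}" "card P \<le> m" and E: "card E \<ge> 1" and E': "card E' \<le> d" "d \<ge> 1"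
  shows "card (PiE {1..n} (\<lambda>k. if k \<in> P then E else E')) \<le> card E ^ m * d ^ n"
proof -
  have "card (PiE {1..n} (\<lambda>k. if k \<in> P then E else E')) = (\<Prod>k\<in>{1..n}. card (if k \<in> P then E else E'))"
    by (rule card_PiE) simp
  also have "\<dots> \<le> (\<Prod>k\<in>{1..n}. (if k \<in> P then card E else 1) * d)"
    using E E' by (intro prod_mono) auto
  also have "\<dots> = (\<Prod>k\<in>{1..n}. if k \<in> P then card E else 1) * d ^ n"
    by (simp add: prod.distrib)
  also have "(\<Prod>k\<in>{1..n}. if k \<in> P then card E else 1) = card E ^ card P"
    using P(1) by (simp add: prod.If_cases Int_absorb1)
  also have "card E ^ card P * d ^ n \<le> card E ^ m * d ^ n"
    using P(2) E by (intro mult_right_mono power_increasing) auto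
  finally show ?thesis .
qed

context wedderburn_action
begin

text \<open>
  A tuple of basis elements on which some word does not vanish is determined by the set \<open>P\<close> of
  positions of radical elements, the set \<open>I\<close> of colours of the other elements, and the
  elements themselves. There are polynomially many choices for \<open>P\<close>, finitely many for \<open>I\<close> and
  for the radical elements, and at most \<open>d\<close> choices for each other element.
\<close>

lemma upper_bound:
  "\<exists>C m. \<forall>n\<ge>1. H_codim scaleH scaleA act n \<le> C * n ^ m * d ^ n"
proof -
  obtain EJ where EJ: "EJ \<subseteq> J" "A.independent EJ" "J \<subseteq> A.span EJ"
    using A.maximal_independent_subset[of J] by metis
  have finEJ: "finite EJ" using EJ(2) by (rule A.finiteI_independent)
  define E where "E = basis_union {1..q} \<union> EJ"
  have finE: "finite E" unfolding E_def using finEJ finite_basis_union by simp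
  have spanE: "A.span E = UNIV"
  proof (rule UNIV_eq_I[symmetric])
    fix a
    obtain f j where f: "\<And>i. i \<in> {1..q} \<Longrightarrow> f i \<in> Bs i" and j: "j \<in> J"
      and a: "a = (\<Sum>i\<in>{1..q}. f i) + j" using decompose[of a] by metis
    have "f i \<in> A.span E" if i: "i \<in> {1..q}" for i
    proof -
      have "basis_of i \<subseteq> E" unfolding E_def basis_union_def using i by blast
      then have "A.span (basis_of i) \<subseteq> A.span E" by (rule A.span_mono)
      then show ?thesis using f[OF i] span_basis_of[OF i] by blast
    qed
    moreover have "j \<in> A.span E"
      using j EJ(3) A.span_mono[of EJ E] by (auto simp: E_def)
    ultimately show "a \<in> A.span E" unfolding a by (intro A.span_add A.span_sum) auto
  qed
  define col where "col e = (if e \<in> EJ then 0 else SOME i. i \<in> {1..q} \<and> e \<in> basis_of i)" for e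
  have col: "e \<in> EJ \<and> col e = 0 \<or> col e \<in> {1..q} \<and> e \<in> basis_of (col e)" if "e \<in> E" for e
  proof (cases "e \<in> EJ")
    case False
    then have "\<exists>i. i \<in> {1..q} \<and> e \<in> basis_of i" using that by (auto simp: E_def basis_union_def)
    then have "(SOME i. i \<in> {1..q} \<and> e \<in> basis_of i) \<in> {1..q} \<and>
        e \<in> basis_of (SOME i. i \<in> {1..q} \<and> e \<in> basis_of i)" by (rule someI_ex)
    then show ?thesis using False by (simp add: col_def)
  qed (simp add: col_def)
  have colour_act: "has_colour (col e) (act h e)" if "e \<in> E" for e h
    using col[OF that]
  proof (elim disjE conjE)
    assume "e \<in> EJ" "col e = 0"
    then show ?thesis using EJ(1) J_invariant by (auto simp: has_colour_def invariant_def)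
  next
    assume i: "col e \<in> {1..q}" "e \<in> basis_of (col e)"
    have "e \<in> Bs (col e)" using i(2) basis_of[of "col e"] by blast
    then have "act h e \<in> Bs (col e)" using Bs_invariant[OF i(1)] by (simp add: invariant_def)
    then show ?thesis using i(1) by (simp add: has_colour_def)
  qed
  \<comment> \<open>The bound on the number of factors from \<open>J\<close> in a nonzero product.\<close>
  define m where "m = Suc A.dimension"
  define small where "small n = {P. P \<subseteq> {1..n} \<and> card P \<le> m}" for n :: nat
  define blocks where "blocks = {I. I \<subseteq> {1..q} \<and> card (basis_union I) \<le> d}"
  define \<Theta> where "\<Theta> n = (\<Union>I\<in>blocks. \<Union>P\<in>small n. PiE {1..n} (\<lambda>k. if k \<in> P then E else basis_union I))"
    for n :: nat
  have fin_small: "finite (small n)" for n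
    by (rule finite_subset[of _ "Pow {1..n}"]) (auto simp: small_def)
  have fin_blocks: "finite blocks"
    by (rule finite_subset[of _ "Pow {1..q}"]) (auto simp: blocks_def)
  have card_blocks: "card blocks \<le> 2 ^ q"
    using card_mono[of "Pow {1..q}" blocks] by (auto simp: blocks_def card_Pow)
  have fin_\<Theta>: "finite (\<Theta> n)" for n
    unfolding \<Theta>_def using fin_small fin_blocks finE finite_basis_union
    by (intro finite_UN_I finite_PiE) (auto simp: blocks_def)
  have "basis_union {1..q} \<noteq> {}"
    using d_attained by (metis d_pos basis_union_def UN_mono card.empty empty_subsetI not_one_le_zero subset_antisym subset_refl)
  then have "E \<noteq> {}" by (auto simp: E_def)
  then have cardE: "card E \<ge> 1" using finE by (simp add: Suc_leI card_gt_0_iff)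
  have card_\<Theta>: "card (\<Theta> n) \<le> 2 ^ q * ((m + 1) * n ^ m) * (card E ^ m * d ^ n)" if n: "n \<ge> 1" for n
  proof -
    have "card (\<Theta> n) \<le> (\<Sum>I\<in>blocks. card (\<Union>P\<in>small n. PiE {1..n} (\<lambda>k. if k \<in> P then E else basis_union I)))"
      unfolding \<Theta>_def by (rule card_UN_le[OF fin_blocks])
    also have "\<dots> \<le> (\<Sum>I\<in>blocks. \<Sum>P\<in>small n. card (PiE {1..n} (\<lambda>k. if k \<in> P then E else basis_union I)))"
      by (intro sum_mono card_UN_le[OF fin_small])
    also have "\<dots> \<le> (\<Sum>I\<in>blocks. \<Sum>P\<in>small n. card E ^ m * d ^ n)"
      using cardE d_pos by (intro sum_mono card_mixed_PiE_le) (auto simp: small_def blocks_def)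
    also have "\<dots> = card blocks * card (small n) * (card E ^ m * d ^ n)" by simp
    also have "\<dots> \<le> 2 ^ q * ((m + 1) * n ^ m) * (card E ^ m * d ^ n)"
      using card_blocks card_small_subsets_le[OF n, of m]
      by (intro mult_right_mono mult_mono) (auto simp: small_def)
    finally show ?thesis .
  qed
  have vanish: "f \<tau> = 0" if f: "f \<in> multilin {1..n}" and \<tau>: "\<tau> \<in> PiE {1..n} (\<lambda>_. E)" and out: "\<tau> \<notin> \<Theta> n"
    for f \<tau> n
  proof (rule multilin_minimal[where Q = "\<lambda>f. f \<tau> = 0", OF _ _ f])
    show "F.subspace {f. f \<tau> = 0}" by (rule F.subspaceI) auto
    fix w assume w: "w \<in> words_over {1..n}"
    show "word_fun w \<tau> = 0"
    proof (rule ccontr)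
      assume nz: "word_fun w \<tau> \<noteq> 0"
      define xs where "xs = map (\<lambda>(i, h). act h (\<tau> i)) w"
      define cs where "cs = map (\<lambda>i. col (\<tau> i)) (map fst w)"
      have prod: "list_product xs \<noteq> 0" using nz by (simp add: xs_def word_fun_def eval_word_def)
      have dist: "distinct (map fst w)" and set: "set (map fst w) = {1..n}"
        using w by (auto simp: words_over_def)
      have \<tau>E: "\<tau> i \<in> E" if "i \<in> {1..n}" for i using \<tau> that by auto
      have "list_all2 has_colour cs xs"
        unfolding list_all2_conv_all_nth
      proof (intro conjI allI impI)
        fix k assume k: "k < length cs"
        obtain i h where ih: "w ! k = (i, h)" by (cases "w ! k")
        have "i \<in> {1..n}" using k ih set by (force simp: cs_def set_conv_nth)
        then show "has_colour (cs ! k) (xs ! k)" using k ih colour_act[OF \<tau>E] by (simp add: cs_def xs_def)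
      qed (simp add: cs_def xs_def)
      moreover have "xs \<noteq> []" using prod by auto
      ultimately have few: "count_list cs 0 \<le> m" and dim: "card (basis_union (set cs - {0})) \<le> d"
        using coloured_product_few_J coloured_product_dim prod unfolding m_def by blast+
      define P where "P = {k \<in> {1..n}. col (\<tau> k) = 0}"
      have "count_list cs 0 = card P"
      proof -
        have "count_list cs 0 = length (filter (\<lambda>i. col (\<tau> i) = 0) (map fst w))"
          unfolding cs_def by (induction w) auto
        also have "\<dots> = card (set (filter (\<lambda>i. col (\<tau> i) = 0) (map fst w)))"
          using dist by (intro distinct_card[symmetric] distinct_filter)
        also have "set (filter (\<lambda>i. col (\<tau> i) = 0) (map fst w)) = P"
          unfolding set_filter set P_def ..
        finally show ?thesis .
      qed
      then have P: "P \<in> small n" using few by (auto simp: small_def P_def)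
      have set_cs: "set cs = (\<lambda>i. col (\<tau> i)) ` {1..n}"
        unfolding cs_def set_map[of "\<lambda>i. col (\<tau> i)"] set ..
      have "set cs - {0} \<subseteq> {1..q}"
      proof
        fix c assume "c \<in> set cs - {0}"
        then obtain i where "i \<in> {1..n}" "c = col (\<tau> i)" "c \<noteq> 0" unfolding set_cs by blast
        then show "c \<in> {1..q}" using col[OF \<tau>E[of i]] by metis
      qed
      then have I: "set cs - {0} \<in> blocks" using dim by (simp add: blocks_def)
      have "\<tau> \<in> PiE {1..n} (\<lambda>k. if k \<in> P then E else basis_union (set cs - {0}))"
      proof (rule PiE_I)
        fix k assume k: "k \<in> {1..n}"
        show "\<tau> k \<in> (if k \<in> P then E else basis_union (set cs - {0}))"
        proof (cases "k \<in> P")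
          case False
          then have "col (\<tau> k) \<noteq> 0" using k by (simp add: P_def)
          then have "\<tau> k \<in> basis_of (col (\<tau> k))" "col (\<tau> k) \<in> set cs - {0}"
            using col[OF \<tau>E[OF k]] k by (auto simp: set_cs)
          then show ?thesis using False by (auto simp: basis_union_def)
        qed (simp add: \<tau>E[OF k])
      qed (use \<tau> in auto)
      then have "\<tau> \<in> \<Theta> n" unfolding \<Theta>_def using P I by blast
      then show False using out by blast
    qed
  qed
  have "H_codim scaleH scaleA act n \<le> (2 ^ q * (m + 1) * card E ^ m * card Basis) * n ^ m * d ^ n"
    if n: "n \<ge> 1" for n
  proof -
    have "H_codim scaleH scaleA act n \<le> card (\<Theta> n) * card Basis"
    proof (rule H_codim_le[OF n fin_\<Theta>])
      fix f assume f: "f \<in> multilin {1..n}" and z: "\<And>\<tau>. \<tau> \<in> \<Theta> n \<Longrightarrow> f \<tau> = 0"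
      show "f = 0"
      proof (rule multilin_eq_0[OF f _ finE spanE])
        fix \<tau> assume "\<tau> \<in> PiE {1..n} (\<lambda>_. E)"
        then show "f \<tau> = 0" using z vanish[OF f] by blast
      qed simp
    qed
    also have "\<dots> \<le> (2 ^ q * ((m + 1) * n ^ m) * (card E ^ m * d ^ n)) * card Basis"
      by (intro mult_right_mono card_\<Theta>[OF n]) simp
    finally show ?thesis by (simp add: algebra_simps)
  qed
  then show ?thesis by blast
qed

end

section \<open>Alternating functions and multiplication by traces\<close>

lemma list_product_concat_triples:
  "list_product (concat (map (\<lambda>k. [a k, b k, c k]) ks)) = list_product (map (\<lambda>k. a k * b k * c k) ks)"
proof (induction ks)
  case (Cons k ks)
  show ?case
  proof (cases "ks = []")
    case False
    then have ne: "concat (map (\<lambda>k. [a k, b k, c k]) ks) \<noteq> []" "map (\<lambda>k. a k * b k * c k) ks \<noteq> []"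
      by (auto simp: neq_Nil_conv)
    have "list_product (concat (map (\<lambda>k. [a k, b k, c k]) (k # ks))) =
        list_product ([a k, b k, c k] @ concat (map (\<lambda>k. [a k, b k, c k]) ks))" by simp
    also have "\<dots> = a k * b k * c k * list_product (map (\<lambda>k. a k * b k * c k) ks)"
      using list_product_append[OF _ ne(1), of "[a k, b k, c k]"] Cons by (simp add: mult.assoc)
    also have "\<dots> = list_product (map (\<lambda>k. a k * b k * c k) (k # ks))"
      using list_product_Cons[OF ne(2)] by simp
    finally show ?thesis .
  qed (simp add: mult.assoc)
qed simp

context fd_action
begin

definition alternating :: "nat set \<Rightarrow> ((nat \<Rightarrow> 'a) \<Rightarrow> 'a) \<Rightarrow> bool" where
  "alternating X f \<longleftrightarrow>
     (\<forall>i\<in>X. \<forall>j\<in>X. i \<noteq> j \<longrightarrow> (\<forall>\<psi>. f (\<psi> \<circ> transpose i j) = - f \<psi>))"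

lemma alternating_eq_0:
  assumes "alternating X f" "i \<in> X" "j \<in> X" "i \<noteq> j" "\<psi> i = \<psi> j"
  shows "f \<psi> = 0"
proof -
  have "\<psi> \<circ> transpose i j = \<psi>"
    using assms(5) by (auto simp: fun_eq_iff transpose_def)
  then have "f \<psi> = - f \<psi>" using assms unfolding alternating_def by metis
  then have "f \<psi> + f \<psi> = 0" by (metis add.right_inverse)
  then have "scaleA 2 (f \<psi>) = 0"
    using A.scale_left_distrib[of 1 1 "f \<psi>"] by simp
  then show ?thesis by simp
qed

definition alternation :: "nat set \<Rightarrow> ((nat \<Rightarrow> 'a) \<Rightarrow> 'a) \<Rightarrow> (nat \<Rightarrow> 'a) \<Rightarrow> 'a" where
  "alternation X g = (\<lambda>\<psi>. \<Sum>\<sigma> | \<sigma> permutes X. scaleA (of_int (sign \<sigma>)) (g (\<psi> \<circ> \<sigma>)))"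

lemma alternation_multilin:
  assumes "g \<in> multilin I" "X \<subseteq> I"
  shows "alternation X g \<in> multilin I"
  unfolding alternation_def
proof (rule multilin_sum_closed)
  fix \<sigma> assume "\<sigma> \<in> {\<sigma>. \<sigma> permutes X}"
  then have "\<sigma> permutes I" using assms(2) by (auto intro: permutes_subset)
  then show "(\<lambda>\<psi>. scaleA (of_int (sign \<sigma>)) (g (\<psi> \<circ> \<sigma>))) \<in> multilin I"
    using assms(1) by (intro multilin_scale_closed multilin_permute)
qed

lemma alternating_alternation:
  assumes X: "finite X"
  shows "alternating X (alternation X g)"
  unfolding alternating_def
proof (intro ballI allI impI)
  fix i j and \<psi> :: "nat \<Rightarrow> 'a" assume ij: "i \<in> X" "j \<in> X" "i \<noteq> j"
  let ?\<tau> = "transpose i j"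
  have \<tau>: "?\<tau> permutes X" using ij by (simp add: permutes_swap_id)
  have "alternation X g (\<psi> \<circ> ?\<tau>) = (\<Sum>\<sigma> | \<sigma> permutes X. scaleA (of_int (sign \<sigma>)) (g (\<psi> \<circ> (?\<tau> \<circ> \<sigma>))))"
    by (simp add: alternation_def comp_assoc)
  also have "\<dots> = (\<Sum>\<sigma> | \<sigma> permutes X. scaleA (of_int (- sign (?\<tau> \<circ> \<sigma>))) (g (\<psi> \<circ> (?\<tau> \<circ> \<sigma>))))"
  proof (intro sum.cong refl)
    fix \<sigma> assume "\<sigma> \<in> {\<sigma>. \<sigma> permutes X}"
    then have "permutation \<sigma>" using X permutation_permutes by auto
    then have "sign (?\<tau> \<circ> \<sigma>) = - sign \<sigma>"
      using sign_compose[of ?\<tau> \<sigma>] ij(3) by (simp add: permutation_swap_id sign_swap_id)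
    then show "scaleA (of_int (sign \<sigma>)) (g (\<psi> \<circ> (?\<tau> \<circ> \<sigma>))) = scaleA (of_int (- sign (?\<tau> \<circ> \<sigma>))) (g (\<psi> \<circ> (?\<tau> \<circ> \<sigma>)))"
      by simp
  qed
  also have "\<dots> = (\<Sum>\<sigma> | \<sigma> permutes X. scaleA (of_int (- sign \<sigma>)) (g (\<psi> \<circ> \<sigma>)))"
    by (rule setum_permutations_compose_left[OF \<tau>, symmetric])
  also have "\<dots> = - alternation X g \<psi>"
    by (simp add: alternation_def sum_negf)
  finally show "alternation X g (\<psi> \<circ> ?\<tau>) = - alternation X g \<psi>" .
qed

context
  fixes X :: "nat set" and e :: "nat \<Rightarrow> 'a" and E :: "'a set"
  assumes finX: "finite X" and e: "bij_betw e X E" and E: "A.independent E"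
    and V: "subalgebra scaleA (A.span E)"
begin

text \<open>
  The function \<open>f'\<close> is the sum over \<open>i\<close> of \<open>f\<close> with \<open>x\<^sub>i\<close> replaced by \<open>y x\<^sub>i\<close>. At the basis
  \<open>e\<close>, expand \<open>y e\<^sub>i\<close>: a term with \<open>e\<^sub>k\<close> in place of \<open>e\<^sub>i\<close>, where \<open>k \<noteq> i\<close>, has two equal
  arguments and vanishes, and the coefficient of \<open>e\<^sub>i\<close> contributes to the trace.
\<close>

lemma multiply_by_trace:
  assumes f: "f \<in> multilin I" "alternating X f" and XI: "X \<subseteq> I" and y: "y \<notin> I"
  obtains f' where "f' \<in> multilin (insert y I)" "alternating X f'"
    "\<And>\<psi>. (\<And>k. k \<in> X \<Longrightarrow> \<psi> k = e k) \<Longrightarrow> \<psi> y \<in> A.span E \<Longrightarrow>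
       f' \<psi> = scaleA (A.mult_trace E (\<psi> y)) (f \<psi>)"
proof -
  define f' where "f' \<psi> = (\<Sum>i\<in>X. f (\<psi>(i := \<psi> y * \<psi> i)))" for \<psi>
  have yX: "y \<notin> X" using XI y by blast
  have "(\<lambda>\<psi>. \<Sum>i\<in>X. f (\<psi>(i := \<psi> y * \<psi> i))) \<in> multilin (insert y I)"
    using XI y by (intro multilin_sum_closed multilin_substitute_product f(1)) auto
  then have m: "f' \<in> multilin (insert y I)" by (simp add: f'_def[abs_def])
  have "alternating X f'"
    unfolding alternating_def
  proof (intro ballI allI impI)
    fix i j and \<psi> :: "nat \<Rightarrow> 'a" assume ij: "i \<in> X" "j \<in> X" "i \<noteq> j"
    let ?\<tau> = "transpose i j"
    have y\<tau>: "(\<psi> \<circ> ?\<tau>) y = \<psi> y" using ij yX by (auto simp: transpose_def)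
    have upd: "(\<psi> \<circ> ?\<tau>)(k := z) = \<psi>(?\<tau> k := z) \<circ> ?\<tau>" for k z
      by (auto simp: fun_eq_iff transpose_def)
    have "f' (\<psi> \<circ> ?\<tau>) = (\<Sum>k\<in>X. f (\<psi>(?\<tau> k := \<psi> y * \<psi> (?\<tau> k)) \<circ> ?\<tau>))"
      unfolding f'_def upd y\<tau> by simp
    also have "\<dots> = (\<Sum>k\<in>X. - f (\<psi>(?\<tau> k := \<psi> y * \<psi> (?\<tau> k))))"
      using f(2) ij unfolding alternating_def by simp
    also have "\<dots> = (\<Sum>k\<in>X. - f (\<psi>(k := \<psi> y * \<psi> k)))"
      by (rule sum.reindex_bij_betw) (use ij in \<open>simp add: permutes_imp_bij permutes_swap_id\<close>)
    finally show "f' (\<psi> \<circ> ?\<tau>) = - f' \<psi>" by (simp add: f'_def sum_negf)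
  qed
  moreover have "f' \<psi> = scaleA (A.mult_trace E (\<psi> y)) (f \<psi>)"
    if basis: "\<And>k. k \<in> X \<Longrightarrow> \<psi> k = e k" and yV: "\<psi> y \<in> A.span E" for \<psi>
  proof -
    have eE: "e k \<in> E" if "k \<in> X" for k using e that by (auto simp: bij_betw_def)
    have finE: "finite E" using e finX bij_betw_finite by blast
    have one: "f (\<psi>(i := \<psi> y * \<psi> i)) = scaleA (A.representation E (\<psi> y * e i) (e i)) (f \<psi>)"
      if i: "i \<in> X" for i
    proof -
      let ?c = "\<lambda>k. A.representation E (\<psi> y * e i) (e k)"
      have "\<psi> y * e i \<in> A.span E"
        using V yV A.span_base[OF eE[OF i]] by (simp add: subalgebra_def)
      then have "\<psi> y * e i = (\<Sum>b\<in>E. scaleA (A.representation E (\<psi> y * e i) b) b)"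
        using E finE by (intro A.sum_representation_eq[symmetric]) auto
      also have "\<dots> = (\<Sum>k\<in>X. scaleA (?c k) (e k))"
        by (rule sum.reindex_bij_betw[OF e, symmetric])
      finally have exp: "\<psi> y * \<psi> i = (\<Sum>k\<in>X. scaleA (?c k) (e k))" using basis[OF i] by simp
      have "f (\<psi>(i := \<psi> y * \<psi> i)) = (\<Sum>k\<in>X. scaleA (?c k) (f (\<psi>(i := e k))))"
        unfolding exp using i XI by (intro multilin_update_sum[OF f(1) _ finX]) auto
      also have "\<dots> = (\<Sum>k\<in>X. if k = i then scaleA (?c i) (f \<psi>) else 0)"
      proof (intro sum.cong refl)
        fix k assume k: "k \<in> X"
        show "scaleA (?c k) (f (\<psi>(i := e k))) = (if k = i then scaleA (?c i) (f \<psi>) else 0)"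
        proof (cases "k = i")
          case True
          have "\<psi>(i := e i) = \<psi>" using basis[OF i] by auto
          then show ?thesis using True by simp
        next
          case False
          have "f (\<psi>(i := e k)) = 0"
            by (rule alternating_eq_0[OF f(2) i k]) (use False basis[OF k] in auto)
          then show ?thesis using False by simp
        qed
      qed
      also have "\<dots> = scaleA (?c i) (f \<psi>)" using finX i by simp
      finally show ?thesis .
    qed
    have "f' \<psi> = (\<Sum>i\<in>X. scaleA (A.representation E (\<psi> y * e i) (e i)) (f \<psi>))"
      unfolding f'_def by (intro sum.cong refl one)
    also have "\<dots> = scaleA (\<Sum>i\<in>X. A.representation E (\<psi> y * e i) (e i)) (f \<psi>)"
      by (rule A.scale_sum_left[symmetric])
    also have "(\<Sum>i\<in>X. A.representation E (\<psi> y * e i) (e i)) = A.mult_trace E (\<psi> y)"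
      unfolding A.mult_trace_def by (rule sum.reindex_bij_betw[OF e])
    finally show ?thesis .
  qed
  ultimately show thesis using that m by blast
qed

text \<open>
  Substitute \<open>z y\<close> for \<open>y\<close> in the function obtained from \<open>multiply_by_trace\<close>.
\<close>

lemma multiply_by_trace_form:
  assumes f: "f \<in> multilin I" "alternating X f" and XI: "X \<subseteq> I" and y: "y \<notin> I" "z \<notin> I" "y \<noteq> z"
  obtains f' where "f' \<in> multilin (insert z (insert y I))" "alternating X f'"
    "\<And>\<psi>. (\<And>k. k \<in> X \<Longrightarrow> \<psi> k = e k) \<Longrightarrow> \<psi> y \<in> A.span E \<Longrightarrow> \<psi> z \<in> A.span E \<Longrightarrow>
       f' \<psi> = scaleA (A.mult_trace E (\<psi> z * \<psi> y)) (f \<psi>)"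
proof -
  obtain g where g: "g \<in> multilin (insert y I)" "alternating X g"
    and val: "\<And>\<psi>. (\<And>k. k \<in> X \<Longrightarrow> \<psi> k = e k) \<Longrightarrow> \<psi> y \<in> A.span E \<Longrightarrow>
       g \<psi> = scaleA (A.mult_trace E (\<psi> y)) (f \<psi>)"
    using multiply_by_trace[OF f XI y(1)] by metis
  have yX: "y \<notin> X" "z \<notin> X" using XI y by auto
  define f' where "f' \<psi> = g (\<psi>(y := \<psi> z * \<psi> y))" for \<psi>
  have "(\<lambda>\<psi>. g (\<psi>(y := \<psi> z * \<psi> y))) \<in> multilin (insert z (insert y I))"
    using y by (intro multilin_substitute_product[OF g(1)]) auto
  then have m: "f' \<in> multilin (insert z (insert y I))" by (simp add: f'_def[abs_def])
  have "alternating X f'"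
    unfolding alternating_def
  proof (intro ballI allI impI)
    fix i j and \<psi> :: "nat \<Rightarrow> 'a" assume ij: "i \<in> X" "j \<in> X" "i \<noteq> j"
    let ?\<tau> = "transpose i j"
    have "(\<psi> \<circ> ?\<tau>) y = \<psi> y" "(\<psi> \<circ> ?\<tau>) z = \<psi> z" using ij yX by (auto simp: transpose_def)
    moreover have "(\<psi> \<circ> ?\<tau>)(y := u) = \<psi>(y := u) \<circ> ?\<tau>" for u
      using ij yX by (auto simp: fun_eq_iff transpose_def)
    ultimately have "f' (\<psi> \<circ> ?\<tau>) = g (\<psi>(y := \<psi> z * \<psi> y) \<circ> ?\<tau>)" by (simp only: f'_def)
    also have "\<dots> = - g (\<psi>(y := \<psi> z * \<psi> y))" using g(2) ij unfolding alternating_def by blast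
    finally show "f' (\<psi> \<circ> ?\<tau>) = - f' \<psi>" by (simp only: f'_def)
  qed
  moreover have "f' \<psi> = scaleA (A.mult_trace E (\<psi> z * \<psi> y)) (f \<psi>)"
    if basis: "\<And>k. k \<in> X \<Longrightarrow> \<psi> k = e k" and V': "\<psi> y \<in> A.span E" "\<psi> z \<in> A.span E" for \<psi>
  proof -
    let ?\<psi> = "\<psi>(y := \<psi> z * \<psi> y)"
    have "\<psi> z * \<psi> y \<in> A.span E" using V V' by (simp add: subalgebra_def)
    then have "g ?\<psi> = scaleA (A.mult_trace E (?\<psi> y)) (f ?\<psi>)"
      using basis yX by (intro val) auto
    moreover have "f ?\<psi> = f \<psi>" by (rule multilin_cong[OF f(1)]) (use y in auto)
    ultimately show ?thesis by (simp add: f'_def)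
  qed
  ultimately show thesis using that m by blast
qed

lemma multiply_by_trace_forms:
  assumes f: "f \<in> multilin I" "alternating X f" and XI: "X \<subseteq> I" and K: "finite K"
    and inj: "inj_on yy K" "inj_on zz K"
    and disj: "yy ` K \<inter> I = {}" "zz ` K \<inter> I = {}" "yy ` K \<inter> zz ` K = {}"
  shows "\<exists>f'. f' \<in> multilin (I \<union> yy ` K \<union> zz ` K) \<and> alternating X f' \<and>
    (\<forall>\<psi>. (\<forall>k\<in>X. \<psi> k = e k) \<longrightarrow> (\<forall>k\<in>K. \<psi> (yy k) \<in> A.span E \<and> \<psi> (zz k) \<in> A.span E) \<longrightarrow>
       f' \<psi> = scaleA (\<Prod>k\<in>K. A.mult_trace E (\<psi> (zz k) * \<psi> (yy k))) (f \<psi>))"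
  using K inj disj
proof (induction K rule: finite_induct)
  case empty
  then show ?case using f by auto
next
  case (insert k K)
  let ?I = "I \<union> yy ` K \<union> zz ` K"
  obtain g where g: "g \<in> multilin ?I" "alternating X g"
    and val: "\<And>\<psi>. (\<forall>k\<in>X. \<psi> k = e k) \<Longrightarrow> (\<forall>k\<in>K. \<psi> (yy k) \<in> A.span E \<and> \<psi> (zz k) \<in> A.span E) \<Longrightarrow>
       g \<psi> = scaleA (\<Prod>k\<in>K. A.mult_trace E (\<psi> (zz k) * \<psi> (yy k))) (f \<psi>)"
    using insert.IH insert.prems by auto
  have new: "yy k \<notin> ?I" "zz k \<notin> ?I" "yy k \<noteq> zz k"
    using insert.prems insert.hyps by (auto simp: inj_on_def)
  have "X \<subseteq> ?I" using XI by auto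
  from multiply_by_trace_form[OF g this new]
  obtain f' where f': "f' \<in> multilin (insert (zz k) (insert (yy k) ?I))" "alternating X f'"
    and val': "\<And>\<psi>. (\<And>k. k \<in> X \<Longrightarrow> \<psi> k = e k) \<Longrightarrow> \<psi> (yy k) \<in> A.span E \<Longrightarrow> \<psi> (zz k) \<in> A.span E \<Longrightarrow>
       f' \<psi> = scaleA (A.mult_trace E (\<psi> (zz k) * \<psi> (yy k))) (g \<psi>)"
    by metis
  have "insert (zz k) (insert (yy k) ?I) = I \<union> yy ` insert k K \<union> zz ` insert k K" by auto
  then have "f' \<in> multilin (I \<union> yy ` insert k K \<union> zz ` insert k K)" using f'(1) by simp
  moreover have "f' \<psi> = scaleA (\<Prod>k\<in>insert k K. A.mult_trace E (\<psi> (zz k) * \<psi> (yy k))) (f \<psi>)"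
    if "\<forall>k\<in>X. \<psi> k = e k" "\<forall>k\<in>insert k K. \<psi> (yy k) \<in> A.span E \<and> \<psi> (zz k) \<in> A.span E" for \<psi>
    using val'[of \<psi>] val[of \<psi>] that insert.hyps by simp
  ultimately show ?case using f'(2) by (intro exI[of _ f']) simp
qed

end

end

section \<open>An alternating function that does not vanish on a basis\<close>

context fd_action
begin

lemma sandwich_nonzero_basic:
  assumes T: "T \<in> sandwich UNIV" "\<Phi> T \<noteq> (0::'a)"
    and zero: "\<Phi> (\<lambda>x. 0) = 0"
    and add: "\<And>S T. \<Phi> (\<lambda>x. S x + T x) = \<Phi> S + \<Phi> T"
  shows "\<exists>p h s. \<Phi> (\<lambda>x. p * act h x * s) \<noteq> 0"
  using T
proof (induction rule: sandwich.induct)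
  case sandwich_zero
  then show ?case using zero by simp
next
  case (sandwich_add S T)
  then have "\<Phi> S \<noteq> 0 \<or> \<Phi> T \<noteq> 0" using add[of S T] by auto
  then show ?case using sandwich_add.IH by blast
next
  case (sandwich_basic p s h)
  then show ?case by blast
qed

text \<open>
  The alternating sum over the permutations of the arguments \<open>e\<close>, for arbitrary operators \<open>T\<close>.
  It is additive in each operator, which allows operators that are sums to be replaced by
  single summands.
\<close>

definition alternating_product :: "nat \<Rightarrow> (nat \<Rightarrow> 'a) \<Rightarrow> (nat \<Rightarrow> 'a \<Rightarrow> 'a) \<Rightarrow> 'a" where
  "alternating_product n e T = (\<Sum>\<sigma> | \<sigma> permutes {1..n}.
     scaleA (of_int (sign \<sigma>)) (list_product (map (\<lambda>k. T k (e (\<sigma> k))) [1..<Suc n])))"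

lemma alternating_product_cong:
  "(\<And>k. k \<in> {1..n} \<Longrightarrow> T k = T' k) \<Longrightarrow> alternating_product n e T = alternating_product n e T'"
  unfolding alternating_product_def
  by (intro sum.cong refl arg_cong2[of _ _ _ _ scaleA] arg_cong[of _ _ list_product] map_cong) auto

lemma alternating_product_update_zero:
  assumes "i \<in> {1..n}"
  shows "alternating_product n e (T(i := \<lambda>x. 0)) = 0"
  unfolding alternating_product_def
proof (intro sum.neutral ballI)
  fix \<sigma>
  have "0 \<in> set (map (\<lambda>k. (T(i := \<lambda>x. 0)) k (e (\<sigma> k))) [1..<Suc n])"
    using assms by (force simp del: upt_Suc)
  then show "scaleA (of_int (sign \<sigma>)) (list_product (map (\<lambda>k. (T(i := \<lambda>x. 0)) k (e (\<sigma> k))) [1..<Suc n])) = 0"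
    by (simp only: list_product_zero A.scale_zero_right)
qed

lemma alternating_product_update_add:
  assumes i: "i \<in> {1..n}"
  shows "alternating_product n e (T(i := \<lambda>x. R x + S x)) =
    alternating_product n e (T(i := R)) + alternating_product n e (T(i := S))"
  unfolding alternating_product_def sum.distrib[symmetric]
proof (intro sum.cong refl)
  fix \<sigma>
  let ?g = "\<lambda>k. T k (e (\<sigma> k))"
  have upd: "(\<lambda>k. (T(i := S)) k (e (\<sigma> k))) = ?g(i := S (e (\<sigma> i)))" for S
    by (auto simp: fun_eq_iff)
  have "list_product (map (?g(i := R (e (\<sigma> i)) + S (e (\<sigma> i)))) [1..<Suc n]) =
    list_product (map (?g(i := R (e (\<sigma> i)))) [1..<Suc n]) + list_product (map (?g(i := S (e (\<sigma> i)))) [1..<Suc n])"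
    by (rule A.list_product_update(1)) (use i in \<open>auto simp del: upt_Suc\<close>)
  then show "scaleA (of_int (sign \<sigma>)) (list_product (map (\<lambda>k. (T(i := \<lambda>x. R x + S x)) k (e (\<sigma> k))) [1..<Suc n])) =
    scaleA (of_int (sign \<sigma>)) (list_product (map (\<lambda>k. (T(i := R)) k (e (\<sigma> k))) [1..<Suc n])) +
    scaleA (of_int (sign \<sigma>)) (list_product (map (\<lambda>k. (T(i := S)) k (e (\<sigma> k))) [1..<Suc n]))"
    unfolding upd by (simp only: A.scale_right_distrib)
qed

lemma alternating_product_basic:
  assumes T: "\<And>k. k \<in> {1..n} \<Longrightarrow> T k \<in> sandwich UNIV" and nz: "alternating_product n e T \<noteq> 0"
  shows "\<exists>p h s. alternating_product n e (\<lambda>k x. p k * act (h k) x * s k) \<noteq> 0"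
proof -
  have "\<exists>T. (\<forall>k\<in>{1..j}. \<exists>p h s. T k = (\<lambda>x. p * act h x * s)) \<and> (\<forall>k\<in>{1..n}. T k \<in> sandwich UNIV) \<and>
      alternating_product n e T \<noteq> 0" if "j \<le> n" for j
    using that
  proof (induction j)
    case 0
    then show ?case using T nz by (intro exI[of _ T]) auto
  next
    case (Suc j)
    then obtain T where T: "\<forall>k\<in>{1..j}. \<exists>p h s. T k = (\<lambda>x. p * act h x * s)"
      "\<forall>k\<in>{1..n}. T k \<in> sandwich UNIV" "alternating_product n e T \<noteq> 0" by auto
    have j: "Suc j \<in> {1..n}" using Suc by simp
    let ?\<Phi> = "\<lambda>S. alternating_product n e (T(Suc j := S))"
    have "?\<Phi> (T (Suc j)) \<noteq> 0" using T(3) by simp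
    then have "\<exists>p h s. ?\<Phi> (\<lambda>x. p * act h x * s) \<noteq> 0"
      using T(2) j alternating_product_update_zero[OF j] alternating_product_update_add[OF j]
      by (intro sandwich_nonzero_basic[of "T (Suc j)" ?\<Phi>]) auto
    then obtain p h s where phs: "?\<Phi> (\<lambda>x. p * act h x * s) \<noteq> 0" by blast
    \<comment> \<open>By additivity, the \<open>(j + 1)\<close>st operator may be replaced by one of its summands.\<close>
    define T' where "T' = T(Suc j := \<lambda>x. p * act h x * s)"
    have "\<exists>p h s. T' k = (\<lambda>x. p * act h x * s)" if "k \<in> {1..Suc j}" for k
      using T(1) that by (cases "k = Suc j") (auto simp: T'_def)
    moreover have "T' k \<in> sandwich UNIV" if "k \<in> {1..n}" for k
      using T(2) that sandwich_basic[of p UNIV s h] by (auto simp: T'_def)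
    moreover have "alternating_product n e T' \<noteq> 0" using phs unfolding T'_def .
    ultimately show ?case by (intro exI[of _ T']) simp
  qed
  from this[of n] obtain T where T: "\<forall>k\<in>{1..n}. \<exists>p h s. T k = (\<lambda>x. p * act h x * s)"
    "alternating_product n e T \<noteq> 0" by auto
  from T(1) obtain p h s where "\<forall>k\<in>{1..n}. T k = (\<lambda>x. p k * act (h k) x * s k)" by metis
  then have "alternating_product n e T = alternating_product n e (\<lambda>k x. p k * act (h k) x * s k)"
    by (intro alternating_product_cong) simp
  then show ?thesis using T(2) by auto
qed

lemma alternating_product_diagonal:
  assumes e: "inj_on e {1..n}"
    and T: "\<And>k j. k \<in> {1..n} \<Longrightarrow> j \<in> {1..n} \<Longrightarrow> j \<noteq> k \<Longrightarrow> T k (e j) = 0"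
  shows "alternating_product n e T = list_product (map (\<lambda>k. T k (e k)) [1..<Suc n])"
proof -
  let ?t = "\<lambda>\<sigma>. scaleA (of_int (sign \<sigma>)) (list_product (map (\<lambda>k. T k (e (\<sigma> k))) [1..<Suc n]))"
  have "(\<Sum>\<sigma> | \<sigma> permutes {1..n}. ?t \<sigma>) = (\<Sum>\<sigma>\<in>{id}. ?t \<sigma>)"
  proof (rule sum.mono_neutral_right)
    show "finite {\<sigma>. \<sigma> permutes {1..n}}" by (simp add: finite_permutations)
    show "{id} \<subseteq> {\<sigma>. \<sigma> permutes {1..n}}" by (simp add: permutes_id)
    show "\<forall>\<sigma>\<in>{\<sigma>. \<sigma> permutes {1..n}} - {id}. ?t \<sigma> = 0"
    proof
      fix \<sigma> assume \<sigma>: "\<sigma> \<in> {\<sigma>. \<sigma> permutes {1..n}} - {id}"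
      then have p: "\<sigma> permutes {1..n}" and "\<sigma> \<noteq> id" by auto
      then obtain k where k: "\<sigma> k \<noteq> k" by (auto simp: fun_eq_iff)
      then have kn: "k \<in> {1..n}" using p permutes_not_in by metis
      then have "\<sigma> k \<in> {1..n}" using permutes_in_image[OF p] by blast
      then have z: "T k (e (\<sigma> k)) = 0" using T kn k by blast
      have "T k (e (\<sigma> k)) \<in> set (map (\<lambda>k. T k (e (\<sigma> k))) [1..<Suc n])"
        unfolding set_map using kn by (intro imageI) (simp del: upt_Suc)
      then have "0 \<in> set (map (\<lambda>k. T k (e (\<sigma> k))) [1..<Suc n])" unfolding z .
      then show "?t \<sigma> = 0" by (simp only: list_product_zero A.scale_zero_right)
    qed
  qed
  then show ?thesis unfolding alternating_product_def by (simp del: upt_Suc)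
qed

text \<open>
  The word \<open>z\<^sub>1 x\<^sub>1\<^sup>h z'\<^sub>1 z\<^sub>2 x\<^sub>2\<^sup>h z'\<^sub>2 \<dots>\<close>, alternated in the \<open>x\<^sub>k\<close>. The variables \<open>x\<^sub>k\<close>,
  \<open>z\<^sub>k\<close> and \<open>z'\<^sub>k\<close> have the indices \<open>k\<close>, \<open>n + k\<close> and \<open>2 n + k\<close>.
\<close>

lemma alternating_multilin_of_product:
  assumes nz: "alternating_product n e (\<lambda>k x. p k * act (h k) x * s k) \<noteq> 0"
  shows "\<exists>f \<psi>. f \<in> multilin {1..3 * n} \<and> alternating {1..n} f \<and> (\<forall>k\<in>{1..n}. \<psi> k = e k) \<and> f \<psi> \<noteq> 0"
proof -
  define w where "w = concat (map (\<lambda>k. [(n + k, 1), (k, h k), (2 * n + k, 1)]) [1..<Suc n])"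
  define \<psi> where "\<psi> i = (if i \<le> n then e i else if i \<le> 2 * n then p (i - n) else s (i - 2 * n))" for i
  have w: "w \<in> words_over {1..3 * n}"
  proof -
    have fst_w: "map fst w = concat (map (\<lambda>k. [n + k, k, 2 * n + k]) [1..<Suc n])"
      unfolding w_def map_concat map_map o_def by simp
    have "set (map fst w) = (\<Union>k\<in>{1..n}. {n + k, k, 2 * n + k})"
      unfolding fst_w by (simp add: atLeastLessThanSuc_atLeastAtMost del: upt_Suc)
    also have "\<dots> = {1..3 * n}"
    proof (rule set_eqI)
      fix i
      have "i \<in> (\<Union>k\<in>{1..n}. {n + k, k, 2 * n + k})" if i: "i \<in> {1..3 * n}"
      proof -
        consider "i \<le> n" | "n < i" "i \<le> 2 * n" | "2 * n < i" by linarith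
        then show ?thesis
        proof cases
          case 1
          then show ?thesis using i by auto
        next
          case 2
          then show ?thesis using i by (intro UN_I[of "i - n"]) auto
        next
          case 3
          then show ?thesis using i by (intro UN_I[of "i - 2 * n"]) auto
        qed
      qed
      then show "i \<in> (\<Union>k\<in>{1..n}. {n + k, k, 2 * n + k}) \<longleftrightarrow> i \<in> {1..3 * n}" by auto
    qed
    finally have set: "set (map fst w) = {1..3 * n}" .
    have "length (map fst w) = 3 * n"
      unfolding fst_w by (simp add: length_concat o_def sum_list_triv del: upt_Suc)
    then have "distinct (map fst w)" using set by (intro card_distinct) simp
    then show ?thesis using set by (simp add: words_over_def)
  qed
  have val: "word_fun w (\<psi> \<circ> \<sigma>) = list_product (map (\<lambda>k. p k * act (h k) (e (\<sigma> k)) * s k) [1..<Suc n])"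
    if \<sigma>: "\<sigma> permutes {1..n}" for \<sigma>
  proof -
    have "map (\<lambda>(i, h). act h ((\<psi> \<circ> \<sigma>) i)) w =
        concat (map (\<lambda>k. [act 1 (\<psi> (\<sigma> (n + k))), act (h k) (\<psi> (\<sigma> k)), act 1 (\<psi> (\<sigma> (2 * n + k)))]) [1..<Suc n])"
      unfolding w_def map_concat map_map o_def by simp
    also have "\<dots> = concat (map (\<lambda>k. [p k, act (h k) (e (\<sigma> k)), s k]) [1..<Suc n])"
    proof (rule arg_cong[of _ _ concat], rule map_cong[OF refl])
      fix k assume "k \<in> set [1..<Suc n]"
      then have k: "k \<in> {1..n}" by (simp only: set_upt atLeastLessThanSuc_atLeastAtMost)
      then have "\<sigma> k \<in> {1..n}" using permutes_in_image[OF \<sigma>] by blast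
      moreover have "\<sigma> (n + k) = n + k" "\<sigma> (2 * n + k) = 2 * n + k"
        using k by (auto intro!: permutes_not_in[OF \<sigma>])
      ultimately show "[act 1 (\<psi> (\<sigma> (n + k))), act (h k) (\<psi> (\<sigma> k)), act 1 (\<psi> (\<sigma> (2 * n + k)))] =
          [p k, act (h k) (e (\<sigma> k)), s k]"
        using k by (simp add: \<psi>_def act_one)
    qed
    finally show ?thesis
      unfolding word_fun_def eval_word_def by (simp only: list_product_concat_triples)
  qed
  have "alternation {1..n} (word_fun w) \<psi> = alternating_product n e (\<lambda>k x. p k * act (h k) x * s k)"
    unfolding alternation_def alternating_product_def by (intro sum.cong refl) (simp only: val mem_Collect_eq)
  moreover have "alternation {1..n} (word_fun w) \<in> multilin {1..3 * n}"
    by (rule alternation_multilin[OF word_fun_multilin[OF w]]) auto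
  moreover have "alternating {1..n} (alternation {1..n} (word_fun w))"
    by (rule alternating_alternation) simp
  ultimately show ?thesis
    using nz by (intro exI[of _ "alternation {1..n} (word_fun w)"] exI[of _ \<psi>]) (simp add: \<psi>_def)
qed

text \<open>
  A nonzero product of \<open>n\<close> elements shows that \<open>x\<^sub>1 \<dots> x\<^sub>n\<close> is not an identity.
\<close>

lemma H_codim_pos:
  assumes nn: "\<not> nilpotent_algebra (UNIV :: 'a set)" and n: "n \<ge> 1"
  shows "H_codim scaleH scaleA act n \<ge> 1"
proof -
  obtain xs :: "'a list" where xs: "length xs = n" "list_product xs \<noteq> 0"
    using nn n unfolding nilpotent_algebra_def by auto
  define w where "w = map (\<lambda>i. (i, 1::'h)) [1..<Suc n]"
  have fst_w: "map fst w = [1..<Suc n]" unfolding w_def by (simp add: o_def del: upt_Suc)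
  have w: "w \<in> words_over {1..n}"
    unfolding words_over_def mem_Collect_eq fst_w by (simp only: set_upt distinct_upt atLeastLessThanSuc_atLeastAtMost)
  have "map (\<lambda>(i, h). act h (xs ! (i - 1))) w = xs"
    unfolding w_def using xs(1) by (intro nth_equalityI) (simp_all add: act_one del: upt_Suc)
  then have val: "word_fun w (\<lambda>i. xs ! (i - 1)) \<noteq> 0"
    using xs(2) by (simp add: word_fun_def eval_word_def)
  have "card {()} \<le> H_codim scaleH scaleA act n"
  proof (rule H_codim_ge[OF n, of "{()}" "\<lambda>_. word_fun w"])
    fix c :: "unit \<Rightarrow> 'f" assume "\<And>\<psi>. (\<Sum>s\<in>{()}. scaleA (c s) (word_fun w \<psi>)) = 0"
    from this[of "\<lambda>i. xs ! (i - 1)"] show "\<forall>s\<in>{()}. c s = 0" using val by simp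
  qed (use word_fun_multilin[OF w] in simp_all)
  then show ?thesis by simp
qed

end

section \<open>The lower bound\<close>

context wedderburn_action
begin

lemma basis_union_mult:
  assumes I: "I \<subseteq> {1..q}"
  shows "subalgebra scaleA (A.span (basis_union I))"
  unfolding subalgebra_def
proof (intro conjI ballI)
  fix x y assume "x \<in> A.span (basis_union I)" "y \<in> A.span (basis_union I)"
  then show "x * y \<in> A.span (basis_union I)"
  proof (rule span_mult_closed)
    fix x y assume "x \<in> basis_union I" "y \<in> basis_union I"
    then obtain i j where ij: "i \<in> I" "j \<in> I" "x \<in> Bs i" "y \<in> Bs j"
      using basis_of unfolding basis_union_def by blast
    show "x * y \<in> A.span (basis_union I)"
    proof (cases "i = j")
      case True
      have "x * y \<in> Bs i" using Bs_subalgebra[of i] ij True I by (auto simp: subalgebra_def)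
      also have "Bs i \<subseteq> A.span (basis_union I)"
        unfolding span_basis_union using ij(1) A.span_superset by blast
      finally show ?thesis .
    next
      case False
      have "x * y = 0" by (rule Bs_orth[of i j]) (use ij I False in auto)
      then show ?thesis by (simp add: A.span_zero)
    qed
  qed
qed simp

lemma basis_union_decompose:
  assumes I: "I \<subseteq> {1..q}" and v: "v \<in> A.span (basis_union I)"
  shows "\<exists>g. v = (\<Sum>i\<in>I. g i) \<and> (\<forall>i\<in>I. g i \<in> Bs i)"
proof -
  have finI: "finite I" using I finite_subset by blast
  have sub: "A.subspace (Bs i)" if "i \<in> I" for i using Bs_subspace that I by blast
  let ?S = "{v. \<exists>g. v = (\<Sum>i\<in>I. g i) \<and> (\<forall>i\<in>I. g i \<in> Bs i)}"
  have "A.span (basis_union I) \<subseteq> ?S"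
  proof (rule A.span_minimal)
    show "A.subspace ?S"
    proof (rule A.subspaceI)
      show "0 \<in> ?S" using A.subspace_0[OF sub] by (auto intro!: exI[of _ "\<lambda>_. 0"])
      show "x + y \<in> ?S" if "x \<in> ?S" "y \<in> ?S" for x y
      proof -
        from that obtain g g' where "x = (\<Sum>i\<in>I. g i)" "\<forall>i\<in>I. g i \<in> Bs i"
          "y = (\<Sum>i\<in>I. g' i)" "\<forall>i\<in>I. g' i \<in> Bs i" by auto
        then show ?thesis
          using A.subspace_add[OF sub] by (auto intro!: exI[of _ "\<lambda>i. g i + g' i"] simp: sum.distrib)
      qed
      show "scaleA c x \<in> ?S" if "x \<in> ?S" for c x
      proof -
        from that obtain g where "x = (\<Sum>i\<in>I. g i)" "\<forall>i\<in>I. g i \<in> Bs i" by auto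
        then show ?thesis
          using A.subspace_scale[OF sub] by (auto intro!: exI[of _ "\<lambda>i. scaleA c (g i)"] simp: A.scale_sum_right)
      qed
    qed
    show "basis_union I \<subseteq> ?S"
    proof
      fix x assume "x \<in> basis_union I"
      then obtain i where i: "i \<in> I" "x \<in> Bs i" using basis_of unfolding basis_union_def by blast
      have "x = (\<Sum>j\<in>I. if j = i then x else 0)" using finI i by simp
      moreover have "\<forall>j\<in>I. (if j = i then x else 0) \<in> Bs j" using i A.subspace_0[OF sub] by simp
      ultimately show "x \<in> ?S" by (intro CollectI exI[of _ "\<lambda>j. if j = i then x else 0"] conjI)
    qed
  qed
  then show ?thesis using v by blast
qed

lemma trace_form_nondegenerate:
  assumes I: "I \<subseteq> {1..q}" and v: "v \<in> A.span (basis_union I)"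
    and z: "\<And>u. u \<in> A.span (basis_union I) \<Longrightarrow> A.mult_trace (basis_union I) (u * v) = 0"
  shows "v = 0"
proof -
  obtain g where g: "v = (\<Sum>i\<in>I. g i)" "\<And>i. i \<in> I \<Longrightarrow> g i \<in> Bs i"
    using basis_union_decompose[OF I v] by blast
  show ?thesis
  proof (rule A.mult_trace_nondegenerate[OF independent_basis_union[OF I] basis_union_mult[OF I], of I Bs v g])
    show "finite I" using I finite_subset by blast
    show "Bs i \<subseteq> A.span (basis_union I)" if "i \<in> I" for i
      unfolding span_basis_union using that A.span_superset by blast
    show "subalgebra scaleA (Bs i)" "semisimple_algebra scaleA (Bs i)" if "i \<in> I" for i
      using that I Bs_subalgebra Bs_semisimple by auto
    show "x * y = 0" if "i \<in> I" "j \<in> I" "i \<noteq> j" "x \<in> Bs i" "y \<in> Bs j" for i j x y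
      by (rule Bs_orth[of i j]) (use that I in auto)
  qed (use g z in auto)
qed

text \<open>
  The functionals \<open>v \<mapsto> t (v e\<^sub>k)\<close> are independent because the trace form is nondegenerate.
\<close>

lemma trace_dual_basis:
  fixes e :: "nat \<Rightarrow> 'a"
  assumes I: "I \<subseteq> {1..q}" and e: "bij_betw e {1..n} (basis_union I)"
  obtains e' where "\<And>k. k \<in> {1..n} \<Longrightarrow> e' k \<in> A.span (basis_union I)"
    "\<And>j k. j \<in> {1..n} \<Longrightarrow> k \<in> {1..n} \<Longrightarrow>
       A.mult_trace (basis_union I) (e' k * e j) = (if j = k then 1 else 0)"
proof -
  let ?E = "basis_union I"
  note ind = independent_basis_union[OF I] and V = basis_union_mult[OF I]
  have e_span: "e k \<in> A.span ?E" if "k \<in> {1..n}" for k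
    using bij_betwE[OF e] that by (intro A.span_base) blast
  have mult: "u * w \<in> A.span ?E" if "u \<in> A.span ?E" "w \<in> A.span ?E" for u w
    using V that by (simp add: subalgebra_def)
  define \<xi> where "\<xi> k v = (if k \<in> {1..n} then A.mult_trace ?E (v * e k) else 0)" for k v
  have "\<exists>v. (\<forall>k\<in>{1..n}. v k \<in> A.span ?E) \<and> (\<forall>k\<in>{1..n}. \<forall>j\<in>{1..n}. \<xi> j (v k) = (if j = k then 1 else 0))"
  proof (rule A.dual_vectors)
    show "\<xi> k (x + y) = \<xi> k x + \<xi> k y" if "x \<in> A.span ?E" "y \<in> A.span ?E" for k x y
      using that e_span mult by (simp add: \<xi>_def distrib_right A.mult_trace_add[OF ind V])
    show "\<xi> k (scaleA c x) = c * \<xi> k x" if "x \<in> A.span ?E" for k c x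
      using that e_span mult by (simp add: \<xi>_def A.scale_mult_left[symmetric] A.mult_trace_scale[OF ind V])
  next
    fix c assume c: "\<forall>v\<in>A.span ?E. (\<Sum>k\<in>{1..n}. c k * \<xi> k v) = 0"
    let ?v = "\<Sum>k\<in>{1..n}. scaleA (c k) (e k)"
    have tr_sum: "A.mult_trace ?E (\<Sum>k\<in>K. g k) = (\<Sum>k\<in>K. A.mult_trace ?E (g k))"
      if "finite K" "\<And>k. k \<in> K \<Longrightarrow> g k \<in> A.span ?E" for g and K :: "nat set"
      using that
      by (induction K rule: finite_induct)
        (auto simp: A.mult_trace_add[OF ind V] A.span_sum A.mult_trace_scale[OF ind V, of 0 0, simplified] A.span_zero)
    have "?v = 0"
    proof (rule trace_form_nondegenerate[OF I])
      show "?v \<in> A.span ?E" using e_span by (intro A.span_sum A.span_scale)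
      fix u assume u: "u \<in> A.span ?E"
      have "A.mult_trace ?E (u * ?v) = A.mult_trace ?E (\<Sum>k\<in>{1..n}. scaleA (c k) (u * e k))"
        by (simp add: sum_distrib_left A.scale_mult_right)
      also have "\<dots> = (\<Sum>k\<in>{1..n}. A.mult_trace ?E (scaleA (c k) (u * e k)))"
        using u e_span mult by (intro tr_sum A.span_scale) auto
      also have "\<dots> = (\<Sum>k\<in>{1..n}. c k * \<xi> k u)"
        using u e_span mult by (intro sum.cong) (auto simp: A.mult_trace_scale[OF ind V] \<xi>_def)
      finally show "A.mult_trace ?E (u * ?v) = 0" using c u by simp
    qed
    have inj: "inj_on e {1..n}" and img: "e ` {1..n} = ?E" using e by (auto simp: bij_betw_def)
    define c' where "c' b = c (the_inv_into {1..n} e b)" for b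
    have c': "c' (e k) = c k" if "k \<in> {1..n}" for k
      using the_inv_into_f_f[OF inj that] by (simp add: c'_def)
    have "(\<Sum>b\<in>?E. scaleA (c' b) b) = ?v"
      unfolding img[symmetric] sum.reindex[OF inj] by (simp add: c')
    then have zero: "(\<Sum>b\<in>?E. scaleA (c' b) b) = 0" using \<open>?v = 0\<close> by simp
    show "\<forall>k\<in>{1..n}. c k = 0"
    proof
      fix k assume k: "k \<in> {1..n}"
      have "c' (e k) = 0"
        using A.independentD[OF ind finite_basis_union[OF I] subset_refl zero, of "e k"] k img by blast
      then show "c k = 0" using c'[OF k] by simp
    qed
  qed simp_all
  then obtain v where "\<And>k. k \<in> {1..n} \<Longrightarrow> v k \<in> A.span ?E"
    "\<And>j k. j \<in> {1..n} \<Longrightarrow> k \<in> {1..n} \<Longrightarrow> \<xi> j (v k) = (if j = k then 1 else 0)" by blast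
  then show thesis using that[of v] by (simp add: \<xi>_def)
qed

text \<open>
  The operators of \<open>interpolation_operators\<close> along a chain of dimension \<open>d\<close> have a nonzero
  product at the identity permutation of the basis, and all other permutations contribute \<open>0\<close>
  to the alternating sum.
\<close>

lemma alternating_start:
  obtains I e f \<psi> where "I \<subseteq> {1..q}" "bij_betw e {1..d} (basis_union I)"
    "f \<in> multilin {1..3 * d}" "alternating {1..d} f" "\<And>k. k \<in> {1..d} \<Longrightarrow> \<psi> k = e k" "f \<psi> \<noteq> 0"
proof -
  obtain "is" where "is": "is \<noteq> []" "distinct is" "set is \<subseteq> {1..q}" "radical_chain scaleA J Bs is \<noteq> {0}"
    "card (basis_union (set is)) = d" by (rule d_attained)
  define es where "es = concat (map basis_list is)"
  have set_es: "set es = basis_union (set is)"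
    by (simp add: es_def basis_list basis_union_def)
  have "distinct es"
    unfolding es_def
  proof (rule distinct_concat)
    have disj: "set (basis_list i) \<inter> set (basis_list j) = {}" if "i \<in> set is" "j \<in> set is" "i \<noteq> j" for i j
      unfolding basis_list by (rule disjoint_basis_of) (use that "is"(3) in auto)
    have "inj_on basis_list (set is)"
    proof (rule inj_onI, rule ccontr)
      fix i j assume ij: "i \<in> set is" "j \<in> set is" "basis_list i = basis_list j" "i \<noteq> j"
      then have "set (basis_list i) = {}" using disj[OF ij(1,2,4)] by simp
      then show False using basis_list_nonempty[of i] ij(1) "is"(3) by auto
    qed
    then show "distinct (map basis_list is)" using "is"(2) by (simp add: distinct_map)
    show "distinct ys" if "ys \<in> set (map basis_list is)" for ys using that basis_list by auto
    show "set ys \<inter> set zs = {}" if "ys \<in> set (map basis_list is)" "zs \<in> set (map basis_list is)" "ys \<noteq> zs" for ys zs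
      using that disj by auto
  qed
  then have len: "length es = d" using distinct_card[of es] set_es "is"(5) by simp
  define e where "e k = es ! (k - 1)" for k
  have bij: "bij_betw e {1..d} (basis_union (set is))"
  proof (rule bij_betw_imageI)
    show inj: "inj_on e {1..d}"
      using \<open>distinct es\<close> len by (intro inj_onI) (auto simp: e_def nth_eq_iff_index_eq)
    have "e ` {1..d} \<subseteq> basis_union (set is)" using len by (auto simp: e_def set_es[symmetric])
    then show "e ` {1..d} = basis_union (set is)"
      using finite_basis_union[OF "is"(3)] card_image[OF inj] "is"(5) by (intro card_subset_eq) auto
  qed
  obtain T where T: "\<And>k. k < length es \<Longrightarrow> T k \<in> sandwich UNIV"
    "\<And>k e. k < length es \<Longrightarrow> e \<in> set es \<Longrightarrow> e \<noteq> es ! k \<Longrightarrow> T k e = 0"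
    "list_product (map (\<lambda>k. T k (es ! k)) [0..<length es]) \<noteq> 0"
    by (rule interpolation_operators[OF "is"(1,3,4), folded es_def]) (rule that, assumption+)
  let ?T = "\<lambda>k. T (k - 1)"
  have "map (\<lambda>k. ?T k (e k)) [1..<Suc d] = map (\<lambda>k. T k (es ! k)) [0..<length es]"
    using len by (intro nth_equalityI) (simp_all add: e_def del: upt_Suc)
  moreover have inj: "inj_on e {1..d}" using bij by (rule bij_betw_imp_inj_on)
  have zero: "T (k - 1) (e j) = 0" if kj: "k \<in> {1..d}" "j \<in> {1..d}" "j \<noteq> k" for k j
  proof (rule T(2))
    show "k - 1 < length es" using kj(1) len by auto
    show "e j \<in> set es" using bij_betwE[OF bij] kj(2) set_es by blast
    show "e j \<noteq> es ! (k - 1)" using inj_on_eq_iff[OF inj kj(2,1)] kj(3) by (simp add: e_def)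
  qed
  have "alternating_product d e ?T = list_product (map (\<lambda>k. ?T k (e k)) [1..<Suc d])"
    by (rule alternating_product_diagonal[OF inj]) (rule zero)
  ultimately have "alternating_product d e ?T \<noteq> 0" using T(3) by simp
  then have "\<exists>p h s. alternating_product d e (\<lambda>k x. p k * act (h k) x * s k) \<noteq> 0"
    using T(1) len by (intro alternating_product_basic[of d ?T]) auto
  then obtain p h s where "alternating_product d e (\<lambda>k x. p k * act (h k) x * s k) \<noteq> 0" by blast
  from alternating_multilin_of_product[OF this]
  obtain f \<psi> where "f \<in> multilin {1..3 * d}" "alternating {1..d} f" "\<forall>k\<in>{1..d}. \<psi> k = e k" "f \<psi> \<noteq> 0"
    by (elim exE conjE)
  then show thesis by (intro that[OF "is"(3) bij, of f \<psi>]) auto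
qed

text \<open>
  For a permutation \<open>\<sigma>\<close>, multiply \<open>f\<close> by the trace forms of \<open>z\<^bsub>\<sigma> i\<^esub>\<close> and \<open>y\<^sub>i\<close>. If the \<open>y\<close>s
  take values in the basis \<open>e\<close> and the \<open>z\<close>s in the dual basis, then the value is \<open>0\<close> or \<open>f \<psi>\<close>
  according to the entry of the matrix of \<open>\<sigma>\<close> on the tensor power. Hence independent
  permutation operators give independent functions.
\<close>

lemma trace_form_count:
  assumes I: "I \<subseteq> {1..q}" and e: "bij_betw e {1..d} (basis_union I)"
    and f: "f \<in> multilin {1..c}" "alternating {1..d} f" and dc: "d \<le> c"
    and \<psi>: "\<And>k. k \<in> {1..d} \<Longrightarrow> \<psi> k = e k" and nz: "f \<psi> \<noteq> 0"
  shows "d ^ (2 * m) \<le> H_codim scaleH scaleA act (c + 2 * m) * (m + 1) ^ (d * d)"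
proof -
  let ?E = "basis_union I"
  obtain S where S: "S \<subseteq> perms m"
    and ind: "indep_family (words m {..<d} \<times> words m {..<d}) (rearranges :: _ \<Rightarrow> _ \<Rightarrow> 'f) S"
    and card: "d ^ (2 * m) \<le> card S * (m + 1) ^ (d * d)"
    by (rule indep_family_permutations[where m = m and d = d])
  obtain e' where e': "\<And>k. k \<in> {1..d} \<Longrightarrow> e' k \<in> A.span ?E"
    and dual: "\<And>j k. j \<in> {1..d} \<Longrightarrow> k \<in> {1..d} \<Longrightarrow> A.mult_trace ?E (e' k * e j) = (if j = k then 1 else 0)"
    by (rule trace_dual_basis[OF I e]) blast
  \<comment> \<open>The \<open>y\<close>s have the indices after \<open>c\<close>, the \<open>z\<close>s those after \<open>c + m\<close>.\<close>
  define yy where "yy i = c + 1 + i" for i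
  define zz where "zz \<sigma> i = c + m + 1 + \<sigma> i" for \<sigma> :: "nat \<Rightarrow> nat" and i
  define traces where "traces \<sigma> p \<longleftrightarrow>
    (\<forall>\<psi>. (\<forall>k\<in>{1..d}. \<psi> k = e k) \<longrightarrow> (\<forall>i\<in>{..<m}. \<psi> (yy i) \<in> A.span ?E \<and> \<psi> (zz \<sigma> i) \<in> A.span ?E) \<longrightarrow>
       p \<psi> = scaleA (\<Prod>i\<in>{..<m}. A.mult_trace ?E (\<psi> (zz \<sigma> i) * \<psi> (yy i))) (f \<psi>))" for \<sigma> p
  have "\<forall>\<sigma>\<in>S. \<exists>p. p \<in> multilin {1..c + 2 * m} \<and> traces \<sigma> p"
  proof
    fix \<sigma> assume "\<sigma> \<in> S"
    then have \<sigma>: "\<sigma> permutes {..<m}" using S by auto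
    have lt: "\<sigma> i < m" if "i < m" for i using permutes_in_image[OF \<sigma>, of i] that by simp
    have "zz \<sigma> ` {..<m} = (\<lambda>i. c + m + 1 + i) ` (\<sigma> ` {..<m})" by (auto simp: zz_def)
    also have "\<dots> = (\<lambda>i. c + m + 1 + i) ` {..<m}" using permutes_image[OF \<sigma>] by simp
    finally have zz: "zz \<sigma> ` {..<m} = (\<lambda>i. c + m + 1 + i) ` {..<m}" .
    have cover: "{1..c} \<union> yy ` {..<m} \<union> zz \<sigma> ` {..<m} = {1..c + 2 * m}"
    proof (rule set_eqI)
      fix i
      have "i \<in> {1..c} \<union> yy ` {..<m} \<union> zz \<sigma> ` {..<m}" if i: "i \<in> {1..c + 2 * m}"
      proof -
        consider "i \<le> c" | "c < i" "i \<le> c + m" | "c + m < i" by linarith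
        then show ?thesis
        proof cases
          case 1
          then show ?thesis using i by simp
        next
          case 2
          then have "i = yy (i - c - 1)" "i - c - 1 < m" by (auto simp: yy_def)
          then show ?thesis by blast
        next
          case 3
          then have "i = c + m + 1 + (i - c - m - 1)" "i - c - m - 1 < m" using i by auto
          then show ?thesis unfolding zz by blast
        qed
      qed
      moreover have "i \<in> {1..c + 2 * m}" if "i \<in> {1..c} \<union> yy ` {..<m} \<union> zz \<sigma> ` {..<m}"
        using that unfolding zz by (auto simp: yy_def)
      ultimately show "i \<in> {1..c} \<union> yy ` {..<m} \<union> zz \<sigma> ` {..<m} \<longleftrightarrow> i \<in> {1..c + 2 * m}" by blast
    qed
    have "inj_on (zz \<sigma>) {..<m}" using permutes_inj_on[OF \<sigma>] by (auto simp: zz_def inj_on_def)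
    moreover have "inj_on yy {..<m}" by (auto simp: yy_def inj_on_def)
    moreover have "yy ` {..<m} \<inter> {1..c} = {}" "zz \<sigma> ` {..<m} \<inter> {1..c} = {}" "yy ` {..<m} \<inter> zz \<sigma> ` {..<m} = {}"
      by (auto simp: yy_def zz_def)
    moreover have "{1..d} \<subseteq> {1..c}" using dc by auto
    ultimately have "\<exists>f'. f' \<in> multilin ({1..c} \<union> yy ` {..<m} \<union> zz \<sigma> ` {..<m}) \<and> alternating {1..d} f' \<and> traces \<sigma> f'"
      unfolding traces_def
      using e f by (intro multiply_by_trace_forms independent_basis_union[OF I] basis_union_mult[OF I]) auto
    then show "\<exists>p. p \<in> multilin {1..c + 2 * m} \<and> traces \<sigma> p"
      unfolding cover by blast
  qed
  from bchoice[OF this] obtain p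
    where p_val: "\<forall>\<sigma>\<in>S. p \<sigma> \<in> multilin {1..c + 2 * m} \<and> traces \<sigma> (p \<sigma>)" ..
  have p: "p \<sigma> \<in> multilin {1..c + 2 * m}" if "\<sigma> \<in> S" for \<sigma>
    using p_val that by blast
  have val: "p \<sigma> \<psi> = scaleA (\<Prod>i\<in>{..<m}. A.mult_trace ?E (\<psi> (zz \<sigma> i) * \<psi> (yy i))) (f \<psi>)"
    if "\<sigma> \<in> S" "\<forall>k\<in>{1..d}. \<psi> k = e k"
      "\<forall>i\<in>{..<m}. \<psi> (yy i) \<in> A.span ?E \<and> \<psi> (zz \<sigma> i) \<in> A.span ?E" for \<sigma> \<psi>
    using p_val that unfolding traces_def by blast
  define \<chi> where "\<chi> a b i = (if i \<le> c then \<psi> i else if i \<le> c + m then e (a (i - c - 1) + 1)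
    else e' (b (i - c - m - 1) + 1))" for a b :: "nat \<Rightarrow> nat" and i
  have eval: "p \<sigma> (\<chi> a b) = scaleA (rearranges \<sigma> (a, b)) (f \<psi>)"
    if \<sigma>S: "\<sigma> \<in> S" and a: "a \<in> words m {..<d}" and b: "b \<in> words m {..<d}" for \<sigma> a b
  proof -
    have \<sigma>: "\<sigma> permutes {..<m}" using S \<sigma>S by auto
    have lt: "\<sigma> i < m" if "i < m" for i using permutes_in_image[OF \<sigma>, of i] that by simp
    have ad: "a i + 1 \<in> {1..d}" and bd: "b i + 1 \<in> {1..d}" if "i < m" for i
      using PiE_mem[OF a, of i] PiE_mem[OF b, of i] that by auto
    have \<chi>y: "\<chi> a b (yy i) = e (a i + 1)" and \<chi>z: "\<chi> a b (zz \<sigma> i) = e' (b (\<sigma> i) + 1)" if "i < m" for i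
      using that lt[OF that] by (auto simp: \<chi>_def yy_def zz_def)
    have e_span: "e k \<in> A.span ?E" if "k \<in> {1..d}" for k
      using bij_betwE[OF e] that by (intro A.span_base) blast
    have 1: "\<forall>k\<in>{1..d}. \<chi> a b k = e k" using \<psi> dc by (auto simp: \<chi>_def)
    have 2: "\<forall>i\<in>{..<m}. \<chi> a b (yy i) \<in> A.span ?E \<and> \<chi> a b (zz \<sigma> i) \<in> A.span ?E"
    proof
      fix i assume "i \<in> {..<m}"
      then have i: "i < m" by simp
      show "\<chi> a b (yy i) \<in> A.span ?E \<and> \<chi> a b (zz \<sigma> i) \<in> A.span ?E"
        unfolding \<chi>y[OF i] \<chi>z[OF i] using e_span[OF ad[OF i]] e'[OF bd[OF lt[OF i]]] by blast
    qed
    have "(\<Prod>i\<in>{..<m}. A.mult_trace ?E (\<chi> a b (zz \<sigma> i) * \<chi> a b (yy i))) = (\<Prod>i\<in>{..<m}. if a i = b (\<sigma> i) then 1 else 0)"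
    proof (intro prod.cong refl)
      fix i assume "i \<in> {..<m}"
      then have i: "i < m" by simp
      show "A.mult_trace ?E (\<chi> a b (zz \<sigma> i) * \<chi> a b (yy i)) = (if a i = b (\<sigma> i) then 1 else 0)"
        unfolding \<chi>y[OF i] \<chi>z[OF i] using dual[OF ad[OF i] bd[OF lt[OF i]]] by simp
    qed
    also have "\<dots> = rearranges \<sigma> (a, b)"
    proof (cases "a = b \<circ> \<sigma>")
      case True
      then show ?thesis by (simp add: rearranges_def)
    next
      case False
      have "\<exists>i<m. a i \<noteq> b (\<sigma> i)"
      proof (rule ccontr)
        assume "\<not> ?thesis"
        then have "a = b \<circ> \<sigma>"
          using PiE_ext[OF a words_comp_permutes[OF b \<sigma>]] by auto
        then show False using False by simp
      qed
      then show ?thesis using False by (auto simp: rearranges_def intro!: prod_zero)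
    qed
    finally have "p \<sigma> (\<chi> a b) = scaleA (rearranges \<sigma> (a, b)) (f (\<chi> a b))"
      using val[OF \<sigma>S 1 2] by simp
    also have "f (\<chi> a b) = f \<psi>" by (rule multilin_cong[OF f(1)]) (simp add: \<chi>_def)
    finally show ?thesis .
  qed
  have "card S \<le> H_codim scaleH scaleA act (c + 2 * m)"
  proof (rule H_codim_ge[OF _ _ p])
    show "c + 2 * m \<ge> 1" using dc d_pos by simp
    show "finite S" using S finite_permutations[of "{..<m}"] finite_subset by auto
    fix g assume g: "\<And>\<psi>. (\<Sum>s\<in>S. scaleA (g s) (p s \<psi>)) = 0"
    have "(\<Sum>s\<in>S. g s * rearranges s x) = 0" if xW: "x \<in> words m {..<d} \<times> words m {..<d}" for x
    proof -
      obtain a b where x: "x = (a, b)" "a \<in> words m {..<d}" "b \<in> words m {..<d}" using xW by blast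
      have "scaleA (\<Sum>s\<in>S. g s * rearranges s x) (f \<psi>) = (\<Sum>s\<in>S. scaleA (g s) (p s (\<chi> a b)))"
        unfolding A.scale_sum_left by (intro sum.cong refl) (simp add: eval x)
      then have "scaleA (\<Sum>s\<in>S. g s * rearranges s x) (f \<psi>) = 0" using g by simp
      then show ?thesis using nz by simp
    qed
    then show "\<forall>s\<in>S. g s = 0" using ind unfolding indep_family_def by blast
  qed simp
  then have "card S * (m + 1) ^ (d * d) \<le> H_codim scaleH scaleA act (c + 2 * m) * (m + 1) ^ (d * d)"
    by (rule mult_right_mono) simp
  then show ?thesis using card by linarith
qed

text \<open>
  The trace forms use up variables in pairs, so for odd \<open>n - 3 d\<close> one more variable is spent
  on a factor \<open>t (y)\<close>, evaluated at an element of trace \<open>1\<close>. For small \<open>n\<close> it suffices that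
  \<open>c\<^sub>n\<close> is positive.
\<close>

lemma lower_bound:
  assumes n: "n \<ge> 1"
  shows "d ^ n \<le> H_codim scaleH scaleA act n * n ^ (d * d) * d ^ (3 * d + 1)"
proof (cases "n \<le> 3 * d")
  case True
  have "d ^ n \<le> d ^ (3 * d + 1)" using True d_pos by (intro power_increasing) auto
  also have "\<dots> \<le> H_codim scaleH scaleA act n * n ^ (d * d) * d ^ (3 * d + 1)"
    using H_codim_pos[OF not_nilpotent n] n by simp
  finally show ?thesis .
next
  case False
  define m where "m = (n - 3 * d) div 2"
  obtain I e f \<psi> where st: "I \<subseteq> {1..q}" "bij_betw e {1..d} (basis_union I)"
    "f \<in> multilin {1..3 * d}" "alternating {1..d} f" "\<And>k. k \<in> {1..d} \<Longrightarrow> \<psi> k = e k" "f \<psi> \<noteq> 0"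
    by (rule alternating_start) blast
  have m_le: "m + 1 \<le> n" and m_ge: "n \<le> 2 * m + (3 * d + 1)"
    using False d_pos by (auto simp: m_def)
  have "d ^ (2 * m) \<le> H_codim scaleH scaleA act n * (m + 1) ^ (d * d)"
  proof (cases "even (n - 3 * d)")
    case True
    then have "n = 3 * d + 2 * m" using False by (simp add: m_def)
    then show ?thesis using trace_form_count[OF st(1-4) _ st(5,6), of m] by simp
  next
    case odd: False
    then have nm: "n = (3 * d + 1) + 2 * m" using False by (simp add: m_def odd_two_times_div_two_nat)
    let ?E = "basis_union I"
    obtain e' where e': "\<And>k. k \<in> {1..d} \<Longrightarrow> e' k \<in> A.span ?E"
      and dual: "\<And>j k. j \<in> {1..d} \<Longrightarrow> k \<in> {1..d} \<Longrightarrow> A.mult_trace ?E (e' k * e j) = (if j = k then 1 else 0)"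
      by (rule trace_dual_basis[OF st(1,2)]) blast
    have one: "1 \<in> {1..d}" using d_pos by simp
    define u where "u = e' 1 * e 1"
    have "e 1 \<in> A.span ?E" using bij_betwE[OF st(2)] one by (intro A.span_base) blast
    then have u: "u \<in> A.span ?E" using e'[OF one] basis_union_mult[OF st(1)] by (simp add: u_def subalgebra_def)
    have tr_u: "A.mult_trace ?E u = 1" using dual[OF one one] by (simp add: u_def)
    obtain g where g: "g \<in> multilin (insert (3 * d + 1) {1..3 * d})" "alternating {1..d} g"
      and val: "\<And>\<psi>. (\<And>k. k \<in> {1..d} \<Longrightarrow> \<psi> k = e k) \<Longrightarrow> \<psi> (3 * d + 1) \<in> A.span ?E \<Longrightarrow>
        g \<psi> = scaleA (A.mult_trace ?E (\<psi> (3 * d + 1))) (f \<psi>)"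
      by (rule multiply_by_trace[of "{1..d}" e ?E f "{1..3 * d}" "3 * d + 1"])
        (use st independent_basis_union[OF st(1)] basis_union_mult[OF st(1)] in auto)
    let ?\<psi> = "\<psi>(3 * d + 1 := u)"
    have "g ?\<psi> = scaleA (A.mult_trace ?E (?\<psi> (3 * d + 1))) (f ?\<psi>)"
      by (rule val) (use st(5) u in auto)
    also have "\<dots> = f ?\<psi>" by (simp add: tr_u)
    also have "f ?\<psi> = f \<psi>" by (rule multilin_cong[OF st(3)]) auto
    finally have nz: "g ?\<psi> \<noteq> 0" using st(6) by simp
    have "insert (3 * d + 1) {1..3 * d} = {1..3 * d + 1}" by auto
    then have "g \<in> multilin {1..3 * d + 1}" using g(1) by simp
    then have "d ^ (2 * m) \<le> H_codim scaleH scaleA act ((3 * d + 1) + 2 * m) * (m + 1) ^ (d * d)"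
      by (rule trace_form_count[OF st(1,2) _ g(2) _ _ nz]) (use st(5) in auto)
    then show ?thesis using nm by simp
  qed
  also have "\<dots> \<le> H_codim scaleH scaleA act n * n ^ (d * d)"
    using m_le by (intro mult_left_mono power_mono) auto
  finally have "d ^ (2 * m) * d ^ (3 * d + 1) \<le> H_codim scaleH scaleA act n * n ^ (d * d) * d ^ (3 * d + 1)"
    by (rule mult_right_mono) simp
  moreover have "d ^ n \<le> d ^ (2 * m) * d ^ (3 * d + 1)"
    unfolding power_add[symmetric] using m_ge d_pos by (intro power_increasing) auto
  ultimately show ?thesis by linarith
qed

end

theorem theorem6:
  fixes scaleH :: "'f::{alg_closed_field, field_char_0} \<Rightarrow> 'h::ring_1 \<Rightarrow> 'h"
    and scaleA :: "'f \<Rightarrow> 'a::ring \<Rightarrow> 'a"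
    and act :: "'h \<Rightarrow> 'a \<Rightarrow> 'a"
    and J B :: "'a set"
    and Bs :: "nat \<Rightarrow> 'a set"
    and q d :: nat
  assumes "generalized_action scaleH scaleA act"
    and "finite_dim scaleA"
    and "\<not> nilpotent_algebra (UNIV :: 'a set)"
    and "J = jacobson_radical scaleA UNIV"
    and "invariant act J"
    and "subalgebra scaleA B"
    and "invariant act B"
    and "B \<inter> J = {0}"
    and "\<forall>a. \<exists>b\<in>B. \<exists>j\<in>J. a = b + j"
    and "direct_sum_of B {1..q} Bs"
    and "\<forall>i\<in>{1..q}. two_sided_ideal scaleA B (Bs i) \<and> invariant act (Bs i) \<and>
           H_simple scaleA act (Bs i) \<and> semisimple_algebra scaleA (Bs i)"
    and "d = exponent_d scaleA J Bs q"
  shows "\<exists>C1 C2 r1 r2 :: real. C1 > 0 \<and> C2 > 0 \<and>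
    (\<forall>n::nat. n \<ge> 1 \<longrightarrow>
       C1 * real n powr r1 * real d ^ n \<le> real (H_codim scaleH scaleA act n) \<and>
       real (H_codim scaleH scaleA act n) \<le> C2 * real n powr r2 * real d ^ n)"
proof -
  interpret act: generalized_action scaleH scaleA act by fact
  obtain S where S: "finite S" "act.A.span S = UNIV"
    using assms(2) unfolding finite_dim_def by blast
  obtain Basis where Basis: "Basis \<subseteq> S" "act.A.independent Basis" "S \<subseteq> act.A.span Basis"
    using act.A.maximal_independent_subset[of S] by metis
  have fin: "finite Basis" using Basis(1) S(1) finite_subset by blast
  have "act.A.span S \<subseteq> act.A.span Basis" using Basis(3) by (intro act.A.span_minimal) auto
  then have span: "act.A.span Basis = UNIV" using S(2) by blast
  interpret wm: wedderburn_action scaleH scaleA act Basis J B Bs q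
    by unfold_locales (use assms fin Basis(2) span in auto)
  have d: "wm.d = d" using assms(12) by (simp add: wm.d_def)
  have d_pos: "real d > 0" using wm.d_pos by (simp add: d)
  obtain C m where upper: "\<And>n. n \<ge> 1 \<Longrightarrow> H_codim scaleH scaleA act n \<le> C * n ^ m * d ^ n"
    using wm.upper_bound unfolding d by blast
  define C1 where "C1 = 1 / real d ^ (3 * d + 1)"
  show ?thesis
  proof (rule exI[of _ C1], rule exI[of _ "real C + 1"], rule exI[of _ "- real (d * d)"],
      rule exI[of _ "real m"], intro conjI allI impI)
    show "C1 > 0" using d_pos by (simp add: C1_def)
    show "real C + 1 > 0" by simp
  next
    fix n :: nat assume n: "n \<ge> 1"
    have "real (d ^ n) \<le> real (H_codim scaleH scaleA act n * n ^ (d * d) * d ^ (3 * d + 1))"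
      using wm.lower_bound[OF n] unfolding d by (rule of_nat_mono)
    then have "real d ^ n / (real n ^ (d * d) * real d ^ (3 * d + 1)) \<le> real (H_codim scaleH scaleA act n)"
      using n d_pos by (subst pos_divide_le_eq) (simp_all add: mult_ac)
    moreover have "real n powr - real (d * d) = 1 / real n ^ (d * d)"
      using n powr_realpow[of "real n" "d * d"] by (simp add: powr_minus inverse_eq_divide del: of_nat_mult)
    ultimately show "C1 * real n powr - real (d * d) * real d ^ n \<le> real (H_codim scaleH scaleA act n)"
      by (simp add: C1_def mult_ac)
  next
    fix n :: nat assume n: "n \<ge> 1"
    have "real (H_codim scaleH scaleA act n) \<le> real (C * n ^ m * d ^ n)"
      using upper[OF n] by (rule of_nat_mono)
    also have "\<dots> \<le> (real C + 1) * real n ^ m * real d ^ n"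
      by (simp add: mult_right_mono)
    finally show "real (H_codim scaleH scaleA act n) \<le> (real C + 1) * real n powr real m * real d ^ n"
      using n by (simp add: powr_realpow)
  qed
qed

end
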